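(* Let $\beta>1$ and let $\varepsilon\in(0,m_+)$ be irrational. For every $n\in\mathbb{N}$, $n\ge 1$, there exists a unique probability distribution $\nu^n_\infty$ on $E_n^\varepsilon$ (called the quasi-stationary distribution) such that the following holds. For every $\eta\in(\varepsilon,m_+)$ there exist $c,C>0$ (independent of $n$) such that, for every $n\ge 1$, every initial condition $m_0^n\in[\eta,1]\cap E_n^\varepsilon$ and every $t\ge 0$, $$d_{TV}(\nu^n_t,\nu^n_\infty)\le C\,n\,e^{-ct},$$ where $\nu^n_t=\mathcal{L}(m^n_t\mid\tau_n>t)$ is the law of $m^n_t$, started from $m_0^n$, conditionally on $\{\tau_n>t\}$.
   Context: For $n\ge1$ let $E_n=\{-1+\frac{2i}{n}: i=0,\dots,n\}$. The (Curie-Weiss) magnetization process $(m^n_t)_{t\ge0}$ is the continuous-time Markov chain on $E_n$ jumping from $m$ to $m+\frac2n$ at rate $\lambda^n_+(m)=n\frac{1-m}{2}e^{\beta m}$ and from $m$ to $m-\frac2n$ at rate $\lambda^n_-(m)=n\frac{1+m}{2}e^{-\beta m}$. For $\beta>1$, $m_+\in(0,1)$ denotes the unique positive solution of $(1-m)e^{\beta m}=(1+m)e^{-\beta m}$. The number $\varepsilon\in(0,m_+)$ is fixed and irrational (so that $\varepsilon\notin E_n$ for all $n$); $E_n^\varepsilon=E_n\cap[\varepsilon,1]$ and $\tau_n=\inf\{t\ge0: m^n_t\le\varepsilon\}$. The total variation distance is normalized as $d_{TV}(\mu,\nu)=\sup_{\|f\|_\infty\le1}\int f\,(d\mu-d\nu)$.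 *)

theory Defs
  imports "HOL-Probability.Probability"
begin

section \<open>Continuous-time Markov chains on a finite state space\<close>

definition transition_semigroup :: "'s set \<Rightarrow> (real \<Rightarrow> 's \<Rightarrow> 's \<Rightarrow> real) \<Rightarrow> bool" where
  "transition_semigroup S P \<longleftrightarrow>
     (\<forall>t\<ge>0. \<forall>x\<in>S. (\<forall>y\<in>S. 0 \<le> P t x y) \<and> (\<Sum>y\<in>S. P t x y) = 1) \<and>
     (\<forall>x\<in>S. \<forall>y\<in>S. P 0 x y = of_bool (x = y)) \<and>
     (\<forall>s\<ge>0. \<forall>t\<ge>0. \<forall>x\<in>S. \<forall>y\<in>S. P (s + t) x y = (\<Sum>z\<in>S. P s x z * P t z y))"

text \<open>Only the off-diagonal rates are prescribed; as \<open>S\<close> is finite and the rows of \<open>P t\<close> sum to 1,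
  the diagonal of the generator is then determined.\<close>

definition has_jump_rates ::
  "'s set \<Rightarrow> (real \<Rightarrow> 's \<Rightarrow> 's \<Rightarrow> real) \<Rightarrow> ('s \<Rightarrow> 's \<Rightarrow> real) \<Rightarrow> bool" where
  "has_jump_rates S P q \<longleftrightarrow>
     (\<forall>x\<in>S. \<forall>y\<in>S. x \<noteq> y \<longrightarrow>
        ((\<lambda>t. P t x y) has_real_derivative q x y) (at 0 within {0..}))"

text \<open>The elementary Markov property
  \<open>Pr(X (u (k+1)) = x (k+1) | X (u 0) = x 0, \<dots>, X (u k) = x k) = P (u (k+1) - u k) (x k) (x (k+1))\<close>,
  multiplied out so that conditioning events of probability 0 need no special treatment.\<close>

definition markov_property ::
  "'a measure \<Rightarrow> (real \<Rightarrow> 'a \<Rightarrow> 's) \<Rightarrow> 's set \<Rightarrow> (real \<Rightarrow> 's \<Rightarrow> 's \<Rightarrow> real) \<Rightarrow> bool" where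
  "markov_property M X S P \<longleftrightarrow>
     (\<forall>k. \<forall>u :: nat \<Rightarrow> real. \<forall>x :: nat \<Rightarrow> 's.
        0 \<le> u 0 \<and> (\<forall>i\<le>k. u i \<le> u (Suc i)) \<and> (\<forall>i\<le>Suc k. x i \<in> S) \<longrightarrow>
        measure M {\<omega> \<in> space M. \<forall>i\<le>Suc k. X (u i) \<omega> = x i} =
        measure M {\<omega> \<in> space M. \<forall>i\<le>k. X (u i) \<omega> = x i} * P (u (Suc k) - u k) (x k) (x (Suc k)))"

text \<open>Right-continuity of the paths is with respect to the discrete topology on the finite set \<open>S\<close>.\<close>

definition markov_chain ::
  "'a measure \<Rightarrow> (real \<Rightarrow> 'a \<Rightarrow> 's) \<Rightarrow> 's set \<Rightarrow> ('s \<Rightarrow> 's \<Rightarrow> real) \<Rightarrow> 's \<Rightarrow> bool" where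
  "markov_chain M X S q x0 \<longleftrightarrow>
     prob_space M \<and> finite S \<and>
     (\<forall>t\<ge>0. X t \<in> measurable M (count_space S)) \<and>
     (AE \<omega> in M. X 0 \<omega> = x0) \<and>
     (\<forall>\<omega>\<in>space M. \<forall>t\<ge>0. \<forall>\<^sub>F s in at_right t. X s \<omega> = X t \<omega>) \<and>
     (\<exists>P. transition_semigroup S P \<and> has_jump_rates S P q \<and> markov_property M X S P)"


section \<open>The Curie-Weiss magnetization process\<close>

definition E :: "nat \<Rightarrow> real set" where
  "E n = (\<lambda>i. -1 + 2 * real i / real n) ` {0..n}"

definition E_eps :: "real \<Rightarrow> nat \<Rightarrow> real set" where
  "E_eps \<epsilon> n = E n \<inter> {\<epsilon>..1}"

definition rate_up :: "real \<Rightarrow> nat \<Rightarrow> real \<Rightarrow> real" where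
  "rate_up \<beta> n m = real n * ((1 - m) / 2) * exp (\<beta> * m)"

definition rate_down :: "real \<Rightarrow> nat \<Rightarrow> real \<Rightarrow> real" where
  "rate_down \<beta> n m = real n * ((1 + m) / 2) * exp (- \<beta> * m)"

definition jump_rate :: "real \<Rightarrow> nat \<Rightarrow> real \<Rightarrow> real \<Rightarrow> real" where
  "jump_rate \<beta> n m m' =
     (if m' = m + 2 / real n then rate_up \<beta> n m
      else if m' = m - 2 / real n then rate_down \<beta> n m
      else 0)"

definition m_plus :: "real \<Rightarrow> real" where
  "m_plus \<beta> = (THE m. 0 < m \<and> (1 - m) * exp (\<beta> * m) = (1 + m) * exp (- \<beta> * m))"

lemma ex1_m_plus:
  assumes "\<beta> > 1"
  shows "\<exists>!m. 0 < m \<and> (1 - m) * exp (\<beta> * m) = (1 + m) * exp (- \<beta> * m)"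
    and "0 < m_plus \<beta>" "m_plus \<beta> < 1"
    and "(1 - m_plus \<beta>) * exp (\<beta> * m_plus \<beta>) = (1 + m_plus \<beta>) * exp (- \<beta> * m_plus \<beta>)"
proof -
  define F where "F m = (1 - m) * exp (\<beta> * m) - (1 + m) * exp (- \<beta> * m)" for m :: real
  define h where "h m = 2 * \<beta> * m + ln (1 - m) - ln (1 + m)" for m :: real
  have lt1: "m < 1" if "0 < m" "F m = 0" for m
  proof (rule ccontr)
    assume "\<not> m < 1"
    then have "(1 - m) * exp (\<beta> * m) \<le> 0"
      by (simp add: mult_nonpos_nonneg)
    moreover have "(1 + m) * exp (- \<beta> * m) > 0"
      using that by (intro mult_pos_pos) auto
    ultimately show False using that unfolding F_def by linarith
  qed
  have h0: "h m = 0" if "0 < m" "F m = 0" for m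
  proof -
    have m1: "m < 1" using lt1 that by blast
    have "ln ((1 - m) * exp (\<beta> * m)) = ln ((1 + m) * exp (- \<beta> * m))"
      using that by (simp add: F_def)
    then show ?thesis using m1 that by (simp add: ln_mult h_def)
  qed
  have dh: "(h has_real_derivative 2 * \<beta> - 2 / (1 - m\<^sup>2)) (at m)" if "0 \<le> m" "m < 1" for m
  proof -
    have "(h has_real_derivative 2 * \<beta> + (-1) / (1 - m) - 1 / (1 + m)) (at m)"
      unfolding h_def using that by (auto intro!: derivative_eq_intros)
    moreover have "2 * \<beta> + (-1) / (1 - m) - 1 / (1 + m) = 2 * \<beta> - 2 / (1 - m\<^sup>2)"
    proof -
      have "1 - m\<^sup>2 = (1 - m) * (1 + m)" by (simp add: power2_eq_square algebra_simps)
      moreover have "1 / (1 - m) + 1 / (1 + m) = 2 / ((1 - m) * (1 + m))"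
        using that by (simp add: field_simps)
      ultimately show ?thesis by simp
    qed
    ultimately show ?thesis by (simp only:)
  qed
  have rolle: "\<exists>z. a < z \<and> z < b \<and> 1 - z\<^sup>2 = 1 / \<beta>"
    if ab: "0 \<le> a" "a < b" "b < 1" "h a = 0" "h b = 0" for a b
  proof -
    obtain z where z: "a < z" "z < b" "h b - h a = (b - a) * (2 * \<beta> - 2 / (1 - z\<^sup>2))"
    proof -
      have "\<exists>z>a. z < b \<and> h b - h a = (b - a) * (2 * \<beta> - 2 / (1 - z\<^sup>2))"
        by (rule MVT2[OF \<open>a < b\<close>], rule dh) (use ab in linarith)+
      then show ?thesis using that by blast
    qed
    then have "2 * \<beta> = 2 / (1 - z\<^sup>2)" using that by simp
    moreover have "1 - z\<^sup>2 > 0"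
    proof -
      have "\<bar>z\<bar> < 1" using z that by linarith
      then show ?thesis by (simp add: abs_square_less_1)
    qed
    ultimately have "1 - z\<^sup>2 = 1 / \<beta>" using assms by (simp add: field_simps)
    then show ?thesis using z by blast
  qed
  have less: False if ab: "0 < a" "a < b" "F a = 0" "F b = 0" for a b
  proof -
    have b1: "b < 1" using lt1 ab by force
    obtain z1 where z1: "0 < z1" "z1 < a" "1 - z1\<^sup>2 = 1 / \<beta>"
      using rolle[of 0 a] h0[of a] ab b1 by (auto simp: h_def)
    obtain z2 where z2: "a < z2" "z2 < b" "1 - z2\<^sup>2 = 1 / \<beta>"
      using rolle[of a b] h0[of a] h0[of b] ab b1 by auto
    have "z1\<^sup>2 = z2\<^sup>2" using z1 z2 by linarith
    then show False using z1 z2 by (simp add: power2_eq_iff_nonneg)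
  qed
  have dF: "(F has_real_derivative 2 * \<beta> - 2) (at 0)"
    unfolding F_def by (auto intro!: derivative_eq_intros)
  obtain d where d: "d > 0" "\<And>x. 0 < x \<Longrightarrow> x < d \<Longrightarrow> F 0 < F (0 + x)"
    using DERIV_pos_inc_right[OF dF] assms by auto
  define a where "a = min (d / 2) (1 / 2)"
  have a: "0 < a" "a < 1" "F a > 0"
    using d(1) d(2)[of a] by (auto simp: a_def F_def min_def split: if_splits)
  have "F 1 \<le> 0" by (simp add: F_def)
  moreover have "continuous_on {a..1} F" unfolding F_def by (intro continuous_intros)
  ultimately obtain m where m: "a \<le> m" "m \<le> 1" "F m = 0"
    using IVT2'[of F 1 0 a] a by auto
  show ex1: "\<exists>!m. 0 < m \<and> (1 - m) * exp (\<beta> * m) = (1 + m) * exp (- \<beta> * m)"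
  proof (rule ex1I[of _ m])
    show "0 < m \<and> (1 - m) * exp (\<beta> * m) = (1 + m) * exp (- \<beta> * m)"
      using m a by (simp add: F_def)
    fix x assume "0 < x \<and> (1 - x) * exp (\<beta> * x) = (1 + x) * exp (- \<beta> * x)"
    then have "0 < x" "F x = 0" by (auto simp: F_def)
    then show "x = m" using less[of x m] less[of m x] m a by force
  qed
  note P = theI'[OF ex1, folded m_plus_def]
  show "0 < m_plus \<beta>"
    and "(1 - m_plus \<beta>) * exp (\<beta> * m_plus \<beta>) = (1 + m_plus \<beta>) * exp (- \<beta> * m_plus \<beta>)"
    using P by auto
  then show "m_plus \<beta> < 1" using lt1[of "m_plus \<beta>"] by (simp add: F_def)
qed

text \<open>The extended reals make the infimum over the empty set equal to \<open>\<infinity>\<close>.\<close>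

definition hitting_time :: "(real \<Rightarrow> 'a \<Rightarrow> real) \<Rightarrow> real \<Rightarrow> 'a \<Rightarrow> ereal" where
  "hitting_time X \<epsilon> \<omega> = (INF t\<in>{t. 0 \<le> t \<and> X t \<omega> \<le> \<epsilon>}. ereal t)"

definition conditional_law ::
  "'a measure \<Rightarrow> (real \<Rightarrow> 'a \<Rightarrow> real) \<Rightarrow> real \<Rightarrow> real \<Rightarrow> real measure" where
  "conditional_law M X \<epsilon> t =
     distr (uniform_measure M {\<omega> \<in> space M. ereal t < hitting_time X \<epsilon> \<omega>})
       (count_space UNIV) (X t)"

text \<open>With this normalization the distance of mutually singular probability measures is 2.\<close>

definition d_TV :: "'b measure \<Rightarrow> 'b measure \<Rightarrow> real" where
  "d_TV \<mu> \<nu> =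
     (SUP f\<in>{f. f \<in> borel_measurable \<mu> \<and> f \<in> borel_measurable \<nu> \<and> (\<forall>x. \<bar>f x\<bar> \<le> 1)}.
        (\<integral>x. f x \<partial>\<mu>) - (\<integral>x. f x \<partial>\<nu>))"

end

theory Submission
  imports Defs "HOL-Real_Asymp.Real_Asymp"
begin

text \<open>
  Index the states above \<open>\<epsilon>\<close> by \<open>1, \<dots>, N\<close> and let \<open>L\<close> be the generator killed at \<open>0\<close>. Observing the path on
  a grid of mesh \<open>\<delta>\<close> shows that \<open>E(f (X t); \<tau> > t)\<close> is the limit of \<open>(I + \<delta> L)^k f\<close> with \<open>k \<delta> \<rightarrow> t\<close>, so
  everything can be done for the Euler scheme. Let \<open>v k = (I + \<delta> L)^k 1\<close> and \<open>G k = (I + \<delta> L)^k g / v k\<close>.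
  Later values of \<open>G\<close> are averages of earlier ones, so an exponential bound on the oscillation of
  \<open>G k\<close> gives both the existence of the limit and the rate.

  For large \<open>n\<close> the increments of \<open>G\<close> are compared with the weight \<open>w m = 1 / (m cosh (\<beta> m))\<close>, for which
  the weighted drift \<open>2 (tanh (\<beta> m) / m - 1)\<close> is strictly decreasing. Conditioning on survival
  perturbs the jump rates, but the perturbation has the favourable sign where the drift is positive and
  is exponentially small in \<open>n\<close> elsewhere, because it loses a factor \<open>\<theta> < 1\<close> at each site between \<open>\<epsilon>\<close>
  and a neighbourhood of \<open>m_plus\<close>. Summing up at most \<open>n\<close> increments gives the factor \<open>n\<close>. The finitely
  many remaining \<open>n\<close> are covered by a Doeblin minorization.
\<close>

section \<open>Killed birth-death chains\<close>

text \<open>The ratio \<open>G\<close> evolves by the chain conditioned to survive, a Doob transform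
  with rates \<open>a i * v (Suc i) / v i\<close> and \<open>b i * v (i - 1) / v i\<close> that
  depend on time through \<open>v\<close>. Its increments \<open>D i = G (Suc i) - G i\<close> solve
  a closed birth-death recursion with nonnegative coefficients. Hence a bound
  \<open>\<bar>D i\<bar> \<le> C * w i\<close> is preserved, with exponential gain, as soon as the
  up rate times \<open>w i\<close> minus the down rate times \<open>w (i - 1)\<close> drops by a
  multiple of \<open>w i\<close> from each site to the next. Without the conditioning and for large
  n this says that drift times weight has a negative derivative. The drift itself increases near 0,
  so constant weights fail when \<epsilon> is small; this forces a weight that varies. Positivity of
  I + \<delta> L is behind the averaging property: a bracket
  \<open>lo * v \<le> u \<le> hi * v\<close> survives every later step, so one bracket serves all
  later times and all sites at once. In the Euler scheme this is elementary as soon as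
  \<open>\<delta> * R \<le> 1\<close>, and the constants obtained do not depend on the mesh.\<close>

locale killed_birth_death =
  fixes N :: nat and a b :: "nat \<Rightarrow> real" and R :: real
  assumes N_pos: "1 \<le> N" and R_pos: "0 < R" and a_top: "a N = 0"
    and a_nonneg: "\<And>i. 1 \<le> i \<Longrightarrow> i \<le> N \<Longrightarrow> 0 \<le> a i"
    and b_nonneg: "\<And>i. 1 \<le> i \<Longrightarrow> i \<le> N \<Longrightarrow> 0 \<le> b i"
    and rate_le: "\<And>i j. 1 \<le> i \<Longrightarrow> i \<le> N \<Longrightarrow> 1 \<le> j \<Longrightarrow> j \<le> N \<Longrightarrow> a i + b j \<le> R"
begin

definition gen :: "(nat \<Rightarrow> real) \<Rightarrow> nat \<Rightarrow> real" where
  "gen u i = a i * (u (Suc i) - u i) - b i * (u i - u (i - 1))"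

text \<open>One Euler step I + \<delta> L. Index 0 is the cemetery, where the result is kept at 0;
  as \<open>a N = 0\<close>, values beyond \<open>N\<close> do not influence the sites up to
  \<open>N\<close>.\<close>

definition step :: "real \<Rightarrow> (nat \<Rightarrow> real) \<Rightarrow> nat \<Rightarrow> real" where
  "step \<delta> u i = (if i = 0 then 0 else u i + \<delta> * gen u i)"

text \<open>The terminal payoff 1: for \<open>\<delta> * R \<le> 1\<close> its \<open>k\<close>-th
  iterate is the probability that the scheme has not been killed within \<open>k\<close>
  steps.\<close>

definition alive :: "nat \<Rightarrow> real" where
  "alive i = of_bool (0 < i)"

lemma step_0 [simp]: "step \<delta> u 0 = 0"
  by (simp add: step_def)

lemma alive_0 [simp]: "alive 0 = 0"
  by (simp add: alive_def)

lemma alive_pos [simp]: "0 < i \<Longrightarrow> alive i = 1"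
  by (simp add: alive_def)

lemma alive_le_1 [simp]: "alive i \<le> 1"
  by (simp add: alive_def)

lemma iter_step_0: "u 0 = 0 \<Longrightarrow> (step \<delta> ^^ k) u 0 = 0"
  by (cases k) auto

text \<open>The coefficients add up to 1 and are nonnegative once
  \<open>\<delta> * R \<le> 1\<close>; monotonicity, positivity and the holding bounds all come from
  this form.\<close>

lemma step_convex:
  "1 \<le> i \<Longrightarrow> step \<delta> u i =
     (1 - \<delta> * (a i + b i)) * u i + \<delta> * a i * u (Suc i) + \<delta> * b i * u (i - 1)"
  by (simp add: step_def gen_def algebra_simps)

lemma step_linear: "step \<delta> (\<lambda>i. c * u i + d * v i) = (\<lambda>i. c * step \<delta> u i + d * step \<delta> v i)"
  by (rule ext) (simp add: step_def gen_def algebra_simps)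

lemma iter_step_linear:
  "(step \<delta> ^^ k) (\<lambda>i. c * u i + d * v i) = (\<lambda>i. c * (step \<delta> ^^ k) u i + d * (step \<delta> ^^ k) v i)"
  by (induction k) (simp_all add: step_linear)

lemma step_mono:
  assumes "0 \<le> \<delta>" "\<delta> * R \<le> 1" and uv: "\<And>i. i \<le> N \<Longrightarrow> u i \<le> v i" and i: "i \<le> N"
  shows "step \<delta> u i \<le> step \<delta> v i"
proof (cases "i = 0")
  case False
  then have i1: "1 \<le> i" by simp
  have "\<delta> * (a i + b i) \<le> 1"
    using mult_left_mono[OF rate_le[OF i1 i i1 i] assms(1)] assms(2) by linarith
  then have "(1 - \<delta> * (a i + b i)) * u i \<le> (1 - \<delta> * (a i + b i)) * v i"
    using uv[OF i] by (intro mult_left_mono) auto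
  moreover have "\<delta> * a i * u (Suc i) \<le> \<delta> * a i * v (Suc i)"
  proof (cases "i = N")
    case False
    then show ?thesis using i a_nonneg[OF i1 i] assms(1) by (intro mult_left_mono uv) auto
  qed (simp add: a_top)
  moreover have "\<delta> * b i * u (i - 1) \<le> \<delta> * b i * v (i - 1)"
    using i b_nonneg[OF i1 i] assms(1) by (intro mult_left_mono uv) auto
  ultimately show ?thesis by (simp add: step_convex[OF i1])
qed simp

lemma iter_step_mono:
  assumes "0 \<le> \<delta>" "\<delta> * R \<le> 1" and "\<And>i. i \<le> N \<Longrightarrow> u i \<le> v i" and "i \<le> N"
  shows "(step \<delta> ^^ k) u i \<le> (step \<delta> ^^ k) v i"
  using assms(4)
proof (induction k arbitrary: i)
  case (Suc k)
  then show ?case using step_mono[OF assms(1,2)] by simp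
qed (use assms in auto)

lemma iter_step_nonneg:
  assumes "0 \<le> \<delta>" "\<delta> * R \<le> 1" and "\<And>i. i \<le> N \<Longrightarrow> 0 \<le> u i" and "i \<le> N"
  shows "0 \<le> (step \<delta> ^^ k) u i"
proof -
  have "(step \<delta> ^^ k) (\<lambda>_. 0) = (\<lambda>_. 0)"
    by (induction k) (auto simp: step_def gen_def)
  then show ?thesis using iter_step_mono[OF assms(1,2), of "\<lambda>_. 0" u i k] assms(3,4) by simp
qed

text \<open>The averaging property of the ratio \<open>u / v\<close>, written without division
  because \<open>v\<close> vanishes at the cemetery.\<close>

lemma step_sandwich:
  assumes "0 \<le> \<delta>" "\<delta> * R \<le> 1" and u: "\<And>i. i \<le> N \<Longrightarrow> lo * v i \<le> u i \<and> u i \<le> hi * v i"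
    and i: "i \<le> N"
  shows "lo * (step \<delta> ^^ k) v i \<le> (step \<delta> ^^ k) u i \<and> (step \<delta> ^^ k) u i \<le> hi * (step \<delta> ^^ k) v i"
  using iter_step_mono[OF assms(1,2), of "\<lambda>i. lo * v i" u i k]
    iter_step_mono[OF assms(1,2), of u "\<lambda>i. hi * v i" i k] u i
    iter_step_linear[where v = v and d = 0 and u = v and \<delta> = \<delta> and k = k and c = lo]
    iter_step_linear[where v = v and d = 0 and u = v and \<delta> = \<delta> and k = k and c = hi]
  by simp

section \<open>Survival probabilities: decreasing in time, increasing in the site\<close>

lemma gen_alive_nonpos: "1 \<le> i \<Longrightarrow> i \<le> N \<Longrightarrow> gen alive i \<le> 0"
  using b_nonneg[of i] by (auto simp: gen_def alive_def)

lemma step_le: "1 \<le> i \<Longrightarrow> 0 \<le> \<delta> \<Longrightarrow> gen v i \<le> 0 \<Longrightarrow> step \<delta> v i \<le> v i"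
  by (simp add: step_def mult_nonneg_nonpos)

text \<open>At living sites \<open>gen v \<le> 0\<close> means
  \<open>step \<delta> v \<le> v\<close>, and monotonicity of \<open>step\<close> propagates the
  latter.\<close>

lemma gen_iter_alive_nonpos:
  assumes "0 < \<delta>" "\<delta> * R \<le> 1" "1 \<le> i" "i \<le> N"
  shows "gen ((step \<delta> ^^ k) alive) i \<le> 0"
  using assms(3,4)
proof (induction k arbitrary: i)
  case (Suc k)
  let ?v = "(step \<delta> ^^ k) alive"
  have "step \<delta> ?v j \<le> ?v j" if "j \<le> N" for j
    using Suc.IH[of j] that assms(1) step_le[of j \<delta> ?v] iter_step_0[where u = alive and \<delta> = \<delta> and k = k]
    by (cases "j = 0") auto
  then have "step \<delta> (step \<delta> ?v) i \<le> step \<delta> ?v i"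
    using step_mono[of \<delta> "step \<delta> ?v" ?v i] assms Suc.prems by auto
  then have "\<delta> * gen (step \<delta> ?v) i \<le> 0"
    using Suc.prems by (subst (asm) (1) step_def) auto
  then show ?case using assms(1) by (simp add: mult_le_0_iff)
qed (use gen_alive_nonpos in auto)

text \<open>The probability of never moving: every step holds with weight at least
  \<open>1 - \<delta> * R\<close>.\<close>

lemma iter_alive_lower:
  assumes "0 \<le> \<delta>" "\<delta> * R \<le> 1" "1 \<le> i" "i \<le> N"
  shows "(1 - \<delta> * R) ^ k \<le> (step \<delta> ^^ k) alive i"
  using assms(3,4)
proof (induction k arbitrary: i)
  case (Suc k)
  let ?v = "(step \<delta> ^^ k) alive"
  have v: "0 \<le> ?v j" if "j \<le> N" for j
    using iter_step_nonneg[OF assms(1,2)] that by (simp add: alive_def)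
  have "\<delta> * (a i + b i) \<le> \<delta> * R"
    using mult_left_mono[OF rate_le assms(1)] Suc.prems by auto
  then have "(1 - \<delta> * R) * (1 - \<delta> * R) ^ k \<le> (1 - \<delta> * (a i + b i)) * ?v i"
    using Suc assms(2) by (intro mult_mono) auto
  moreover have "0 \<le> \<delta> * a i * ?v (Suc i)"
    using a_nonneg[of i] a_top v[of "Suc i"] Suc.prems assms(1) by (cases "i = N") auto
  moreover have "0 \<le> \<delta> * b i * ?v (i - 1)"
    using b_nonneg[of i] v[of "i - 1"] Suc.prems assms(1) by auto
  ultimately show ?case using Suc.prems by (simp add: step_convex)
qed (auto simp: alive_def)

text \<open>The increments of \<open>step \<delta> v\<close> are nonnegative combinations of those
  of \<open>v\<close>. The coefficient of \<open>v (Suc i) - v i\<close> couples the up rate at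
  \<open>i\<close> with the down rate at \<open>Suc i\<close>, which is why \<open>rate_le\<close>
  compares two different sites. At the cemetery only \<open>0 \<le> step \<delta> v 1\<close> has to
  be shown.\<close>

lemma step_increasing:
  assumes "0 \<le> \<delta>" "\<delta> * R \<le> 1" "v 0 = 0" and inc: "\<And>i. i < N \<Longrightarrow> v i \<le> v (Suc i)" and i: "i < N"
  shows "step \<delta> v i \<le> step \<delta> v (Suc i)"
proof (cases "i = 0")
  case True
  have "0 \<le> v j" if "j \<le> N" for j
    using that
  proof (induction j)
    case (Suc j)
    then show ?case using inc[of j] by simp
  qed (simp add: assms(3))
  then have "0 \<le> (step \<delta> ^^ 1) v 1" using iter_step_nonneg[OF assms(1,2), of v 1 1] N_pos by blast
  then show ?thesis using True by simp
next
  case False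
  have "\<delta> * (a i + b (Suc i)) \<le> 1"
    using mult_left_mono[OF rate_le[of i "Suc i"] assms(1)] assms(2) i False by linarith
  then have "0 \<le> (1 - \<delta> * (a i + b (Suc i))) * (v (Suc i) - v i)"
    using inc[OF i] by simp
  moreover have "0 \<le> \<delta> * (a (Suc i) * (v (Suc (Suc i)) - v (Suc i)))"
  proof (cases "Suc i = N")
    case False
    then show ?thesis using inc[of "Suc i"] i a_nonneg[of "Suc i"] assms(1) by simp
  qed (simp add: a_top)
  moreover have "0 \<le> \<delta> * (b i * (v i - v (i - 1)))"
    using inc[of "i - 1"] i False b_nonneg[of i] assms(1) by simp
  moreover have "step \<delta> v (Suc i) - step \<delta> v i =
      (1 - \<delta> * (a i + b (Suc i))) * (v (Suc i) - v i)
      + \<delta> * (a (Suc i) * (v (Suc (Suc i)) - v (Suc i))) + \<delta> * (b i * (v i - v (i - 1)))"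
    using False by (simp add: step_def gen_def algebra_simps)
  ultimately show ?thesis by linarith
qed

lemma iter_alive_increasing:
  assumes "0 \<le> \<delta>" "\<delta> * R \<le> 1" "i < N"
  shows "(step \<delta> ^^ k) alive i \<le> (step \<delta> ^^ k) alive (Suc i)"
  using assms(3)
proof (induction k arbitrary: i)
  case (Suc k)
  then show ?case
    using step_increasing[OF assms(1,2), of "(step \<delta> ^^ k) alive"] iter_step_0[where u = alive and \<delta> = \<delta> and k = k] alive_0
    by simp
qed (simp add: alive_def)

lemma iter_alive_le_top:
  assumes "0 \<le> \<delta>" "\<delta> * R \<le> 1" "i \<le> N"
  shows "(step \<delta> ^^ k) alive i \<le> (step \<delta> ^^ k) alive N"
  using assms(3)
proof (induction rule: inc_induct)
  case (step j)
  then show ?case using iter_alive_increasing[OF assms(1,2), of j k] by linarith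
qed simp

text \<open>\<open>[lo, hi]\<close> contains the ratios \<open>G k i\<close> of all living sites,
  and \<open>real k * \<delta>\<close> is the elapsed time. The mesh threshold may depend on the
  chain; \<open>c\<close> and \<open>C\<close> are what has to be controlled in
  \<open>n\<close>.\<close>

definition osc_decay :: "real \<Rightarrow> real \<Rightarrow> bool" where
  "osc_decay c C \<longleftrightarrow> (\<exists>\<delta>0>0. \<forall>\<delta> k g. 0 < \<delta> \<longrightarrow> \<delta> \<le> \<delta>0 \<longrightarrow> g 0 = 0 \<longrightarrow> (\<forall>i\<le>N. \<bar>g i\<bar> \<le> 1) \<longrightarrow>
     (\<exists>lo hi. hi - lo \<le> C * exp (- c * (real k * \<delta>)) \<and>
        (\<forall>i\<le>N. lo * (step \<delta> ^^ k) alive i \<le> (step \<delta> ^^ k) g i \<and>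
               (step \<delta> ^^ k) g i \<le> hi * (step \<delta> ^^ k) alive i)))"

section \<open>Doeblin minorization for the conditioned chain\<close>

lemma iter_alive_antimono:
  assumes "0 < \<delta>" "\<delta> * R \<le> 1" "i \<le> N"
  shows "(step \<delta> ^^ (m + k)) alive i \<le> (step \<delta> ^^ k) alive i"
proof (induction m)
  case (Suc m)
  show ?case
  proof (cases "i = 0")
    case False
    then have "step \<delta> ((step \<delta> ^^ (m + k)) alive) i \<le> (step \<delta> ^^ (m + k)) alive i"
      using assms by (intro step_le gen_iter_alive_nonpos[OF assms(1,2)]) auto
    then show ?thesis using Suc.IH by simp
  qed (simp add: iter_step_0)
qed simp

text \<open>Keeps only the trajectories running straight from \<open>x\<close> to \<open>y\<close>:
  \<open>d\<close> jumps of weight at least \<open>\<alpha> * \<delta>\<close>, placed in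
  \<open>m choose d\<close> ways among the \<open>m\<close> steps. The holding factor, at most 1, is
  charged for all \<open>m\<close> steps, jumps included.\<close>

lemma iter_indicator_lower:
  fixes x y m :: nat
  defines "d \<equiv> (x - y) + (y - x)"
  assumes \<delta>: "0 \<le> \<delta>" "\<delta> * R \<le> 1" and "0 \<le> \<alpha>"
    and \<alpha>: "\<And>i. 1 \<le> i \<Longrightarrow> i < N \<Longrightarrow> \<alpha> \<le> a i" "\<And>i. 1 < i \<Longrightarrow> i \<le> N \<Longrightarrow> \<alpha> \<le> b i"
    and xy: "1 \<le> x" "x \<le> N" "1 \<le> y" "y \<le> N"
  shows "(\<alpha> * \<delta>) ^ d * (1 - \<delta> * R) ^ m * real (m choose d) \<le> (step \<delta> ^^ m) (\<lambda>i. of_bool (i = y)) x"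
  using xy(1,2) unfolding d_def
proof (induction m arbitrary: x)
  case 0
  then show ?case by (cases x y rule: linorder_cases) (auto simp: binomial_eq_0)
next
  case (Suc m)
  let ?u = "(step \<delta> ^^ m) (\<lambda>i. of_bool (i = y))"
  let ?f = "\<lambda>d m. (\<alpha> * \<delta>) ^ d * (1 - \<delta> * R) ^ m * real (m choose d)"
  have u: "0 \<le> ?u j" if "j \<le> N" for j using iter_step_nonneg[OF \<delta>] that by simp
  have f: "0 \<le> ?f d m" for d m using \<delta> \<open>0 \<le> \<alpha>\<close> by simp
  have up: "0 \<le> \<delta> * a x * ?u (Suc x)"
    using a_nonneg[of x] a_top u[of "Suc x"] Suc.prems \<delta> by (cases "x = N") auto
  have down: "0 \<le> \<delta> * b x * ?u (x - 1)"
    using b_nonneg[of x] u[of "x - 1"] Suc.prems \<delta> by auto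
  have "\<delta> * (a x + b x) \<le> \<delta> * R"
    using mult_left_mono[OF rate_le \<delta>(1)] Suc.prems by auto
  then have stay: "(1 - \<delta> * R) * ?f ((x - y) + (y - x)) m \<le> (1 - \<delta> * (a x + b x)) * ?u x"
    using Suc \<delta> f by (intro mult_mono) auto
  have eq: "(step \<delta> ^^ Suc m) (\<lambda>i. of_bool (i = y)) x =
      (1 - \<delta> * (a x + b x)) * ?u x + \<delta> * a x * ?u (Suc x) + \<delta> * b x * ?u (x - 1)"
    using Suc.prems by (simp add: step_convex)
  \<comment> \<open>Pascal's rule; the surplus holding factor at the jump is bounded by 1.\<close>
  have pascal: "?f (Suc e) (Suc m) \<le> (1 - \<delta> * R) * ?f (Suc e) m + \<alpha> * \<delta> * ?f e m" for e
  proof -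
    have "(1 - \<delta> * R) * (\<alpha> * \<delta> * ?f e m) \<le> 1 * (\<alpha> * \<delta> * ?f e m)"
      using \<delta> \<open>0 \<le> \<alpha>\<close> f R_pos by (intro mult_right_mono) auto
    then show ?thesis by (simp add: algebra_simps)
  qed
  consider "x = y" | "x < y" | "y < x" by linarith
  then show ?case
  proof cases
    case 1
    then show ?thesis using stay up down eq by simp
  next
    case 2
    define e where "e = y - Suc x"
    have e: "(x - y) + (y - x) = Suc e" "(Suc x - y) + (y - Suc x) = e" using 2 by (auto simp: e_def)
    have "\<alpha> * \<delta> * ?f e m \<le> \<delta> * a x * ?u (Suc x)"
      using Suc.IH[of "Suc x"] \<alpha>(1)[of x] Suc.prems 2 xy(4) \<delta> f[of e m] u[of "Suc x"] \<open>0 \<le> \<alpha>\<close>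
      unfolding e by (subst mult.commute[of \<alpha>], intro mult_mono) (auto simp: mult_left_mono)
    then show ?thesis using pascal[of e] stay down eq unfolding e by linarith
  next
    case 3
    define e where "e = x - 1 - y"
    have e: "(x - y) + (y - x) = Suc e" "(x - 1 - y) + (y - (x - 1)) = e" using 3 by (auto simp: e_def)
    have "\<alpha> * \<delta> * ?f e m \<le> \<delta> * b x * ?u (x - 1)"
      using Suc.IH[of "x - 1"] \<alpha>(2)[of x] Suc.prems 3 xy(3) \<delta> f[of e m] u[of "x - 1"] \<open>0 \<le> \<alpha>\<close>
      unfolding e by (subst mult.commute[of \<alpha>], intro mult_mono) (auto simp: mult_left_mono)
    then show ?thesis using pascal[of e] stay up eq unfolding e by linarith
  qed
qed

text \<open>A Doeblin step with reference site \<open>N\<close>. One of \<open>u - lo * v\<close>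
  and \<open>hi * v - u\<close> takes at least half of the gap at \<open>N\<close>; the minorization
  carries a fraction \<open>c0\<close> of it to every site, where it dominates
  \<open>c0 / 2 * (hi - lo) * V\<close>, because survival is likeliest from \<open>N\<close> and
  decreases in time. So one end of the bracket moves inwards.\<close>

lemma osc_reduction:
  assumes \<delta>: "0 < \<delta>" "\<delta> * R < 1" and c0: "0 \<le> c0"
    and minor: "\<And>x y. 1 \<le> x \<Longrightarrow> x \<le> N \<Longrightarrow> c0 \<le> (step \<delta> ^^ m) (\<lambda>i. of_bool (i = N)) x"
    and lohi: "\<And>i. i \<le> N \<Longrightarrow> lo * (step \<delta> ^^ k) alive i \<le> (step \<delta> ^^ k) g i \<and>
               (step \<delta> ^^ k) g i \<le> hi * (step \<delta> ^^ k) alive i"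
    and g0: "g 0 = 0"
  obtains lo' hi' where "hi' - lo' = (1 - c0 / 2) * (hi - lo)"
    "\<And>i. i \<le> N \<Longrightarrow> lo' * (step \<delta> ^^ (m + k)) alive i \<le> (step \<delta> ^^ (m + k)) g i \<and>
               (step \<delta> ^^ (m + k)) g i \<le> hi' * (step \<delta> ^^ (m + k)) alive i"
proof -
  let ?v = "(step \<delta> ^^ k) alive" and ?u = "(step \<delta> ^^ k) g"
  let ?V = "(step \<delta> ^^ (m + k)) alive" and ?U = "(step \<delta> ^^ (m + k)) g"
  have \<delta>': "0 \<le> \<delta>" "\<delta> * R \<le> 1" using \<delta> by auto
  have "0 < (1 - \<delta> * R) ^ k" using \<delta> by simp
  also have "\<dots> \<le> ?v N" using iter_alive_lower[OF \<delta>'] N_pos by simp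
  finally have vN: "0 < ?v N" .
  have "0 \<le> (hi - lo) * ?v N" using lohi[of N] by (simp add: algebra_simps)
  then have hl: "0 \<le> hi - lo" using vN by (simp add: zero_le_mult_iff)
  have key: "c0 / 2 * (hi - lo) * ?V x \<le> (step \<delta> ^^ m) p x"
    if p: "\<And>i. i \<le> N \<Longrightarrow> 0 \<le> p i" "(hi - lo) * ?v N / 2 \<le> p N" and x: "1 \<le> x" "x \<le> N" for p x
  proof -
    have "?V x \<le> ?V N" by (rule iter_alive_le_top[OF \<delta>' x(2)])
    also have "\<dots> \<le> ?v N" by (rule iter_alive_antimono[OF \<delta>(1) \<delta>'(2)]) simp
    finally have "c0 / 2 * (hi - lo) * ?V x \<le> c0 / 2 * (hi - lo) * ?v N"
      using c0 hl by (intro mult_left_mono) auto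
    also have "\<dots> \<le> p N * c0"
      using mult_right_mono[OF p(2) c0] by (simp add: algebra_simps)
    also have "\<dots> \<le> p N * (step \<delta> ^^ m) (\<lambda>i. of_bool (i = N)) x"
      using minor[OF x] p(1)[of N] by (intro mult_left_mono) auto
    also have "\<dots> = (step \<delta> ^^ m) (\<lambda>i. p N * of_bool (i = N)) x"
      using iter_step_linear[of m \<delta> "p N" "\<lambda>i. of_bool (i = N)" 0 "\<lambda>_. 0"] by simp
    also have "\<dots> \<le> (step \<delta> ^^ m) p x"
      using p(1) by (intro iter_step_mono[OF \<delta>' _ x(2)]) auto
    finally show ?thesis .
  qed
  have UV: "?U = (step \<delta> ^^ m) ?u" "?V = (step \<delta> ^^ m) ?v" by (simp_all add: funpow_add)
  have zero: "?U 0 = 0" "?V 0 = 0" using g0 iter_step_0 by auto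
  have keep: "lo * ?V i \<le> ?U i \<and> ?U i \<le> hi * ?V i" if "i \<le> N" for i
    unfolding UV by (rule step_sandwich[OF \<delta>' lohi that])
  show thesis
  proof (cases "(hi - lo) * ?v N / 2 \<le> ?u N - lo * ?v N")
    case True
    have "c0 / 2 * (hi - lo) * ?V x \<le> ?U x - lo * ?V x" if "1 \<le> x" "x \<le> N" for x
      using key[of "\<lambda>i. 1 * ?u i + (- lo) * ?v i" x] lohi True that
        iter_step_linear[of m \<delta> 1 ?u "- lo" ?v] by (simp add: UV)
    then have "(lo + c0 / 2 * (hi - lo)) * ?V x \<le> ?U x" if "x \<le> N" for x
      using that zero by (cases "x = 0") (force simp: algebra_simps)+
    then show ?thesis using keep
      by (intro that[of hi "lo + c0 / 2 * (hi - lo)"]) (auto simp: field_simps)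
  next
    case False
    have "c0 / 2 * (hi - lo) * ?V x \<le> hi * ?V x - ?U x" if "1 \<le> x" "x \<le> N" for x
      using key[of "\<lambda>i. (-1) * ?u i + hi * ?v i" x] lohi False that
        iter_step_linear[of m \<delta> "-1" ?u "hi" ?v] unfolding UV by (simp add: field_simps)
    then have "?U x \<le> (hi - c0 / 2 * (hi - lo)) * ?V x" if "x \<le> N" for x
      using that zero by (cases "x = 0") (force simp: algebra_simps)+
    then show ?thesis using keep
      by (intro that[of "hi - c0 / 2 * (hi - lo)" lo]) (auto simp: field_simps)
  qed
qed

lemma osc_decay_doeblin:
  assumes "0 < \<alpha>" "\<alpha> \<le> R"
    and \<alpha>: "\<And>i. 1 \<le> i \<Longrightarrow> i < N \<Longrightarrow> \<alpha> \<le> a i" "\<And>i. 1 < i \<Longrightarrow> i \<le> N \<Longrightarrow> \<alpha> \<le> b i"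
  shows "\<exists>c>0. \<exists>C>0. osc_decay c C"
proof -
  \<comment> \<open>A time block of length \<open>s\<close> has \<open>s * R = 1 / 2\<close>, so by
    Bernoulli's inequality the scheme holds still through it with weight at least 1/2.\<close>
  define s where "s = 1 / (2 * R)"
  \<comment> \<open>From \<open>m choose d \<ge> (m / d) ^ d\<close> and
    \<open>m * \<delta> \<ge> s / 2\<close>; the final 1/2 is the holding weight.\<close>
  define c0 where "c0 = (\<alpha> * s / (2 * N)) ^ N / 2"
  have s: "0 < s" "s * R = 1 / 2" using R_pos by (auto simp: s_def)
  have base: "0 < \<alpha> * s / (2 * N)" "\<alpha> * s / (2 * N) \<le> 1"
  proof -
    show "0 < \<alpha> * s / (2 * N)" using assms(1) s N_pos by simp
    have "\<alpha> * s \<le> R * s" using assms(2) s by simp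
    then have "\<alpha> * s \<le> 1 / 2" using s(2) mult.commute[of R s] by linarith
    then show "\<alpha> * s / (2 * N) \<le> 1" using N_pos by (simp add: field_simps)
  qed
  have c0: "0 < c0" "c0 \<le> 1 / 2"
    using base zero_less_power[OF base(1), of N] power_le_one[of "\<alpha> * s / (2 * N)" N]
    by (auto simp: c0_def)
  have main: "\<exists>lo hi. hi - lo \<le> 2 * exp (c0 / 2) * exp (- (c0 / (2 * s)) * (real k * \<delta>)) \<and>
        (\<forall>i\<le>N. lo * (step \<delta> ^^ k) alive i \<le> (step \<delta> ^^ k) g i \<and>
               (step \<delta> ^^ k) g i \<le> hi * (step \<delta> ^^ k) alive i)"
    if \<delta>: "0 < \<delta>" "\<delta> \<le> s / (2 * N)" and g: "g 0 = 0" "\<forall>i\<le>N. \<bar>g i\<bar> \<le> 1" for \<delta> k g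
  proof -
    define m where "m = nat \<lfloor>s / \<delta>\<rfloor>"
    have "2 * real N \<le> s / \<delta>" using \<delta> N_pos by (simp add: field_simps)
    moreover have "real m = of_int \<lfloor>s / \<delta>\<rfloor>" using \<delta> s by (simp add: m_def)
    ultimately have m: "real m \<le> s / \<delta>" "s / \<delta> - 1 < real m" "2 * real N - 1 < real m"
      by linarith+
    have mN: "N \<le> m" "0 < m" using m(3) N_pos by linarith+
    have m\<delta>: "m * \<delta> \<le> s" "s / 2 \<le> m * \<delta>"
    proof -
      show "m * \<delta> \<le> s" using m(1) \<delta> by (simp add: field_simps)
      have "s - \<delta> \<le> m * \<delta>" using m(2) \<delta> by (simp add: field_simps)
      moreover have "\<delta> \<le> s / 2" using \<delta> N_pos s(1)
        by (rule_tac order_trans[OF \<delta>(2)]) (simp add: field_simps)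
      ultimately show "s / 2 \<le> m * \<delta>" by linarith
    qed
    have "\<delta> \<le> s" using \<delta>(2) N_pos s(1) by (rule_tac order_trans[OF \<delta>(2)]) (simp add: field_simps)
    then have \<delta>R: "\<delta> * R \<le> 1 / 2" using mult_right_mono[of \<delta> s R] R_pos s by simp
    then have \<delta>': "0 \<le> \<delta>" "\<delta> * R \<le> 1" "\<delta> * R < 1" using \<delta> by auto
    have minor: "c0 \<le> (step \<delta> ^^ m) (\<lambda>i. of_bool (i = N)) x" if x: "1 \<le> x" "x \<le> N" for x
    proof -
      define d where "d = (x - N) + (N - x)"
      have d: "d \<le> N" "d \<le> m" using x mN by (auto simp: d_def)
      have "1 / 2 \<le> 1 + real m * (- (\<delta> * R))"
        using mult_right_mono[OF m\<delta>(1), of R] R_pos s(2) by (simp add: mult.assoc)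
      also have "\<dots> \<le> (1 + - (\<delta> * R)) ^ m"
        using \<delta>' by (intro Bernoulli_inequality) auto
      finally have A: "1 / 2 \<le> (1 - \<delta> * R) ^ m" by simp
      have "(\<alpha> * s / (2 * N)) ^ N \<le> (\<alpha> * s / (2 * N)) ^ d"
        using base d by (intro power_decreasing) auto
      also have "\<dots> \<le> (\<alpha> * \<delta>) ^ d * real (m choose d)"
      proof (cases "d = 0")
        case False
        have "\<alpha> * s / (2 * N) \<le> \<alpha> * s / (2 * d)"
          using d False assms(1) s by (intro divide_left_mono) auto
        also have "\<dots> \<le> \<alpha> * (m * \<delta>) / d"
          using mult_left_mono[OF m\<delta>(2), of \<alpha>] assms(1) False by (simp add: field_simps)
        finally have "(\<alpha> * s / (2 * N)) ^ d \<le> (\<alpha> * (m * \<delta>) / d) ^ d"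
          using base(1) by (intro power_mono) auto
        also have "\<dots> = (\<alpha> * \<delta>) ^ d * (real m / real d) ^ d"
          by (simp add: power_mult_distrib[symmetric] mult_ac)
        also have "\<dots> \<le> (\<alpha> * \<delta>) ^ d * real (m choose d)"
          using binomial_ge_n_over_k_pow_k[OF d(2), where 'a = real] assms(1) \<delta>'
          by (intro mult_left_mono) auto
        finally show ?thesis .
      qed simp
      finally have B: "(\<alpha> * s / (2 * N)) ^ N \<le> (\<alpha> * \<delta>) ^ d * real (m choose d)" .
      have "c0 \<le> ((\<alpha> * \<delta>) ^ d * real (m choose d)) * (1 - \<delta> * R) ^ m"
        unfolding c0_def using mult_mono[OF B A] base(1) assms(1) \<delta>' by simp
      also have "\<dots> \<le> (step \<delta> ^^ m) (\<lambda>i. of_bool (i = N)) x"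
        using iter_indicator_lower[OF \<delta>'(1,2) _ \<alpha> x, of N m] assms(1) N_pos
        by (simp add: d_def mult_ac)
      finally show ?thesis .
    qed
    \<comment> \<open>The initial bracket is \<open>[-1, 1]\<close>, of width 2, and each block of
      \<open>m\<close> steps contributes one factor \<open>1 - c0 / 2\<close>.\<close>
    have blocks: "\<exists>lo hi. hi - lo = 2 * (1 - c0 / 2) ^ q \<and>
        (\<forall>i\<le>N. lo * (step \<delta> ^^ (q * m)) alive i \<le> (step \<delta> ^^ (q * m)) g i \<and>
               (step \<delta> ^^ (q * m)) g i \<le> hi * (step \<delta> ^^ (q * m)) alive i)" for q
    proof (induction q)
      case 0
      show ?case
        using g by (intro exI[of _ "-1"] exI[of _ "1 :: real"])
          (auto simp: alive_def abs_le_iff intro: minus_le_iff[THEN iffD1])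
    next
      case (Suc q)
      then obtain lo hi where lh: "hi - lo = 2 * (1 - c0 / 2) ^ q"
        "\<And>i. i \<le> N \<Longrightarrow> lo * (step \<delta> ^^ (q * m)) alive i \<le> (step \<delta> ^^ (q * m)) g i \<and>
               (step \<delta> ^^ (q * m)) g i \<le> hi * (step \<delta> ^^ (q * m)) alive i" by blast
      obtain lo' hi' where "hi' - lo' = (1 - c0 / 2) * (hi - lo)"
        "\<And>i. i \<le> N \<Longrightarrow> lo' * (step \<delta> ^^ (m + q * m)) alive i \<le> (step \<delta> ^^ (m + q * m)) g i \<and>
               (step \<delta> ^^ (m + q * m)) g i \<le> hi' * (step \<delta> ^^ (m + q * m)) alive i"
        using osc_reduction[OF \<delta>(1) \<delta>'(3) _ minor lh(2) g(1)] c0(1) by (metis less_imp_le)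
      then show ?case by (intro exI[of _ lo'] exI[of _ hi']) (simp add: lh(1))
    qed
    define q where "q = k div m"
    obtain lo hi where lh: "hi - lo = 2 * (1 - c0 / 2) ^ q"
        "\<And>i. i \<le> N \<Longrightarrow> lo * (step \<delta> ^^ (q * m)) alive i \<le> (step \<delta> ^^ (q * m)) g i \<and>
               (step \<delta> ^^ (q * m)) g i \<le> hi * (step \<delta> ^^ (q * m)) alive i"
      using blocks[of q] by blast
    have k: "k = k mod m + q * m" by (simp add: q_def)
    have "k < m * Suc q"
      using mN dividend_less_times_div[of m k] by (simp add: q_def)
    then have "real k < real m * (real q + 1)"
      by (metis of_nat_Suc of_nat_less_iff of_nat_mult add.commute)
    then have "real k / real m - 1 \<le> real q"
      using mN by (simp add: field_simps)
    moreover have "real k * \<delta> / s \<le> real k / real m"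
      using m\<delta>(1) s mN \<delta> mult_left_mono[OF m\<delta>(1), of "real k"] by (simp add: field_simps)
    \<comment> \<open>The \<open>- 1\<close> accounts for the unfinished last block; it becomes the
      constant \<open>exp (c0 / 2)\<close>.\<close>
    ultimately have q: "real k * \<delta> / s - 1 \<le> real q" by linarith
    have "(1 - c0 / 2) ^ q \<le> exp (- (c0 / 2)) ^ q"
      using c0 exp_ge_add_one_self[of "- (c0 / 2)"] by (intro power_mono) auto
    also have "\<dots> = exp (- (c0 / 2) * real q)" by (simp add: exp_of_nat_mult[symmetric] mult.commute)
    also have "\<dots> \<le> exp (- (c0 / 2) * (real k * \<delta> / s - 1))"
      using mult_left_mono[OF q, of "c0 / 2"] c0 by simp
    also have "\<dots> = exp (c0 / 2) * exp (- (c0 / (2 * s)) * (real k * \<delta>))"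
      by (simp add: exp_add[symmetric] algebra_simps)
    finally have "hi - lo \<le> 2 * exp (c0 / 2) * exp (- (c0 / (2 * s)) * (real k * \<delta>))"
      using lh(1) by simp
    have split: "(step \<delta> ^^ k) h = (step \<delta> ^^ (k mod m)) ((step \<delta> ^^ (q * m)) h)" for h
      by (subst k) (simp only: funpow_add comp_apply)
    have "\<forall>i\<le>N. lo * (step \<delta> ^^ k) alive i \<le> (step \<delta> ^^ k) g i \<and>
               (step \<delta> ^^ k) g i \<le> hi * (step \<delta> ^^ k) alive i"
      unfolding split by (intro allI impI, rule step_sandwich[OF \<delta>'(1,2) lh(2)])
    with \<open>hi - lo \<le> 2 * exp (c0 / 2) * exp (- (c0 / (2 * s)) * (real k * \<delta>))\<close>
    show ?thesis by blast
  qed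
  have "osc_decay (c0 / (2 * s)) (2 * exp (c0 / 2))"
    unfolding osc_decay_def using main s N_pos by (intro exI[of _ "s / (2 * N)"]) auto
  moreover have "0 < c0 / (2 * s)" "0 < 2 * exp (c0 / 2)" using c0 s by auto
  ultimately show ?thesis by blast
qed

end

section \<open>Contraction of weighted increments\<close>

text \<open>\<open>K\<close> separates two regimes: below it \<open>b\<close> is at most \<theta>
  times \<open>a\<close>, from it on \<open>a - b\<close> decreases. \<open>w i\<close> is the
  weight of the edge between \<open>i\<close> and \<open>Suc i\<close>. Of the rate
  \<open>2 * \<kappa>\<close> in \<open>drift\<close>, half is spent on the conditioning, via
  \<open>2 * R * \<eta> \<le> \<kappa>\<close>, and a quarter on the time discretization, which
  leaves \<open>\<kappa> / 2\<close>.\<close>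

locale contracting_birth_death = killed_birth_death +
  fixes w :: "nat \<Rightarrow> real" and \<theta> \<eta> \<kappa> wmin wmax :: real and K :: nat
  assumes K: "2 \<le> K" "K \<le> N"
    and b_decreasing: "\<And>i. 1 \<le> i \<Longrightarrow> i < N \<Longrightarrow> b (Suc i) \<le> b i"
    and \<theta>: "0 \<le> \<theta>" "\<theta> \<le> 1"
    and left: "\<And>i. 1 \<le> i \<Longrightarrow> i < K \<Longrightarrow> b i \<le> \<theta> * a i"
    and a_pos: "\<And>i. 1 \<le> i \<Longrightarrow> i < K \<Longrightarrow> 0 < a i"
    and right: "\<And>i. K \<le> i \<Longrightarrow> i < N \<Longrightarrow> b i - b (Suc i) \<le> a i - a (Suc i)"
    and \<eta>: "\<theta> ^ (K - 1) \<le> \<eta>" "\<eta> \<le> 1"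
    and \<kappa>: "0 < \<kappa>" "2 * R * \<eta> \<le> \<kappa>"
    and w_bounds: "0 < wmin" "\<And>i. i \<le> N \<Longrightarrow> wmin \<le> w i" "\<And>i. i \<le> N \<Longrightarrow> w i \<le> wmax"
    and w_decreasing: "\<And>i. i < N \<Longrightarrow> w (Suc i) \<le> w i"
    and drift: "\<And>i. 1 \<le> i \<Longrightarrow> i < N \<Longrightarrow>
      a (Suc i) * w (Suc i) - a i * w i - b (Suc i) * w i + b i * w (i - 1) \<le> - (2 * \<kappa> * w i)"
begin

text \<open>An invariant of the scheme. The last clause concerns only the sites from
  \<open>K\<close> on; to the left the increments are controlled through
  \<open>gen v \<le> 0\<close>.\<close>

definition survival_profile :: "(nat \<Rightarrow> real) \<Rightarrow> bool" where
  "survival_profile v \<longleftrightarrow> v 0 = 0 \<and> (\<forall>i. 1 \<le> i \<and> i \<le> N \<longrightarrow> 0 < v i \<and> gen v i \<le> 0) \<and>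
     (\<forall>i<N. v i \<le> v (Suc i)) \<and> (\<forall>i. K \<le> i \<and> i < N \<longrightarrow> v (Suc i) - v i \<le> \<eta> * v i)"

lemma \<eta>_nonneg: "0 \<le> \<eta>"
  using \<eta>(1) \<theta>(1) zero_le_power[of \<theta> "K - 1"] by linarith

lemma survival_profile_mono:
  assumes v: "survival_profile v" and "i \<le> j" "j \<le> N"
  shows "v i \<le> v j"
  using assms(2,3)
proof (induction rule: inc_induct)
  case (step n)
  then show ?case using v unfolding survival_profile_def by (metis order_trans less_le_trans)
qed simp

text \<open>\<open>gen v \<le> 0\<close> bounds the increment above a site by
  \<open>b / a \<le> \<theta>\<close> times the one below it, so increments decay geometrically from
  \<open>v 1 - v 0 = v 1\<close>.\<close>

lemma increment_left:
  assumes v: "survival_profile v" and i: "i < K"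
  shows "v (Suc i) - v i \<le> \<theta> ^ i * v 1"
  using i
proof (induction i)
  case (Suc i)
  have i: "1 \<le> Suc i" "Suc i < K" using Suc.prems by auto
  have "gen v (Suc i) \<le> 0" using v i K by (simp add: survival_profile_def)
  then have "a (Suc i) * (v (Suc (Suc i)) - v (Suc i)) \<le> b (Suc i) * (v (Suc i) - v i)"
    by (simp add: gen_def)
  also have "\<dots> \<le> (\<theta> * a (Suc i)) * (v (Suc i) - v i)"
    using left[OF i] survival_profile_mono[OF v, of i "Suc i"] i K by (intro mult_right_mono) auto
  also have "\<dots> \<le> (\<theta> * a (Suc i)) * (\<theta> ^ i * v 1)"
    using Suc \<theta>(1) a_pos[OF i] by (intro mult_left_mono) auto
  also have "\<dots> = a (Suc i) * (\<theta> ^ Suc i * v 1)" by simp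
  finally show ?case using a_pos[OF i] by (subst (asm) mult_le_cancel_left_pos)
qed (use v in \<open>simp add: survival_profile_def\<close>)

text \<open>Adds the site \<open>K - 1\<close>, to which the recursion at \<open>K\<close> looks
  back. There the geometric decay has reached \<open>\<theta> ^ (K - 1)\<close>, which is at most
  \<eta>.\<close>

lemma increment_right:
  assumes v: "survival_profile v" and i: "K - 1 \<le> i" "i < N"
  shows "v (Suc i) - v i \<le> \<eta> * v i"
proof (cases "K \<le> i")
  case True
  then show ?thesis using v i by (simp add: survival_profile_def)
next
  case False
  then have i: "i = K - 1" using i by simp
  have "i < K" using i K by simp
  then have "v (Suc i) - v i \<le> \<theta> ^ i * v 1" by (rule increment_left[OF v])
  also have "\<dots> \<le> \<eta> * v i"
    using \<eta> \<eta>_nonneg i K v survival_profile_mono[OF v, of 1 i]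
    by (intro mult_mono) (auto simp: survival_profile_def less_imp_le)
  finally show ?thesis .
qed

text \<open>Crude control of the upward rates of the conditioned chain, from an increment of at most
  \<open>v 1\<close> on the left and \<open>\<eta> * v i\<close> on the right.\<close>

lemma survival_profile_double:
  assumes v: "survival_profile v" and i: "1 \<le> i" "i < N"
  shows "v (Suc i) \<le> 2 * v i"
proof -
  have pos: "0 < v i" "0 < v 1" using v i N_pos by (auto simp: survival_profile_def)
  have "v (Suc i) - v i \<le> v i"
  proof (cases "i < K")
    case True
    have "\<theta> ^ i * v 1 \<le> 1 * v 1"
      using \<theta> pos by (intro mult_right_mono power_le_one) auto
    then show ?thesis
      using increment_left[OF v True] survival_profile_mono[OF v i(1)] i by linarith
  next
    case False
    have "\<eta> * v i \<le> 1 * v i" using \<eta> pos by (intro mult_right_mono) auto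
    moreover have "K - 1 \<le> i" using False by simp
    ultimately show ?thesis using increment_right[OF v _ i(2)] by linarith
  qed
  then show ?thesis by simp
qed

text \<open>The ratio bound \<open>v (Suc i) \<le> (1 + \<eta>) v i\<close> is propagated through
  \<open>e i = (1 + \<eta>) v i - v (Suc i)\<close>, which satisfies a birth-death inequality with a nonnegative
  source as long as \<open>a - b\<close> decreases.\<close>

lemma step_increment_right:
  assumes v: "survival_profile v" and \<delta>: "0 < \<delta>" "\<delta> * R \<le> 1" and i: "K \<le> i" "i < N"
  shows "step \<delta> v (Suc i) - step \<delta> v i \<le> \<eta> * step \<delta> v i"
proof -
  define e where "e j = (1 + \<eta>) * v j - v (Suc j)" for j
  have e: "0 \<le> e j" if "K - 1 \<le> j" "j < N" for j
    using increment_right[OF v that] by (simp add: e_def algebra_simps)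
  have i1: "1 \<le> i" "i - 1 < N" "K - 1 \<le> i - 1" "Suc (i - 1) = i" using i K by auto
  \<comment> \<open>The source is nonnegative: both differences of rates are, that of
    \<open>a\<close> dominates, and \<open>v\<close> increases.\<close>
  have "(b i - b (Suc i)) * v i \<le> (a i - a (Suc i)) * v (Suc i)"
    using right[OF i] b_decreasing[OF i1(1) i(2)] survival_profile_mono[OF v, of i "Suc i"] v i i1
    by (intro mult_mono) (auto simp: survival_profile_def less_imp_le)
  then have "0 \<le> \<eta> * ((a i - a (Suc i)) * v (Suc i) - (b i - b (Suc i)) * v i)"
    using \<eta>_nonneg by simp
  then have src: "0 \<le> \<delta> * (\<eta> * ((a i - a (Suc i)) * v (Suc i) - (b i - b (Suc i)) * v i))"
    using \<delta> by simp
  have "\<delta> * (a i + b (Suc i)) \<le> 1"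
    using mult_left_mono[OF rate_le[of i "Suc i"], of \<delta>] \<delta> i i1 by linarith
  then have "0 \<le> (1 - \<delta> * (a i + b (Suc i))) * e i" using e[of i] i by simp
  moreover have "0 \<le> \<delta> * (b i * e (i - 1))" using \<delta> b_nonneg[of i] e[of "i - 1"] i i1 by simp
  moreover have "0 \<le> \<delta> * (a (Suc i) * e (Suc i))"
  proof (cases "Suc i = N")
    case False
    then show ?thesis using \<delta> a_nonneg[of "Suc i"] e[of "Suc i"] i by simp
  qed (simp add: a_top)
  moreover have "(1 + \<eta>) * step \<delta> v i - step \<delta> v (Suc i) =
     \<delta> * (\<eta> * ((a i - a (Suc i)) * v (Suc i) - (b i - b (Suc i)) * v i))
     + (1 - \<delta> * (a i + b (Suc i))) * e i + \<delta> * (b i * e (i - 1)) + \<delta> * (a (Suc i) * e (Suc i))"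
    using i1 by (simp add: step_def gen_def e_def algebra_simps)
  ultimately have "0 \<le> (1 + \<eta>) * step \<delta> v i - step \<delta> v (Suc i)" using src by linarith
  then show ?thesis by (simp add: algebra_simps)
qed

lemma survival_profile_iter:
  assumes \<delta>: "0 < \<delta>" "\<delta> * R < 1"
  shows "survival_profile ((step \<delta> ^^ k) alive)"
proof (induction k)
  case 0
  then show ?case using gen_alive_nonpos \<eta>_nonneg K by (auto simp: survival_profile_def)
next
  case (Suc k)
  have \<delta>': "0 \<le> \<delta>" "\<delta> * R \<le> 1" using \<delta> by auto
  have "0 < (1 - \<delta> * R) ^ Suc k" using \<delta> by simp
  moreover note iter_alive_lower[OF \<delta>', of _ "Suc k"]
  ultimately have "0 < (step \<delta> ^^ Suc k) alive i" if "1 \<le> i" "i \<le> N" for i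
    using that by (meson less_le_trans)
  then show ?case
    using gen_iter_alive_nonpos[OF \<delta>(1) \<delta>'(2), of _ "Suc k"] iter_alive_increasing[OF \<delta>', of _ "Suc k"]
      step_increment_right[OF Suc \<delta>(1) \<delta>'(2)]
    unfolding survival_profile_def by (auto simp: iter_step_0)
qed

text \<open>The weighted drift under the Doob-transformed rates: the up rate meets the edge above
  \<open>i\<close>, the down rate the edge below.\<close>

definition flux :: "(nat \<Rightarrow> real) \<Rightarrow> nat \<Rightarrow> real" where
  "flux v i = (a i * v (Suc i) * w i - b i * v (i - 1) * w (i - 1)) / v i"

text \<open>With \<open>s = a i (v (Suc i) - v i) / v i\<close> and \<open>z = b i (v i - v (i - 1)) / v i\<close> the flux is
  \<open>a i w i - b i w (i - 1) + s w i + z w (i - 1)\<close>. On the left,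
  \<open>s (Suc i) \<le> z (Suc i) \<le> s i \<le> z i\<close>, so conditioning on survival only helps the contraction; on the right they are negligible.\<close>

lemma flux_decrease:
  assumes v: "survival_profile v" and i: "1 \<le> i" "i < N"
  shows "flux v (Suc i) - flux v i \<le> - (\<kappa> * w i)"
proof -
  define s where "s j = a j * (v (Suc j) - v j) / v j" for j
  define z where "z j = b j * (v j - v (j - 1)) / v j" for j
  have pos: "0 < v j" if "1 \<le> j" "j \<le> N" for j using v that by (simp add: survival_profile_def)
  have flux: "flux v j = a j * w j - b j * w (j - 1) + s j * w j + z j * w (j - 1)"
    if "1 \<le> j" "j \<le> N" for j
    using pos[OF that] by (simp add: flux_def s_def z_def field_simps)
  have sz: "s j \<le> z j" if "1 \<le> j" "j \<le> N" for j
    using v that pos[OF that] unfolding s_def z_def survival_profile_def gen_def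
    by (intro divide_right_mono) force+
  have s0: "0 \<le> s j" if "1 \<le> j" "j \<le> N" for j
  proof (cases "j = N")
    case False
    then show ?thesis unfolding s_def
      using pos[OF that] a_nonneg[OF that] that survival_profile_mono[OF v, of j "Suc j"] by simp
  qed (simp add: s_def a_top)
  \<comment> \<open>The denominator \<open>v (Suc i)\<close> is lowered to \<open>v i\<close>, so
    that the bound can be compared with \<open>s i\<close>.\<close>
  have z_le: "z (Suc i) \<le> b (Suc i) * ((v (Suc i) - v i) / v i)"
    unfolding z_def using pos[of i] pos[of "Suc i"] i b_nonneg[of "Suc i"]
      survival_profile_mono[OF v, of i "Suc i"]
    by (simp add: mult_left_mono frac_le divide_left_mono flip: times_divide_eq_right)
  have w0: "0 < w i" "w (Suc i) \<le> w i" "w i \<le> w (i - 1)"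
    using w_bounds(1) w_bounds(2)[of i] w_decreasing[of i] w_decreasing[of "i - 1"] i by auto
  have "s (Suc i) * w (Suc i) + z (Suc i) * w i - s i * w i - z i * w (i - 1) \<le> \<kappa> * w i"
  proof (cases "i < K")
    case True
    have "b (Suc i) \<le> a i"
    proof -
      have "b (Suc i) \<le> b i" using b_decreasing i by simp
      also have "\<dots> \<le> \<theta> * a i" by (rule left[OF i(1) True])
      also have "\<dots> \<le> a i" using \<theta> a_pos[OF i(1) True] by (simp add: mult_le_cancel_right1)
      finally show ?thesis .
    qed
    moreover have "0 \<le> (v (Suc i) - v i) / v i"
      using pos[of i] i survival_profile_mono[OF v, of i "Suc i"] by simp
    ultimately have "z (Suc i) \<le> a i * ((v (Suc i) - v i) / v i)"
      using z_le by (meson mult_right_mono order_trans)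
    then have zs: "z (Suc i) \<le> s i" by (simp add: s_def)
    have "s (Suc i) * w (Suc i) + z (Suc i) * w i \<le> s i * w i + s i * w i"
      using sz[of "Suc i"] s0[of "Suc i"] s0[of i] zs w0 i w_bounds(1) w_bounds(2)[of "Suc i"]
      by (intro add_mono mult_mono) auto
    moreover have "s i * w i \<le> z i * w (i - 1)"
      using sz[of i] s0[of i] w0 i by (intro mult_mono) auto
    moreover have "0 \<le> \<kappa> * w i" using \<kappa> w0 by simp
    ultimately show ?thesis by linarith
  next
    case False
    \<comment> \<open>Relative increments are at most \<eta> here, so the two terms at
      \<open>Suc i\<close> cost at most \<open>2 * R * \<eta> * w i\<close>; the terms at
      \<open>i\<close> have the favourable sign and are dropped.\<close>
    have "K - 1 \<le> i" using False by simp
    then have "(v (Suc i) - v i) / v i \<le> \<eta>"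
      using increment_right[OF v _ i(2)] pos[of i] i by (simp add: pos_divide_le_eq)
    then have "z (Suc i) \<le> b (Suc i) * \<eta>"
      using z_le b_nonneg[of "Suc i"] i by (meson Suc_leI le_SucI mult_left_mono order_trans)
    also have "\<dots> \<le> R * \<eta>"
      using rate_le[of i "Suc i"] a_nonneg[of i] \<eta>_nonneg i by (intro mult_right_mono) auto
    finally have zR: "z (Suc i) \<le> R * \<eta>" .
    have "s (Suc i) * w (Suc i) + z (Suc i) * w i \<le> (R * \<eta>) * w i + (R * \<eta>) * w i"
      using sz[of "Suc i"] s0[of "Suc i"] zR w0 i w_bounds(1) w_bounds(2)[of "Suc i"]
      by (intro add_mono mult_mono) auto
    also have "\<dots> = 2 * R * \<eta> * w i" by simp
    also have "\<dots> \<le> \<kappa> * w i" using \<kappa> w0 by (intro mult_right_mono) auto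
    moreover have "0 \<le> s i * w i" using s0[of i] w0 i by simp
    moreover have "0 \<le> z i * w (i - 1)" using s0[of i] sz[of i] w0 i by simp
    ultimately show ?thesis by linarith
  qed
  moreover have "flux v (Suc i) - flux v i =
      (a (Suc i) * w (Suc i) - a i * w i - b (Suc i) * w i + b i * w (i - 1)) +
      (s (Suc i) * w (Suc i) + z (Suc i) * w i - s i * w i - z i * w (i - 1))"
    using flux[of i] flux[of "Suc i"] i by simp
  ultimately show ?thesis using drift[OF i] by linarith
qed

text \<open>The factor 3 is 2 for the upward part, where \<open>v\<close> at most doubles, plus 1
  for the downward part.\<close>

lemma flux_bound:
  assumes v: "survival_profile v" and i: "1 \<le> i" "i \<le> N"
  shows "\<bar>flux v i\<bar> \<le> 3 * R * wmax"
proof -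
  have pos: "0 < v i" using v i by (simp add: survival_profile_def)
  have wm: "0 < w j" "w j \<le> wmax" if "j \<le> N" for j
    using w_bounds(1) w_bounds(2,3)[OF that] by auto
  have a: "0 \<le> a i" "a i \<le> R" and b: "0 \<le> b i" "b i \<le> R"
    using a_nonneg[OF i] b_nonneg[OF i] rate_le[OF i i] by auto
  have v1: "0 \<le> v (i - 1)" "v (i - 1) \<le> v i"
    using survival_profile_mono[OF v, of 0 "i - 1"] survival_profile_mono[OF v, of "i - 1" i] i v
    by (auto simp: survival_profile_def)
  have up: "0 \<le> a i * v (Suc i) * w i" "a i * v (Suc i) * w i \<le> 2 * R * wmax * v i"
  proof -
    have *: "0 \<le> a i * v (Suc i) \<and> a i * v (Suc i) \<le> R * (2 * v i)"
    proof (cases "i = N")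
      case False
      then have "0 \<le> v (Suc i)" "v (Suc i) \<le> 2 * v i"
        using survival_profile_double[OF v, of i] survival_profile_mono[OF v, of i "Suc i"] pos i by auto
      then show ?thesis using a by (auto intro!: mult_mono)
    qed (use pos R_pos a_top in simp)
    then show "0 \<le> a i * v (Suc i) * w i" using wm[OF i(2)] by simp
    have "a i * v (Suc i) * w i \<le> R * (2 * v i) * wmax"
      using * wm[OF i(2)] pos R_pos by (intro mult_mono[of "a i * v (Suc i)"]) auto
    then show "a i * v (Suc i) * w i \<le> 2 * R * wmax * v i" by (simp add: mult_ac)
  qed
  have down: "0 \<le> b i * v (i - 1) * w (i - 1)" "b i * v (i - 1) * w (i - 1) \<le> R * wmax * v i"
  proof -
    have "i - 1 \<le> N" using i by simp
    note wm1 = wm[OF this]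
    show "0 \<le> b i * v (i - 1) * w (i - 1)" using b v1 wm1 by simp
    have "b i * v (i - 1) * w (i - 1) \<le> R * v i * wmax"
      using b v1 wm1 pos R_pos by (intro mult_mono) auto
    then show "b i * v (i - 1) * w (i - 1) \<le> R * wmax * v i" by (simp add: mult_ac)
  qed
  have "\<bar>a i * v (Suc i) * w i - b i * v (i - 1) * w (i - 1)\<bar> \<le> 3 * R * wmax * v i"
    using up down by linarith
  then show ?thesis using pos by (simp add: flux_def field_simps)
qed

text \<open>Subtracting the ratio updates of neighbouring sites gives a recursion for
  \<open>D\<close> with nonnegative coefficients. Inserting
  \<open>\<bar>D j\<bar> \<le> C * w j\<close> yields
  \<open>C * (w i + \<delta> * (F (Suc i) - F i))\<close>, where \<open>F\<close> is
  \<open>flux v\<close> up to an error of order \<delta>, and \<open>flux_decrease\<close> applies.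
  The constant 12 in \<open>small\<close> is the error 6 at each of two sites.\<close>

lemma gradient_step:
  assumes v: "survival_profile v" and \<delta>: "0 < \<delta>" "\<delta> * R \<le> 1 / 8"
    and small: "12 * R\<^sup>2 * wmax * \<delta> \<le> \<kappa> * wmin / 2"
    and u: "u 0 = 0" and "0 \<le> C"
    and grad: "\<And>i. 1 \<le> i \<Longrightarrow> i < N \<Longrightarrow> \<bar>u (Suc i) / v (Suc i) - u i / v i\<bar> \<le> C * w i"
    and i: "1 \<le> i" "i < N"
  shows "\<bar>step \<delta> u (Suc i) / step \<delta> v (Suc i) - step \<delta> u i / step \<delta> v i\<bar> \<le> (1 - \<delta> * \<kappa> / 2) * C * w i"
proof -
  define G where "G j = u j / v j" for j
  define D where "D j = G (Suc j) - G j" for j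
  define v' where "v' = step \<delta> v"
  have pos: "0 < v j" if "1 \<le> j" "j \<le> N" for j using v that by (simp add: survival_profile_def)
  have v0: "v 0 = 0" using v by (simp add: survival_profile_def)
  have vnn: "0 \<le> v j" if "j \<le> N" for j using survival_profile_mono[OF v, of 0 j] v0 that by simp
  have rates: "0 \<le> a j" "a j \<le> R" "0 \<le> b j" "b j \<le> R" if "1 \<le> j" "j \<le> N" for j
    using a_nonneg[OF that] b_nonneg[OF that] rate_le[OF that that] by auto
  have uG: "u j = G j * v j" if "j \<le> N" for j
    using pos[of j] that u v0 by (cases "j = 0") (auto simp: G_def)
  have v'_lower: "(1 - \<delta> * R) * v j \<le> v' j" and v'_upper: "v' j \<le> v j" if j: "1 \<le> j" "j \<le> N" for j
  proof -
    have "0 \<le> \<delta> * a j * v (Suc j)"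
      using rates[OF j] \<delta> a_top vnn[of "Suc j"] j by (cases "j = N") auto
    moreover have "0 \<le> \<delta> * b j * v (j - 1)" using rates[OF j] \<delta> vnn[of "j - 1"] j by simp
    moreover have "(1 - \<delta> * R) * v j \<le> (1 - \<delta> * (a j + b j)) * v j"
      using rate_le[OF j j] \<delta> pos[OF j] by (intro mult_right_mono) auto
    ultimately show "(1 - \<delta> * R) * v j \<le> v' j" using j by (simp add: v'_def step_convex)
    show "v' j \<le> v j"
      using step_le[of j \<delta> v] v j \<delta> by (simp add: v'_def survival_profile_def)
  qed
  have v'_half: "v j / 2 \<le> v' j" and v'_pos: "0 < v' j" if j: "1 \<le> j" "j \<le> N" for j
  proof -
    have "1 / 2 * v j \<le> (1 - \<delta> * R) * v j"
      using \<delta> pos[OF j] by (intro mult_right_mono) auto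
    then show "v j / 2 \<le> v' j" using v'_lower[OF j] by simp
    then show "0 < v' j" using pos[OF j] by simp
  qed
  \<comment> \<open>Dividing by the updated profile \<open>v'\<close> rather than by
    \<open>v\<close> makes the recursion for the ratio exact.\<close>
  define p where "p j = a j * v (Suc j) / v' j" for j
  define q where "q j = b j * v (j - 1) / v' j" for j
  have p: "0 \<le> p j" "p j \<le> 4 * R" if j: "1 \<le> j" "j \<le> N" for j
  proof -
    have "0 \<le> a j * v (Suc j) \<and> a j * v (Suc j) \<le> R * (4 * v' j)"
    proof (cases "j = N")
      case False
      have "v (Suc j) \<le> 4 * v' j"
        using survival_profile_double[OF v, of j] v'_half[OF j] j False by simp
      then show ?thesis using rates[OF j] vnn[of "Suc j"] j False R_pos by (auto intro!: mult_mono)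
    qed (use a_top R_pos v'_pos[OF j] in auto)
    then show "0 \<le> p j" "p j \<le> 4 * R"
      using v'_pos[OF j] by (auto simp: p_def field_simps)
  qed
  have q: "0 \<le> q j" "q j \<le> 2 * R" if j: "1 \<le> j" "j \<le> N" for j
  proof -
    have "b j * v (j - 1) \<le> R * (2 * v' j)"
      using survival_profile_mono[OF v, of "j - 1" j] v'_half[OF j] rates[OF j] vnn[of "j - 1"] j R_pos
      by (intro mult_mono) auto
    then show "q j \<le> 2 * R" using v'_pos[OF j] by (simp add: q_def field_simps)
    show "0 \<le> q j" using rates[OF j] vnn[of "j - 1"] j v'_pos[OF j] by (simp add: q_def)
  qed
  have ratio: "step \<delta> u j / v' j = G j + \<delta> * (p j * D j - q j * D (j - 1))" if j: "1 \<le> j" "j \<le> N" for j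
  proof -
    have a_u: "a j * u (Suc j) = a j * (G (Suc j) * v (Suc j))"
      using uG[of "Suc j"] j a_top by (cases "j = N") auto
    have "Suc (j - 1) = j" using j by simp
    moreover have "step \<delta> u j = (1 - \<delta> * (a j + b j)) * u j + \<delta> * (a j * u (Suc j)) + \<delta> * b j * u (j - 1)"
      using j by (simp add: step_convex)
    ultimately have "step \<delta> u j = G j * v' j + \<delta> * (a j * v (Suc j) * D j - b j * v (j - 1) * D (j - 1))"
      using j unfolding a_u uG[OF j(2)] using uG[of "j - 1"]
      by (simp add: v'_def step_convex D_def algebra_simps)
    then show ?thesis using v'_pos[OF j] by (simp add: p_def q_def field_simps)
  qed
  define F where "F j = p j * w j - q j * w (j - 1)" for j
  \<comment> \<open>6 = 3 * 2: \<open>flux_bound\<close> times the relative change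
    \<open>2 * R * \<delta>\<close> of the profile.\<close>
  have F: "\<bar>F j - flux v j\<bar> \<le> 6 * R\<^sup>2 * wmax * \<delta>" if j: "1 \<le> j" "j \<le> N" for j
  proof -
    have eq: "F j - flux v j = flux v j * ((v j - v' j) / v' j)"
      using pos[OF j] v'_pos[OF j] by (simp add: F_def p_def q_def flux_def field_simps)
    have "v j - v' j \<le> (2 * R * \<delta>) * v' j"
    proof -
      have "v j - v' j \<le> \<delta> * R * v j" using v'_lower[OF j] by (simp add: algebra_simps)
      also have "\<dots> \<le> \<delta> * R * (2 * v' j)" using v'_half[OF j] \<delta> R_pos by (intro mult_left_mono) auto
      finally show ?thesis by (simp add: mult_ac)
    qed
    then have "\<bar>(v j - v' j) / v' j\<bar> \<le> 2 * R * \<delta>"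
      using v'_pos[OF j] v'_upper[OF j] by (simp add: field_simps)
    then have "\<bar>flux v j\<bar> * \<bar>(v j - v' j) / v' j\<bar> \<le> (3 * R * wmax) * (2 * R * \<delta>)"
      using flux_bound[OF v j] by (intro mult_mono) auto
    then show ?thesis unfolding eq abs_mult by (simp add: power2_eq_square mult_ac)
  qed
  have i': "1 \<le> Suc i" "Suc i \<le> N" "i \<le> N" using i by auto
  have Dabs: "\<bar>D j\<bar> \<le> C * w j" if "1 \<le> j" "j < N" for j
    using grad[OF that] by (simp add: D_def G_def)
  have coef: "0 \<le> 1 - \<delta> * (q (Suc i) + p i)"
  proof -
    have "\<delta> * (q (Suc i) + p i) \<le> \<delta> * (2 * R + 4 * R)"
      using p[OF i(1) i'(3)] q[OF i'(1,2)] \<delta> by (intro mult_left_mono) auto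
    then show ?thesis using \<delta> by (simp add: algebra_simps)
  qed
  \<comment> \<open>At the two ends the neighbouring increment is not controlled by
    \<open>grad\<close>, but its coefficient vanishes: \<open>a N = 0\<close> above and
    \<open>v 0 = 0\<close> below.\<close>
  have pD: "\<bar>p (Suc i) * D (Suc i)\<bar> \<le> C * (p (Suc i) * w (Suc i))"
  proof (cases "Suc i = N")
    case False
    then show ?thesis using mult_left_mono[OF Dabs[of "Suc i"] p(1)[OF i'(1,2)]] i p(1)[OF i'(1,2)]
      by (simp add: abs_mult mult_ac)
  qed (simp add: p_def a_top)
  have qD: "\<bar>q i * D (i - 1)\<bar> \<le> C * (q i * w (i - 1))"
  proof (cases "i = 1")
    case False
    then show ?thesis using mult_left_mono[OF Dabs[of "i - 1"] q(1)[OF i(1) i'(3)]] i q(1)[OF i(1) i'(3)]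
      by (simp add: abs_mult mult_ac)
  qed (simp add: q_def v0)
  have cD: "\<bar>(1 - \<delta> * (q (Suc i) + p i)) * D i\<bar> \<le> (1 - \<delta> * (q (Suc i) + p i)) * (C * w i)"
    using mult_left_mono[OF Dabs[OF i] coef] coef by (simp add: abs_mult)
  have "step \<delta> u (Suc i) / v' (Suc i) - step \<delta> u i / v' i =
      (1 - \<delta> * (q (Suc i) + p i)) * D i + \<delta> * (p (Suc i) * D (Suc i)) + \<delta> * (q i * D (i - 1))"
    unfolding ratio[OF i(1) i'(3)] ratio[OF i'(1,2)] by (simp add: D_def algebra_simps)
  also have "\<bar>\<dots>\<bar> \<le> (1 - \<delta> * (q (Suc i) + p i)) * (C * w i)
      + \<delta> * (C * (p (Suc i) * w (Suc i))) + \<delta> * (C * (q i * w (i - 1)))"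
    using cD mult_left_mono[OF pD, of \<delta>] mult_left_mono[OF qD, of \<delta>] \<delta>
    by (intro order_trans[OF abs_triangle_ineq] add_mono order_trans[OF abs_triangle_ineq])
       (auto simp: abs_mult)
  also have "\<dots> = C * (w i + \<delta> * (F (Suc i) - F i))"
    by (simp add: F_def algebra_simps)
  also have "\<dots> \<le> C * (w i + \<delta> * (- (\<kappa> / 2 * w i)))"
  proof -
    have "F (Suc i) - F i \<le> - (\<kappa> * w i) + 12 * R\<^sup>2 * wmax * \<delta>"
      using F[OF i(1) i'(3)] F[OF i'(1,2)] flux_decrease[OF v i] by linarith
    also have "\<dots> \<le> - (\<kappa> / 2 * w i)"
      using small mult_left_mono[OF w_bounds(2)[OF i'(3)], of \<kappa>] \<kappa> by linarith
    finally show ?thesis using \<delta> \<open>0 \<le> C\<close> by (intro mult_left_mono add_left_mono) auto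
  qed
  finally show ?thesis by (simp add: v'_def algebra_simps)
qed

text \<open>Fewer than \<open>N\<close> increments separate a living site from site 1, so a bracket
  of half-width \<open>N * S\<close> around \<open>G 1\<close> suffices. The 4 is the initial
  increment bound 2 times the two sides of the bracket.\<close>

lemma osc_decay_contraction: "osc_decay (\<kappa> / 2) (4 * (wmax / wmin) * N)"
proof -
  have wm: "0 < wmax" using w_bounds(1) w_bounds(2,3)[of 0] by linarith
  \<comment> \<open>In this order: a nonnegative contraction factor, nonnegative coefficients
    (\<open>6 * \<delta> * R \<le> 1\<close>), and the assumption \<open>small\<close> of
    \<open>gradient_step\<close>.\<close>
  define \<delta>0 where "\<delta>0 = min (1 / \<kappa>) (min (1 / (8 * R)) (\<kappa> * wmin / (24 * R\<^sup>2 * wmax)))"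
  have \<delta>0: "0 < \<delta>0" using R_pos \<kappa> w_bounds(1) wm by (simp add: \<delta>0_def)
  have "\<exists>lo hi. hi - lo \<le> 4 * (wmax / wmin) * N * exp (- (\<kappa> / 2) * (real k * \<delta>)) \<and>
        (\<forall>i\<le>N. lo * (step \<delta> ^^ k) alive i \<le> (step \<delta> ^^ k) g i \<and>
               (step \<delta> ^^ k) g i \<le> hi * (step \<delta> ^^ k) alive i)"
    if d: "0 < \<delta>" "\<delta> \<le> \<delta>0" and g: "g 0 = 0" "\<forall>i\<le>N. \<bar>g i\<bar> \<le> 1" for \<delta> k g
  proof -
    have \<delta>R: "\<delta> * R \<le> 1 / 8" using d R_pos by (simp add: \<delta>0_def field_simps)
    have small: "12 * R\<^sup>2 * wmax * \<delta> \<le> \<kappa> * wmin / 2"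
      using d R_pos wm by (simp add: \<delta>0_def field_simps)
    define r where "r = 1 - \<delta> * \<kappa> / 2"
    let ?v = "\<lambda>k. (step \<delta> ^^ k) alive" and ?u = "\<lambda>k. (step \<delta> ^^ k) g"
    have sp: "survival_profile (?v k)" for k using survival_profile_iter d(1) \<delta>R by simp
    have "\<delta> * \<kappa> \<le> 1" using d \<kappa> by (simp add: \<delta>0_def field_simps)
    then have "r \<ge> 0" by (simp add: r_def)
    have grad: "\<bar>?u k (Suc i) / ?v k (Suc i) - ?u k i / ?v k i\<bar> \<le> r ^ k * (2 / wmin) * w i"
      if "1 \<le> i" "i < N" for i
      using that
    proof (induction k arbitrary: i)
      case 0
      have "2 \<le> 2 / wmin * w i" using w_bounds(1) w_bounds(2)[of i] 0 by (simp add: field_simps)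
      moreover have "\<bar>g (Suc i)\<bar> \<le> 1" "\<bar>g i\<bar> \<le> 1" using g 0 by auto
      ultimately show ?case using 0 by (simp add: alive_def)
    next
      case (Suc k)
      then show ?case
        using gradient_step[OF sp[of k] d(1) \<delta>R small _ _ Suc.IH, of i] iter_step_0[of g] g(1)
          w_bounds(1) \<open>r \<ge> 0\<close> by (simp add: r_def mult_ac)
    qed
    define S where "S = r ^ k * (2 / wmin) * wmax"
    have S: "0 \<le> S" using \<open>r \<ge> 0\<close> w_bounds(1) wm by (simp add: S_def)
    define G where "G i = ?u k i / ?v k i" for i
    have gradS: "\<bar>G (Suc i) - G i\<bar> \<le> S" if "1 \<le> i" "i < N" for i
      using grad[OF that] w_bounds(1) w_bounds(3)[of i] that \<open>r \<ge> 0\<close>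
      unfolding S_def G_def by (elim order_trans) (intro mult_left_mono, auto)
    have dist: "\<bar>G i - G 1\<bar> \<le> real (i - 1) * S" if "1 \<le> i" "i \<le> N" for i
      using that
    proof (induction i rule: dec_induct)
      case (step n)
      then have "\<bar>G (Suc n) - G 1\<bar> \<le> real (n - 1) * S + S" using gradS[of n] by simp
      also have "\<dots> = real (Suc n - 1) * S" using step by (simp add: algebra_simps of_nat_diff)
      finally show ?case .
    qed simp
    have lh: "(G 1 - N * S) * ?v k i \<le> ?u k i \<and> ?u k i \<le> (G 1 + N * S) * ?v k i" if "i \<le> N" for i
    proof (cases "i = 0")
      case False
      then have i: "1 \<le> i" by simp
      have v: "0 < ?v k i" using sp[of k] i that by (simp add: survival_profile_def)
      have "real (i - 1) * S \<le> N * S" using that S by (intro mult_right_mono) auto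
      then have "G 1 - N * S \<le> G i" "G i \<le> G 1 + N * S" using dist[OF i that] by linarith+
      then show ?thesis using v unfolding G_def by (simp add: pos_le_divide_eq pos_divide_le_eq)
    qed (use g in \<open>simp add: iter_step_0\<close>)
    have "r ^ k \<le> exp (- (\<delta> * \<kappa> / 2)) ^ k"
      using exp_ge_add_one_self[of "- (\<delta> * \<kappa> / 2)"] \<open>r \<ge> 0\<close> by (intro power_mono) (auto simp: r_def)
    also have "\<dots> = exp (- (\<kappa> / 2) * (real k * \<delta>))" by (simp add: exp_of_nat_mult[symmetric] mult_ac)
    finally have "(4 * (wmax / wmin) * N) * r ^ k \<le> (4 * (wmax / wmin) * N) * exp (- (\<kappa> / 2) * (real k * \<delta>))"
      using w_bounds(1) wm by (intro mult_left_mono) auto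
    then have "(G 1 + N * S) - (G 1 - N * S) \<le> 4 * (wmax / wmin) * N * exp (- (\<kappa> / 2) * (real k * \<delta>))"
      by (simp add: S_def mult_ac)
    then show ?thesis using lh by blast
  qed
  then show ?thesis unfolding osc_decay_def using \<delta>0 by blast
qed

end

section \<open>Killed laws of finite Markov chains\<close>

locale killed_chain = prob_space M
  for M :: "'a measure" +
  fixes X :: "real \<Rightarrow> 'a \<Rightarrow> 's" and S A :: "'s set" and q :: "'s \<Rightarrow> 's \<Rightarrow> real"
    and x0 :: 's and P :: "real \<Rightarrow> 's \<Rightarrow> 's \<Rightarrow> real" and \<Lambda> :: real
  assumes finite_S: "finite S" and A: "A \<subseteq> S" and x0: "x0 \<in> A"
    and X_meas: "\<And>t. 0 \<le> t \<Longrightarrow> X t \<in> measurable M (count_space S)"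
    and X_start: "AE \<omega> in M. X 0 \<omega> = x0"
    and X_right: "\<And>\<omega> t. \<omega> \<in> space M \<Longrightarrow> 0 \<le> t \<Longrightarrow> \<forall>\<^sub>F s in at_right t. X s \<omega> = X t \<omega>"
    and semigroup: "transition_semigroup S P" and rates: "has_jump_rates S P q"
    and markov: "markov_property M X S P"
    and q_nonneg: "\<And>x y. x \<in> S \<Longrightarrow> y \<in> S \<Longrightarrow> x \<noteq> y \<Longrightarrow> 0 \<le> q x y"
    and \<Lambda>: "0 < \<Lambda>" "\<And>x. x \<in> A \<Longrightarrow> (\<Sum>y\<in>S - {x}. q x y) \<le> \<Lambda>"
begin

lemma finite_A: "finite A"
  using A finite_S finite_subset by blast

definition ktrans :: "real \<Rightarrow> ('s \<Rightarrow> real) \<Rightarrow> 's \<Rightarrow> real" where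
  "ktrans s g x = (\<Sum>y\<in>A. P s x y * g y)"

text \<open>Euler step for the generator killed outside \<open>A\<close>: every jump out of
  \<open>x\<close> is subtracted, only jumps into \<open>A\<close> are credited.\<close>

definition kstep :: "real \<Rightarrow> ('s \<Rightarrow> real) \<Rightarrow> 's \<Rightarrow> real" where
  "kstep s g x = g x + s * ((\<Sum>y\<in>A - {x}. q x y * g y) - (\<Sum>y\<in>S - {x}. q x y) * g x)"

lemma kstep_bound:
  assumes "0 \<le> s" "s * \<Lambda> \<le> 1" and g: "\<And>y. y \<in> A \<Longrightarrow> \<bar>g y\<bar> \<le> 1" and x: "x \<in> A"
  shows "\<bar>kstep s g x\<bar> \<le> 1"
proof -
  let ?r = "\<Sum>y\<in>S - {x}. q x y"
  have xS: "x \<in> S" using x A by auto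
  have nn: "0 \<le> ?r" using q_nonneg xS by (intro sum_nonneg) auto
  have "\<bar>\<Sum>y\<in>A - {x}. q x y * g y\<bar> \<le> (\<Sum>y\<in>A - {x}. q x y * 1)"
  proof (rule order_trans[OF sum_abs sum_mono])
    fix y assume "y \<in> A - {x}"
    then show "\<bar>q x y * g y\<bar> \<le> q x y * 1"
      using g[of y] q_nonneg[of x y] xS A by (auto simp: abs_mult intro!: mult_left_le)
  qed
  also have "\<dots> \<le> ?r"
    using A q_nonneg xS finite_S by (auto intro!: sum_mono2)
  finally have nb: "\<bar>\<Sum>y\<in>A - {x}. q x y * g y\<bar> \<le> ?r" .
  have sr: "s * ?r \<le> 1" using mult_left_mono[OF \<Lambda>(2)[OF x] assms(1)] assms(2) by linarith
  have "kstep s g x = (1 - s * ?r) * g x + s * (\<Sum>y\<in>A - {x}. q x y * g y)"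
    by (simp add: kstep_def algebra_simps)
  also have "\<bar>\<dots>\<bar> \<le> (1 - s * ?r) * 1 + s * ?r"
    using mult_left_mono[OF nb assms(1)] mult_left_mono[OF g[OF x], of "1 - s * ?r"] sr assms(1)
    by (intro order_trans[OF abs_triangle_ineq] add_mono) (auto simp: abs_mult)
  finally show ?thesis by simp
qed

text \<open>\<open>kstep s g x - g x\<close> is linear in \<open>s\<close>, so
  \<open>kstep_bound\<close> at the extreme value \<open>s = 1 / \<Lambda>\<close> controls its
  slope.\<close>

lemma kstep_close:
  assumes "0 \<le> s" and g: "\<And>y. y \<in> A \<Longrightarrow> \<bar>g y\<bar> \<le> 1" and x: "x \<in> A"
  shows "\<bar>kstep s g x - g x\<bar> \<le> 2 * \<Lambda> * s"
proof -
  let ?s = "1 / \<Lambda>"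
  have "\<bar>kstep ?s g x\<bar> \<le> 1" using \<Lambda>(1) g x by (intro kstep_bound) auto
  moreover have "kstep s g x - g x = s * \<Lambda> * (kstep ?s g x - g x)"
    using \<Lambda>(1) by (simp add: kstep_def field_simps)
  moreover have "\<bar>kstep ?s g x - g x\<bar> \<le> 2" using calculation(1) g[OF x] by linarith
  then have "s * \<Lambda> * \<bar>kstep ?s g x - g x\<bar> \<le> s * \<Lambda> * 2"
    using assms(1) \<Lambda>(1) by (intro mult_left_mono) auto
  ultimately show ?thesis using assms(1) \<Lambda>(1) by (simp add: abs_mult mult_ac)
qed

text \<open>The rates give the off-diagonal derivatives at 0, the diagonal follows because rows sum
  to 1, and finiteness of \<open>S\<close> gives uniformity. The threshold must not depend on
  \<open>g\<close>, since the estimate is applied to all iterates.\<close>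

lemma ktrans_kstep:
  assumes "0 < \<eta>"
  shows "\<exists>s0>0. \<forall>s g x. 0 \<le> s \<longrightarrow> s < s0 \<longrightarrow> x \<in> A \<longrightarrow> (\<forall>y\<in>A. \<bar>g y\<bar> \<le> 1) \<longrightarrow>
           \<bar>ktrans s g x - kstep s g x\<bar> \<le> \<eta> * s"
proof -
  \<comment> \<open>Off-diagonal errors enter twice, as gains and through the diagonal, with at most
    \<open>card S\<close> terms each; \<open>+ 1\<close> keeps the denominator positive.\<close>
  define \<eta>' where "\<eta>' = \<eta> / (2 * real (card S) + 1)"
  have \<eta>': "0 < \<eta>'" "2 * real (card S) * \<eta>' \<le> \<eta>"
    using assms by (auto simp: \<eta>'_def field_simps)
  have "\<forall>\<^sub>F s in at_right 0. \<forall>x\<in>S. \<forall>y\<in>S. x \<noteq> y \<longrightarrow> \<bar>P s x y - s * q x y\<bar> \<le> \<eta>' * s"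
  proof (intro eventually_ball_finite finite_S ballI)
    fix x y assume xy: "x \<in> S" "y \<in> S"
    show "\<forall>\<^sub>F s in at_right 0. x \<noteq> y \<longrightarrow> \<bar>P s x y - s * q x y\<bar> \<le> \<eta>' * s"
    proof (cases "x = y")
      case False
      have P0: "P 0 x y = 0" using semigroup xy False by (simp add: transition_semigroup_def)
      have "((\<lambda>t. P t x y) has_derivative (\<lambda>s. s * q x y)) (at 0 within {0..})"
        using rates xy False by (simp add: has_jump_rates_def has_field_derivative_def mult_commute_abs)
      then obtain d where "d > 0"
        "\<And>s. 0 \<le> s \<Longrightarrow> \<bar>s\<bar> < d \<Longrightarrow> \<bar>P s x y - s * q x y\<bar> \<le> \<eta>' * \<bar>s\<bar>"
        using \<eta>'(1) P0 unfolding has_derivative_within_alt by auto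
      then show ?thesis by (auto simp: eventually_at_right_field intro!: exI[of _ d])
    qed simp
  qed
  then obtain s0 where s0: "s0 > 0"
    "\<And>s x y. 0 < s \<Longrightarrow> s < s0 \<Longrightarrow> x \<in> S \<Longrightarrow> y \<in> S \<Longrightarrow> x \<noteq> y \<Longrightarrow> \<bar>P s x y - s * q x y\<bar> \<le> \<eta>' * s"
    unfolding eventually_at_right_field by auto
  have "\<bar>ktrans s g x - kstep s g x\<bar> \<le> \<eta> * s"
    if s: "0 \<le> s" "s < s0" and x: "x \<in> A" and g: "\<forall>y\<in>A. \<bar>g y\<bar> \<le> 1" for s g x
  proof -
    have xS: "x \<in> S" using x A by auto
    define e where "e y = P s x y - s * q x y" for y
    have e: "\<bar>e y\<bar> \<le> \<eta>' * s" if "y \<in> S" "y \<noteq> x" for y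
    proof (cases "s = 0")
      case True
      then show ?thesis using semigroup xS that by (simp add: transition_semigroup_def e_def)
    qed (use s0(2)[of s x y] s xS that in \<open>auto simp: e_def\<close>)
    have "(\<Sum>y\<in>S. P s x y) = 1" using semigroup s xS by (simp add: transition_semigroup_def)
    then have diag: "P s x x = 1 - (\<Sum>y\<in>S - {x}. P s x y)"
      by (subst (asm) sum.remove[OF finite_S xS]) simp
    have "ktrans s g x = P s x x * g x + (\<Sum>y\<in>A - {x}. P s x y * g y)"
      unfolding ktrans_def by (rule sum.remove[OF finite_A x])
    then have eq: "ktrans s g x - kstep s g x = (\<Sum>y\<in>A - {x}. e y * g y) - (\<Sum>y\<in>S - {x}. e y) * g x"
      by (simp add: kstep_def diag e_def sum_subtractf left_diff_distrib sum_distrib_left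
          sum_distrib_right algebra_simps)
    have "\<bar>\<Sum>y\<in>A - {x}. e y * g y\<bar> \<le> (\<Sum>y\<in>A - {x}. \<eta>' * s)"
    proof (rule order_trans[OF sum_abs sum_mono])
      fix y assume y: "y \<in> A - {x}"
      then have "\<bar>e y\<bar> * \<bar>g y\<bar> \<le> (\<eta>' * s) * 1"
        using e[of y] g A \<eta>' s by (intro mult_mono) auto
      then show "\<bar>e y * g y\<bar> \<le> \<eta>' * s" by (simp add: abs_mult)
    qed
    also have "\<dots> \<le> real (card S) * (\<eta>' * s)"
      using \<eta>' s card_mono[OF finite_S, of "A - {x}"] A
      by (simp, intro mult_right_mono) auto
    finally have 1: "\<bar>\<Sum>y\<in>A - {x}. e y * g y\<bar> \<le> real (card S) * (\<eta>' * s)" .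
    have "\<bar>\<Sum>y\<in>S - {x}. e y\<bar> \<le> (\<Sum>y\<in>S - {x}. \<eta>' * s)"
      using e by (intro order_trans[OF sum_abs sum_mono]) auto
    also have "\<dots> \<le> real (card S) * (\<eta>' * s)"
      using \<eta>' s card_mono[OF finite_S, of "S - {x}"] by (auto intro!: mult_right_mono)
    finally have "\<bar>\<Sum>y\<in>S - {x}. e y\<bar> * \<bar>g x\<bar> \<le> real (card S) * (\<eta>' * s) * 1"
      using g x by (intro mult_mono) auto
    then have "\<bar>ktrans s g x - kstep s g x\<bar> \<le> 2 * real (card S) * \<eta>' * s"
      using 1 unfolding eq by (simp add: abs_mult abs_triangle_ineq4[THEN order_trans])
    also have "\<dots> \<le> \<eta> * s" using \<eta>'(2) s by (intro mult_right_mono) auto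
    finally show ?thesis .
  qed
  then show ?thesis using s0(1) by blast
qed

section \<open>Observing the path on a time grid\<close>

lemma X_pred [measurable]: "0 \<le> t \<Longrightarrow> Measurable.pred M (\<lambda>\<omega>. X t \<omega> \<in> B)"
  using measurable_compose[OF X_meas, of t "\<lambda>x. x \<in> B" "count_space UNIV"] by simp

lemma X_eq_pred [measurable]: "0 \<le> t \<Longrightarrow> Measurable.pred M (\<lambda>\<omega>. X t \<omega> = y)"
  using X_pred[of t "{y}"] by simp

definition grid_law :: "(nat \<Rightarrow> real) \<Rightarrow> nat \<Rightarrow> 's \<Rightarrow> real" where
  "grid_law u j y = measure M {\<omega> \<in> space M. (\<forall>i\<le>j. X (u i) \<omega> \<in> A) \<and> X (u j) \<omega> = y}"

text \<open>\<open>markov_property\<close> speaks of one prescribed path, so the event of staying in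
  \<open>A\<close> is cut into the finitely many paths through \<open>A\<close>. \<open>Q\<close>
  makes room for the next observation.\<close>

lemma grid_paths:
  fixes u :: "nat \<Rightarrow> real"
  assumes u: "\<And>i. 0 \<le> u i" and z: "z \<in> A" and Q: "Measurable.pred M Q"
  shows "measure M {\<omega> \<in> space M. (\<forall>i\<le>j. X (u i) \<omega> \<in> A) \<and> X (u j) \<omega> = z \<and> Q \<omega>} =
     (\<Sum>p\<in>{p \<in> PiE {..j} (\<lambda>_. A). p j = z}. measure M {\<omega> \<in> space M. (\<forall>i\<le>j. X (u i) \<omega> = p i) \<and> Q \<omega>})"
proof -
  let ?F = "{p \<in> PiE {..j} (\<lambda>_. A). p j = z}"
  let ?B = "\<lambda>p. {\<omega> \<in> space M. (\<forall>i\<le>j. X (u i) \<omega> = p i) \<and> Q \<omega>}"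
  have [measurable]: "Measurable.pred M (\<lambda>\<omega>. X (u i) \<omega> = y)" for i y
    using X_eq_pred u by blast
  note Q [measurable]
  have "finite (PiE {..j} (\<lambda>_. A))" using finite_A by (intro finite_PiE) auto
  then have fin: "finite ?F" by (rule rev_finite_subset) auto
  have disj: "disjoint_family_on ?B ?F"
    unfolding disjoint_family_on_def
  proof (intro ballI impI)
    fix p p' assume p: "p \<in> ?F" "p' \<in> ?F" "p \<noteq> p'"
    then obtain i where "i \<le> j" "p i \<noteq> p' i"
      by (metis (mono_tags, lifting) PiE_ext atMost_iff mem_Collect_eq)
    then show "?B p \<inter> ?B p' = {}" by auto
  qed
  have "{\<omega> \<in> space M. (\<forall>i\<le>j. X (u i) \<omega> \<in> A) \<and> X (u j) \<omega> = z \<and> Q \<omega>} = (\<Union>p\<in>?F. ?B p)"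
  proof (intro equalityI subsetI)
    fix \<omega> assume \<omega>: "\<omega> \<in> {\<omega> \<in> space M. (\<forall>i\<le>j. X (u i) \<omega> \<in> A) \<and> X (u j) \<omega> = z \<and> Q \<omega>}"
    then have "(\<lambda>i\<in>{..j}. X (u i) \<omega>) \<in> ?F" "\<omega> \<in> ?B (\<lambda>i\<in>{..j}. X (u i) \<omega>)" by auto
    then show "\<omega> \<in> (\<Union>p\<in>?F. ?B p)" by blast
  qed (auto simp: PiE_iff)
  then show ?thesis
    using finite_measure_finite_Union[OF fin _ disj] by (simp add: image_subset_iff)
qed

lemma grid_law_Suc:
  assumes u: "\<And>i. 0 \<le> u i" "\<And>i. u i \<le> u (Suc i)" and y: "y \<in> A"
  shows "grid_law u (Suc j) y = (\<Sum>z\<in>A. grid_law u j z * P (u (Suc j) - u j) z y)"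
proof -
  have [measurable]: "Measurable.pred M (\<lambda>\<omega>. X (u i) \<omega> = y)" "Measurable.pred M (\<lambda>\<omega>. X (u i) \<omega> \<in> B)"
    for i y B using X_eq_pred X_pred u by blast+
  let ?F = "\<lambda>z. {p \<in> PiE {..j} (\<lambda>_. A). p j = z}"
  let ?C = "\<lambda>z. {\<omega> \<in> space M. (\<forall>i\<le>j. X (u i) \<omega> \<in> A) \<and> X (u j) \<omega> = z \<and> X (u (Suc j)) \<omega> = y}"
  have path: "measure M {\<omega> \<in> space M. (\<forall>i\<le>j. X (u i) \<omega> = p i) \<and> X (u (Suc j)) \<omega> = y} =
      measure M {\<omega> \<in> space M. (\<forall>i\<le>j. X (u i) \<omega> = p i) \<and> True} * P (u (Suc j) - u j) z y"
    if p: "p \<in> ?F z" for p z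
  proof -
    define p' where "p' = p(Suc j := y)"
    have "\<forall>i\<le>Suc j. p' i \<in> S" using p y A by (auto simp: p'_def PiE_iff le_Suc_eq)
    then have "measure M {\<omega> \<in> space M. \<forall>i\<le>Suc j. X (u i) \<omega> = p' i} =
        measure M {\<omega> \<in> space M. \<forall>i\<le>j. X (u i) \<omega> = p' i} * P (u (Suc j) - u j) (p' j) (p' (Suc j))"
      using markov u by (simp add: markov_property_def)
    moreover have "(\<forall>i\<le>Suc j. X (u i) \<omega> = p' i) \<longleftrightarrow> (\<forall>i\<le>j. X (u i) \<omega> = p i) \<and> X (u (Suc j)) \<omega> = y" for \<omega>
      by (auto simp: p'_def le_Suc_eq)
    moreover have "(\<forall>i\<le>j. X (u i) \<omega> = p' i) \<longleftrightarrow> (\<forall>i\<le>j. X (u i) \<omega> = p i)" for \<omega>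
      by (auto simp: p'_def)
    moreover have "p' j = z" "p' (Suc j) = y" using p by (auto simp: p'_def)
    ultimately show ?thesis by simp
  qed
  have C: "measure M (?C z) = grid_law u j z * P (u (Suc j) - u j) z y" if "z \<in> A" for z
  proof -
    have "measure M (?C z) = (\<Sum>p\<in>?F z. measure M {\<omega> \<in> space M. (\<forall>i\<le>j. X (u i) \<omega> = p i) \<and> X (u (Suc j)) \<omega> = y})"
      by (rule grid_paths[OF u(1) that]) measurable
    also have "\<dots> = (\<Sum>p\<in>?F z. measure M {\<omega> \<in> space M. (\<forall>i\<le>j. X (u i) \<omega> = p i) \<and> True}) * P (u (Suc j) - u j) z y"
      using path unfolding sum_distrib_right by (intro sum.cong refl) blast
    also have "\<dots> = grid_law u j z * P (u (Suc j) - u j) z y"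
      unfolding grid_law_def using grid_paths[where u = u and Q = "\<lambda>_. True" and j = j, OF u(1) that] by simp
    finally show ?thesis .
  qed
  have "{\<omega> \<in> space M. (\<forall>i\<le>Suc j. X (u i) \<omega> \<in> A) \<and> X (u (Suc j)) \<omega> = y} = (\<Union>z\<in>A. ?C z)"
    using y by (auto simp: le_Suc_eq)
  moreover have "measure M (\<Union>z\<in>A. ?C z) = (\<Sum>z\<in>A. measure M (?C z))"
    by (rule finite_measure_finite_Union[OF finite_A]) (auto simp: disjoint_family_on_def)
  ultimately show ?thesis using C by (simp add: grid_law_def cong: sum.cong)
qed

lemma grid_law_0: "u 0 = 0 \<Longrightarrow> grid_law u 0 y = of_bool (y = x0)"
proof -
  assume u: "u 0 = 0"
  have "AE \<omega> in M. (X 0 \<omega> \<in> A \<and> X 0 \<omega> = y) \<longleftrightarrow> y = x0"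
    using X_start by eventually_elim (use x0 in auto)
  then have "measure M {\<omega> \<in> space M. X 0 \<omega> \<in> A \<and> X 0 \<omega> = y} = measure M {\<omega> \<in> space M. y = x0}"
    by (intro measure_eq_AE) auto
  then show ?thesis using u by (auto simp: grid_law_def prob_space)
qed

lemma grid_law_sum_le:
  assumes u: "\<And>i. 0 \<le> u i"
  shows "(\<Sum>y\<in>A. grid_law u j y) \<le> 1"
proof -
  have [measurable]: "Measurable.pred M (\<lambda>\<omega>. X (u i) \<omega> = y)" "Measurable.pred M (\<lambda>\<omega>. X (u i) \<omega> \<in> B)"
    for i y B using X_eq_pred X_pred u by blast+
  have "(\<Sum>y\<in>A. grid_law u j y) =
      measure M (\<Union>y\<in>A. {\<omega> \<in> space M. (\<forall>i\<le>j. X (u i) \<omega> \<in> A) \<and> X (u j) \<omega> = y})"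
    unfolding grid_law_def
    by (rule finite_measure_finite_Union[OF finite_A, symmetric]) (auto simp: disjoint_family_on_def)
  then show ?thesis by simp
qed

lemma grid_law_average:
  assumes u: "\<And>i. 0 \<le> u i" and "\<And>z. z \<in> A \<Longrightarrow> \<bar>f z - g z\<bar> \<le> c" "0 \<le> c"
  shows "\<bar>(\<Sum>z\<in>A. grid_law u j z * f z) - (\<Sum>z\<in>A. grid_law u j z * g z)\<bar> \<le> c"
proof -
  have "\<bar>(\<Sum>z\<in>A. grid_law u j z * f z) - (\<Sum>z\<in>A. grid_law u j z * g z)\<bar>
      \<le> (\<Sum>z\<in>A. \<bar>grid_law u j z * (f z - g z)\<bar>)"
    by (simp add: sum_subtractf[symmetric] right_diff_distrib[symmetric] sum_abs)
  also have "\<dots> \<le> (\<Sum>z\<in>A. grid_law u j z * c)"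
    using assms(2) by (intro sum_mono) (auto simp: abs_mult grid_law_def intro!: mult_left_mono)
  also have "\<dots> \<le> 1 * c"
    unfolding sum_distrib_right[symmetric]
    using grid_law_sum_le[OF u] assms(3) by (intro mult_right_mono) auto
  finally show ?thesis by simp
qed

lemma grid_law_Suc_sum:
  assumes u: "\<And>i. 0 \<le> u i" "\<And>i. u i \<le> u (Suc i)"
  shows "(\<Sum>y\<in>A. grid_law u (Suc j) y * g y) =
    (\<Sum>z\<in>A. grid_law u j z * ktrans (u (Suc j) - u j) g z)"
proof -
  have "(\<Sum>y\<in>A. grid_law u (Suc j) y * g y) =
      (\<Sum>y\<in>A. \<Sum>z\<in>A. grid_law u j z * (P (u (Suc j) - u j) z y * g y))"
    using grid_law_Suc[where u = u, OF u] by (simp add: sum_distrib_right mult.assoc)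
  also have "\<dots> = (\<Sum>z\<in>A. \<Sum>y\<in>A. grid_law u j z * (P (u (Suc j) - u j) z y * g y))"
    by (rule sum.swap)
  finally show ?thesis by (simp add: ktrans_def sum_distrib_left)
qed

text \<open>Peels off the last time step: replacing \<open>ktrans\<close> by \<open>kstep\<close>
  costs \<open>\<eta> * \<delta>\<close> when averaged over the sub-probability
  \<open>grid_law\<close>, and \<open>kstep\<close> keeps functions in the unit ball, so the
  induction hypothesis applies to \<open>kstep \<delta> g\<close>.\<close>

lemma grid_law_approx:
  assumes u: "u 0 = 0" "\<And>i. 0 \<le> u i" "\<And>i. u i \<le> u (Suc i)"
    and \<delta>: "0 \<le> \<delta>" "\<delta> * \<Lambda> \<le> 1" "\<And>i. i < k \<Longrightarrow> u (Suc i) - u i = \<delta>" and \<eta>: "0 \<le> \<eta>"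
    and close: "\<And>g x. x \<in> A \<Longrightarrow> \<forall>y\<in>A. \<bar>g y\<bar> \<le> 1 \<Longrightarrow> \<bar>ktrans \<delta> g x - kstep \<delta> g x\<bar> \<le> \<eta> * \<delta>"
    and g: "\<And>y. y \<in> A \<Longrightarrow> \<bar>g y\<bar> \<le> 1"
    and j: "j \<le> k"
  shows "\<bar>(\<Sum>y\<in>A. grid_law u j y * g y) - (kstep \<delta> ^^ j) g x0\<bar> \<le> real j * (\<eta> * \<delta>)"
  using j g
proof (induction j arbitrary: g)
  case 0
  have "(\<Sum>y\<in>A. grid_law u 0 y * g y) = (\<Sum>y\<in>A. if y = x0 then g y else 0)"
    using u(1) by (intro sum.cong) (auto simp: grid_law_0)
  then show ?case using x0 finite_A by simp
next
  case (Suc j)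
  have "\<bar>(\<Sum>y\<in>A. grid_law u (Suc j) y * g y) - (\<Sum>z\<in>A. grid_law u j z * kstep \<delta> g z)\<bar> \<le> \<eta> * \<delta>"
    unfolding grid_law_Suc_sum[where u = u, OF u(2,3)] \<delta>(3)[OF Suc_le_lessD[OF Suc.prems(1)]]
    using Suc.prems \<eta> \<delta>(1) by (intro grid_law_average[OF u(2)]) (auto intro!: close)
  moreover have "\<bar>(\<Sum>z\<in>A. grid_law u j z * kstep \<delta> g z) - (kstep \<delta> ^^ j) (kstep \<delta> g) x0\<bar> \<le> real j * (\<eta> * \<delta>)"
    using Suc.prems kstep_bound[OF \<delta>(1,2)] by (intro Suc.IH) auto
  ultimately show ?case by (simp add: funpow_swap1 algebra_simps)
qed

section \<open>From dyadic grids to the whole path\<close>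

definition survive :: "real \<Rightarrow> 'a set" where
  "survive t = {\<omega> \<in> space M. \<forall>s. 0 \<le> s \<and> s \<le> t \<longrightarrow> X s \<omega> \<in> A}"

lemma dyadic_between:
  fixes s r :: real
  assumes "0 \<le> s" "s < r"
  obtains i l where "s < real i * (1/2) ^ l" "real i * (1/2) ^ l < r"
proof -
  obtain l where l: "(1/2 :: real) ^ l < r - s"
    using assms real_arch_pow_inv[of "r - s" "1/2"] by auto
  define i where "i = nat \<lfloor>s * 2 ^ l\<rfloor> + 1"
  have "real i = of_int \<lfloor>s * 2 ^ l\<rfloor> + 1" using assms by (simp add: i_def)
  then have "s * 2 ^ l < real i" "real i \<le> s * 2 ^ l + 1" by linarith+
  then have "s < real i * (1/2) ^ l" "real i * (1/2) ^ l \<le> s + (1/2) ^ l"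
    by (simp_all add: field_simps)
  then show ?thesis using l by (intro that[of i l]) auto
qed

text \<open>By right-continuity the value at \<open>s < t\<close> is taken again at a dyadic time
  between \<open>s\<close> and \<open>t\<close>. The time \<open>t\<close> itself, which need not be
  dyadic, enters through the cap \<open>min _ t\<close>.\<close>

lemma survive_eq_grid:
  assumes t: "0 \<le> t"
  shows "survive t = {\<omega> \<in> space M. \<forall>l i. X (min (real i * (1/2) ^ l) t) \<omega> \<in> A}"
proof (intro equalityI subsetI)
  fix \<omega> assume \<omega>: "\<omega> \<in> {\<omega> \<in> space M. \<forall>l i. X (min (real i * (1/2) ^ l) t) \<omega> \<in> A}"
  have "X s \<omega> \<in> A" if s: "0 \<le> s" "s \<le> t" for s
  proof (cases "s = t")
    case True
    obtain n :: nat where "t \<le> real n" using real_arch_simple by blast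
    then have "min (real n * (1/2) ^ 0) t = t" by simp
    then show ?thesis using \<omega> True by (metis (mono_tags, lifting) mem_Collect_eq)
  next
    case False
    have "\<forall>\<^sub>F r in at_right s. X r \<omega> = X s \<omega>" using X_right \<omega> s by auto
    then obtain b where b: "b > s" "\<And>r. s < r \<Longrightarrow> r < b \<Longrightarrow> X r \<omega> = X s \<omega>"
      unfolding eventually_at_right_field by blast
    obtain i l where il: "s < real i * (1/2) ^ l" "real i * (1/2) ^ l < min b t"
      using dyadic_between[of s "min b t"] b s False by auto
    then have "X s \<omega> = X (min (real i * (1/2) ^ l) t) \<omega>" using b(2) by auto
    then show ?thesis using \<omega> by auto
  qed
  then show "\<omega> \<in> survive t" using \<omega> by (simp add: survive_def)
qed (use t in \<open>auto simp: survive_def\<close>)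

lemma survive_sets [measurable]: "0 \<le> t \<Longrightarrow> survive t \<in> sets M"
proof -
  assume t: "0 \<le> t"
  then have [measurable]: "Measurable.pred M (\<lambda>\<omega>. X (min (real i * (1/2) ^ l) t) \<omega> \<in> A)" for i l
    by (intro X_pred) auto
  show ?thesis unfolding survive_eq_grid[OF t] by measurable
qed

text \<open>On the grid of mesh \<open>(1/2) ^ l\<close> capped at \<open>t\<close>, the observed
  events decrease to survival up to \<open>t\<close>, while the observed laws are close to Euler
  iterates. The step from the last full multiple to \<open>t\<close> may be shorter than the mesh
  and is absorbed as an error of order \<delta>.\<close>

theorem killed_law_limit:
  assumes t: "0 \<le> t" and g: "\<And>y. y \<in> A \<Longrightarrow> \<bar>g y\<bar> \<le> 1"
  shows "(\<lambda>l. (kstep ((1/2) ^ l) ^^ nat \<lfloor>t * 2 ^ l\<rfloor>) g x0) \<longlonglongrightarrow>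
     (\<Sum>y\<in>A. measure M {\<omega> \<in> survive t. X t \<omega> = y} * g y)"
proof -
  define \<delta> where "\<delta> l = (1/2 :: real) ^ l" for l :: nat
  define k where "k l = nat \<lfloor>t * 2 ^ l\<rfloor>" for l :: nat
  define u where "u l i = min (real i * \<delta> l) t" for l i :: nat
  have \<delta>: "0 < \<delta> l" for l by (simp add: \<delta>_def)
  have k: "real (k l) * \<delta> l \<le> t" "t < real (Suc (k l)) * \<delta> l" for l
  proof -
    have "real (k l) = of_int \<lfloor>t * 2 ^ l\<rfloor>" using t by (simp add: k_def)
    then have "real (k l) \<le> t * 2 ^ l" "t * 2 ^ l < real (Suc (k l))" by linarith+
    then show "real (k l) * \<delta> l \<le> t" "t < real (Suc (k l)) * \<delta> l"
      by (simp_all add: \<delta>_def field_simps)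
  qed
  have u: "u l 0 = 0" "0 \<le> u l i" "u l i \<le> u l (Suc i)" for l i
    using t \<delta>[of l] by (auto simp: u_def min_def algebra_simps)
  have u_le: "u l i = real i * \<delta> l" if "i \<le> k l" for l i
  proof -
    have "real i * \<delta> l \<le> real (k l) * \<delta> l" using that \<delta>[of l] by (intro mult_right_mono) auto
    then show ?thesis using k(1)[of l] by (simp add: u_def)
  qed
  have u_ge: "u l i = t" if "Suc (k l) \<le> i" for l i
  proof -
    have "real (Suc (k l)) * \<delta> l \<le> real i * \<delta> l" using that \<delta>[of l] by (intro mult_right_mono) auto
    then show ?thesis using k(2)[of l] by (simp add: u_def)
  qed
  have grid: "(\<lambda>l. grid_law (u l) (Suc (k l)) y) \<longlonglongrightarrow> measure M {\<omega> \<in> survive t. X t \<omega> = y}" for y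
  proof -
    define D where "D l = {\<omega> \<in> space M. (\<forall>i. X (u l i) \<omega> \<in> A) \<and> X t \<omega> = y}" for l
    have [measurable]: "Measurable.pred M (\<lambda>\<omega>. X (u l i) \<omega> \<in> A)" "Measurable.pred M (\<lambda>\<omega>. X t \<omega> = y)" for l i
      using X_pred[OF u(2)] X_eq_pred[OF t] by blast+
    have D_sets: "D l \<in> sets M" for l unfolding D_def by measurable
    have "grid_law (u l) (Suc (k l)) y = measure M (D l)" for l
    proof -
      have "(\<forall>i\<le>Suc (k l). X (u l i) \<omega> \<in> A) \<longleftrightarrow> (\<forall>i. X (u l i) \<omega> \<in> A)" for \<omega>
        using u_ge[of l] by (metis nat_le_linear order_refl)
      then show ?thesis by (simp add: grid_law_def D_def u_ge)
    qed
    moreover have "decseq D"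
      unfolding decseq_Suc_iff
    proof (intro allI subsetI)
      fix l \<omega> assume \<omega>: "\<omega> \<in> D (Suc l)"
      \<comment> \<open>Dyadic grids are nested, so every condition at level \<open>l\<close> recurs
        at level \<open>Suc l\<close>.\<close>
      have "u l i = u (Suc l) (2 * i)" for i by (simp add: u_def \<delta>_def)
      then show "\<omega> \<in> D l" using \<omega> by (simp add: D_def)
    qed
    then have "(\<lambda>l. measure M (D l)) \<longlonglongrightarrow> measure M (\<Inter>l. D l)"
      using D_sets by (intro finite_Lim_measure_decseq) auto
    moreover have "(\<Inter>l. D l) = {\<omega> \<in> survive t. X t \<omega> = y}"
      unfolding survive_eq_grid[OF t] by (auto simp: D_def u_def \<delta>_def)
    ultimately show ?thesis by simp
  qed
  have "(\<lambda>l. (\<Sum>y\<in>A. grid_law (u l) (Suc (k l)) y * g y)) \<longlonglongrightarrow>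
      (\<Sum>y\<in>A. measure M {\<omega> \<in> survive t. X t \<omega> = y} * g y)"
    by (intro tendsto_intros grid)
  moreover have "(\<lambda>l. (\<Sum>y\<in>A. grid_law (u l) (Suc (k l)) y * g y) - (kstep (\<delta> l) ^^ k l) g x0) \<longlonglongrightarrow> 0"
  proof (rule LIMSEQ_I)
    fix r :: real assume r: "r > 0"
    \<comment> \<open>The approximation by \<open>kstep\<close> costs at most
      \<open>\<eta> * (t + 1) = r / 2\<close> in total, the last step to \<open>t\<close> another
      \<open>r / 4\<close>.\<close>
    define \<eta> where "\<eta> = r / (2 * (t + 1))"
    have \<eta>: "0 < \<eta>" "\<eta> * (t + 1) = r / 2" using r t by (auto simp: \<eta>_def field_simps)
    obtain s0 where s0: "s0 > 0" "\<And>s g x. 0 \<le> s \<Longrightarrow> s < s0 \<Longrightarrow> x \<in> A \<Longrightarrow> \<forall>y\<in>A. \<bar>g y\<bar> \<le> 1 \<Longrightarrow>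
           \<bar>ktrans s g x - kstep s g x\<bar> \<le> \<eta> * s"
      using ktrans_kstep[OF \<eta>(1)] by blast
    have "(\<lambda>l. \<delta> l) \<longlonglongrightarrow> 0" unfolding \<delta>_def by (rule LIMSEQ_power_zero) simp
    then have "\<forall>\<^sub>F l in sequentially. \<delta> l < Min {s0, 1 / \<Lambda>, r / (8 * \<Lambda>), 1}"
      using s0 \<Lambda>(1) r by (intro order_tendstoD(2)) auto
    then obtain l0 where l0: "\<And>l. l \<ge> l0 \<Longrightarrow> \<delta> l < Min {s0, 1 / \<Lambda>, r / (8 * \<Lambda>), 1}"
      unfolding eventually_sequentially by blast
    show "\<exists>no. \<forall>l\<ge>no. norm ((\<Sum>y\<in>A. grid_law (u l) (Suc (k l)) y * g y) - (kstep (\<delta> l) ^^ k l) g x0 - 0) < r"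
    proof (intro exI[of _ l0] allI impI)
      fix l assume "l \<ge> l0"
      then have d: "\<delta> l < s0" "\<delta> l * \<Lambda> \<le> 1" "2 * \<Lambda> * \<delta> l \<le> r / 4" "\<delta> l < 1"
        using l0[of l] \<Lambda>(1) by (auto simp: field_simps)
      let ?s = "u l (Suc (k l)) - u l (k l)"
      have s: "0 \<le> ?s" "?s \<le> \<delta> l"
        using u(3)[of l "k l"] u_le[of "k l" l] u_ge[of l "Suc (k l)"] k[of l]
        by (auto simp: algebra_simps)
      have A1: "\<bar>(\<Sum>y\<in>A. grid_law (u l) (Suc (k l)) y * g y) - (\<Sum>y\<in>A. grid_law (u l) (k l) y * g y)\<bar>
          \<le> \<eta> * \<delta> l + r / 4"
        unfolding grid_law_Suc_sum[where u = "u l", OF u(2,3)]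
      proof (rule grid_law_average[OF u(2)])
        fix z assume z: "z \<in> A"
        have "\<bar>ktrans ?s g z - kstep ?s g z\<bar> \<le> \<eta> * ?s" using s0(2)[OF s(1) _ z] s d g by auto
        also have "\<dots> \<le> \<eta> * \<delta> l" using s \<eta> by (intro mult_left_mono) auto
        finally have "\<bar>ktrans ?s g z - kstep ?s g z\<bar> \<le> \<eta> * \<delta> l" .
        moreover have "\<bar>kstep ?s g z - g z\<bar> \<le> 2 * \<Lambda> * ?s" using kstep_close[OF s(1) g z] .
        moreover have "2 * \<Lambda> * ?s \<le> 2 * \<Lambda> * \<delta> l" using s \<Lambda>(1) by (intro mult_left_mono) auto
        ultimately show "\<bar>ktrans ?s g z - g z\<bar> \<le> \<eta> * \<delta> l + r / 4" using d by linarith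
      qed (use \<eta> \<delta>[of l] r in auto)
      have "\<bar>(\<Sum>y\<in>A. grid_law (u l) (k l) y * g y) - (kstep (\<delta> l) ^^ k l) g x0\<bar> \<le> real (k l) * (\<eta> * \<delta> l)"
        by (rule grid_law_approx[where u = "u l" and k = "k l", OF u])
           (use \<delta>[of l] d \<eta> s0(2)[of "\<delta> l"] g u_le in \<open>auto simp: algebra_simps less_imp_le\<close>)
      also have "\<dots> \<le> \<eta> * t" using mult_left_mono[OF k(1)[of l], of \<eta>] \<eta> by (simp add: mult_ac)
      finally have "\<bar>(\<Sum>y\<in>A. grid_law (u l) (Suc (k l)) y * g y) - (kstep (\<delta> l) ^^ k l) g x0\<bar>
          \<le> \<eta> * t + \<eta> * \<delta> l + r / 4" using A1 by linarith
      moreover have "\<eta> * \<delta> l \<le> \<eta> * 1" using d \<eta> by (intro mult_left_mono) auto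
      ultimately show "norm ((\<Sum>y\<in>A. grid_law (u l) (Suc (k l)) y * g y) - (kstep (\<delta> l) ^^ k l) g x0 - 0) < r"
        using \<eta>(2) r by (simp add: algebra_simps)
    qed
  qed
  ultimately have "(\<lambda>l. (kstep (\<delta> l) ^^ k l) g x0) \<longlonglongrightarrow>
     (\<Sum>y\<in>A. measure M {\<omega> \<in> survive t. X t \<omega> = y} * g y)"
    by (rule Lim_transform2)
  then show ?thesis unfolding \<delta>_def k_def .
qed

end

section \<open>Drift of the Curie-Weiss process\<close>

text \<open>The inequality that makes \<open>tanh x / x\<close> decrease on the positive
  axis.\<close>

lemma less_sinh_cosh:
  fixes x :: real assumes "0 < x"
  shows "x < sinh x * cosh x"
proof -
  have "\<exists>z>0. z < x \<and> (sinh x * cosh x - x) - (sinh 0 * cosh 0 - 0) = (x - 0) * (2 * (sinh z)\<^sup>2)"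
  proof (rule MVT2[OF assms])
    fix z :: real
    have "((\<lambda>x. sinh x * cosh x - x) has_real_derivative cosh z * cosh z + sinh z * sinh z - 1) (at z)"
      by (auto intro!: derivative_eq_intros)
    moreover have "cosh z * cosh z + sinh z * sinh z - 1 = 2 * (sinh z)\<^sup>2"
      using cosh_square_eq[of z] by (simp add: power2_eq_square)
    ultimately show "((\<lambda>x. sinh x * cosh x - x) has_real_derivative 2 * (sinh z)\<^sup>2) (at z)" by simp
  qed
  then obtain z where "z > 0" "sinh x * cosh x - x = x * (2 * (sinh z)\<^sup>2)" by auto
  moreover have "0 < x * (2 * (sinh z)\<^sup>2)" using calculation(1) assms by simp
  ultimately show ?thesis by linarith
qed

locale curie_weiss =
  fixes \<beta> :: real
  assumes \<beta>: "1 < \<beta>"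
begin

text \<open>The jump rates without their common factor \<open>n / 2\<close>.\<close>

definition up :: "real \<Rightarrow> real" where "up m = (1 - m) * exp (\<beta> * m)"
definition down :: "real \<Rightarrow> real" where "down m = (1 + m) * exp (- \<beta> * m)"
definition up' :: "real \<Rightarrow> real" where "up' m = (\<beta> * (1 - m) - 1) * exp (\<beta> * m)"
definition down' :: "real \<Rightarrow> real" where "down' m = (1 - \<beta> * (1 + m)) * exp (- \<beta> * m)"

lemma up_deriv: "(up has_real_derivative up' m) (at m)"
  unfolding up_def up'_def by (auto intro!: derivative_eq_intros simp: algebra_simps)

lemma down_deriv: "(down has_real_derivative down' m) (at m)"
  unfolding down_def down'_def by (auto intro!: derivative_eq_intros simp: algebra_simps)

lemma drift_deriv: "((\<lambda>m. up m - down m) has_real_derivative up' m - down' m) (at m)"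
  by (intro derivative_intros up_deriv down_deriv)

lemma drift_deriv_hyperbolic: "up' m - down' m = 2 * cosh (\<beta> * m) * (\<beta> - 1 - \<beta> * m * tanh (\<beta> * m))"
proof -
  have "exp (\<beta> * m) = cosh (\<beta> * m) + sinh (\<beta> * m)" "exp (- \<beta> * m) = cosh (\<beta> * m) - sinh (\<beta> * m)"
    by (simp_all add: cosh_plus_sinh cosh_minus_sinh)
  then have "up' m - down' m = 2 * (\<beta> - 1) * cosh (\<beta> * m) - 2 * \<beta> * m * sinh (\<beta> * m)"
    unfolding up'_def down'_def by (simp only:) (simp add: algebra_simps)
  also have "\<dots> = 2 * cosh (\<beta> * m) * (\<beta> - 1 - \<beta> * m * tanh (\<beta> * m))"
    by (simp add: tanh_def algebra_simps)
  finally show ?thesis .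
qed

lemma drift_hyperbolic: "up m - down m = 2 * (sinh (\<beta> * m) - m * cosh (\<beta> * m))"
proof -
  have "exp (\<beta> * m) = cosh (\<beta> * m) + sinh (\<beta> * m)" "exp (- \<beta> * m) = cosh (\<beta> * m) - sinh (\<beta> * m)"
    by (simp_all add: cosh_plus_sinh cosh_minus_sinh)
  then show ?thesis
    unfolding up_def down_def by (simp only:) (simp add: algebra_simps)
qed

text \<open>The drift vanishes at 0 and at \<open>m_plus\<close>, so its derivative has a zero in
  between; it changes sign only there because \<open>\<beta> * m * tanh (\<beta> * m)\<close> is
  strictly increasing.\<close>

lemma drift_turning_point:
  obtains \<xi> where "0 < \<xi>" "\<xi> < m_plus \<beta>"
    "\<And>m. 0 < m \<Longrightarrow> m < \<xi> \<Longrightarrow> 0 < up' m - down' m" "\<And>m. \<xi> < m \<Longrightarrow> up' m - down' m < 0"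
proof -
  note mp = ex1_m_plus(2-4)[OF \<beta>]
  have "\<exists>z>0. z < m_plus \<beta> \<and> (up (m_plus \<beta>) - down (m_plus \<beta>)) - (up 0 - down 0)
      = (m_plus \<beta> - 0) * (up' z - down' z)"
    by (rule MVT2[OF mp(1)]) (rule drift_deriv)
  then obtain \<xi> where \<xi>: "0 < \<xi>" "\<xi> < m_plus \<beta>" "up' \<xi> - down' \<xi> = 0"
    using mp by (auto simp: up_def down_def)
  let ?H = "\<lambda>m. \<beta> * m * tanh (\<beta> * m)"
  have H: "?H m < ?H m'" if "0 < m" "m < m'" for m m'
    using that \<beta> by (intro mult_strict_mono[of "\<beta> * m" "\<beta> * m'"]) auto
  have "\<beta> - 1 - ?H \<xi> = 0" using \<xi>(3) unfolding drift_deriv_hyperbolic by simp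
  then have "0 < \<beta> - 1 - ?H m" if "0 < m" "m < \<xi>" for m using H[OF that] by linarith
  moreover have "\<beta> - 1 - ?H m < 0" if "\<xi> < m" for m
    using H[OF \<xi>(1) that] \<open>\<beta> - 1 - ?H \<xi> = 0\<close> by linarith
  ultimately show thesis
    using \<xi> by (intro that[of \<xi>]) (simp_all add: drift_deriv_hyperbolic mult_pos_neg)
qed

text \<open>Mean value theorem against the zero on the same side of the turning point: 0 where the
  drift increases, \<open>m_plus\<close> where it decreases.\<close>

lemma drift_pos:
  assumes "0 < m" "m < m_plus \<beta>"
  shows "down m < up m"
proof -
  note mp = ex1_m_plus(2-4)[OF \<beta>]
  obtain \<xi> where \<xi>: "0 < \<xi>" "\<xi> < m_plus \<beta>"
    "\<And>m. 0 < m \<Longrightarrow> m < \<xi> \<Longrightarrow> 0 < up' m - down' m" "\<And>m. \<xi> < m \<Longrightarrow> up' m - down' m < 0"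
    using drift_turning_point by blast
  show ?thesis
  proof (cases "m \<le> \<xi>")
    case True
    have "\<exists>z>0. z < m \<and> (up m - down m) - (up 0 - down 0) = (m - 0) * (up' z - down' z)"
      by (rule MVT2[OF assms(1)]) (rule drift_deriv)
    then obtain z where z: "0 < z" "z < m" "up m - down m = m * (up' z - down' z)"
      by (auto simp: up_def down_def)
    have "0 < m * (up' z - down' z)" using z True \<xi>(3)[of z] assms(1) by (intro mult_pos_pos) auto
    then show ?thesis using z by linarith
  next
    case False
    have "\<exists>z>m. z < m_plus \<beta> \<and> (up (m_plus \<beta>) - down (m_plus \<beta>)) - (up m - down m)
        = (m_plus \<beta> - m) * (up' z - down' z)"
      by (rule MVT2[OF assms(2)]) (rule drift_deriv)
    then obtain z where z: "m < z" "- (up m - down m) = (m_plus \<beta> - m) * (up' z - down' z)"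
      using mp(3) by (auto simp: up_def down_def)
    have "(m_plus \<beta> - m) * (up' z - down' z) < 0"
      using z False \<xi>(4)[of z] assms(2) by (intro mult_pos_neg) auto
    then show ?thesis using z by linarith
  qed
qed

text \<open>\<open>ms\<close> becomes the border between the two regimes: beyond the turning point,
  but below \<open>m_plus\<close>, so that the drift is still positive up to it.\<close>

lemma drift_antimono_near_m_plus:
  assumes "\<epsilon> < m_plus \<beta>"
  obtains ms where "\<epsilon> < ms" "0 < ms" "ms < m_plus \<beta>"
    "\<And>x y. ms \<le> x \<Longrightarrow> x \<le> y \<Longrightarrow> up y - down y \<le> up x - down x"
proof -
  obtain \<xi> where \<xi>: "0 < \<xi>" "\<xi> < m_plus \<beta>"
    "\<And>m. 0 < m \<Longrightarrow> m < \<xi> \<Longrightarrow> 0 < up' m - down' m" "\<And>m. \<xi> < m \<Longrightarrow> up' m - down' m < 0"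
    using drift_turning_point by blast
  define ms where "ms = (max \<epsilon> \<xi> + m_plus \<beta>) / 2"
  have ms: "\<epsilon> < ms" "\<xi> < ms" "ms < m_plus \<beta>" using assms \<xi> by (auto simp: ms_def max_def)
  have "up y - down y \<le> up x - down x" if "ms \<le> x" "x \<le> y" for x y
  proof (rule DERIV_nonpos_imp_nonincreasing[OF that(2)])
    fix z assume "x \<le> z" "z \<le> y"
    then have "up' z - down' z < 0" using that ms by (intro \<xi>(4)) auto
    then show "\<exists>d. ((\<lambda>m. up m - down m) has_real_derivative d) (at z) \<and> d \<le> 0"
      using drift_deriv by (meson less_imp_le)
  qed
  then show thesis using ms \<xi> by (intro that[of ms]) auto
qed

lemma down_antimono:
  assumes "0 \<le> x" "x \<le> y"
  shows "down y \<le> down x"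
proof (rule DERIV_nonpos_imp_nonincreasing[OF assms(2)])
  fix z assume "x \<le> z" "z \<le> y"
  then have "1 * 1 \<le> \<beta> * (1 + z)" using assms \<beta> by (intro mult_mono) auto
  then have "down' z \<le> 0" unfolding down'_def by (intro mult_nonpos_nonneg) auto
  then show "\<exists>d. (down has_real_derivative d) (at z) \<and> d \<le> 0" using down_deriv by blast
qed

text \<open>\<theta> is the maximum of the continuous ratio \<open>down / up\<close> on a compact
  interval where \<open>drift_pos\<close> keeps it below 1.\<close>

lemma rate_ratio:
  assumes "0 < \<epsilon>" "\<epsilon> \<le> ms" "ms < m_plus \<beta>"
  obtains \<theta> where "0 < \<theta>" "\<theta> < 1" "\<And>m. \<epsilon> \<le> m \<Longrightarrow> m \<le> ms \<Longrightarrow> down m \<le> \<theta> * up m"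
proof -
  note mp = ex1_m_plus(2-4)[OF \<beta>]
  have up_pos: "0 < up m" if "m \<in> {\<epsilon>..ms}" for m using that assms mp unfolding up_def by auto
  have "continuous_on {\<epsilon>..ms} (\<lambda>m. down m / up m)"
    using up_pos unfolding up_def down_def
    by (intro continuous_intros) (metis less_irrefl up_def up_pos)
  then obtain m0 where m0: "m0 \<in> {\<epsilon>..ms}" "\<And>m. m \<in> {\<epsilon>..ms} \<Longrightarrow> down m / up m \<le> down m0 / up m0"
    using continuous_attains_sup[of "{\<epsilon>..ms}" "\<lambda>m. down m / up m"] assms by auto
  have "down m0 / up m0 < 1" using drift_pos[of m0] up_pos[OF m0(1)] m0(1) assms by simp
  moreover have "0 < down m0 / up m0" using up_pos[OF m0(1)] m0(1) assms by (simp add: down_def)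
  moreover have "down m \<le> down m0 / up m0 * up m" if "\<epsilon> \<le> m" "m \<le> ms" for m
    using m0(2)[of m] up_pos[of m] that by (simp add: pos_divide_le_eq)
  ultimately show thesis by (intro that)
qed

section \<open>The weight and the weighted drift\<close>

definition weight :: "real \<Rightarrow> real" where "weight m = 1 / (m * cosh (\<beta> * m))"
definition weight' :: "real \<Rightarrow> real" where
  "weight' m = - (cosh (\<beta> * m) + \<beta> * m * sinh (\<beta> * m)) / (m * cosh (\<beta> * m))\<^sup>2"

lemma weight_deriv: "0 < m \<Longrightarrow> (weight has_real_derivative weight' m) (at m)"
  unfolding weight_def weight'_def
  by (auto intro!: derivative_eq_intros simp: power2_eq_square field_simps less_imp_neq[symmetric])

lemma weight_pos: "0 < m \<Longrightarrow> 0 < weight m"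
  by (simp add: weight_def)

lemma weight_antimono: "0 < x \<Longrightarrow> x \<le> y \<Longrightarrow> weight y \<le> weight x"
  using \<beta> unfolding weight_def
  by (intro divide_left_mono mult_mono mult_pos_pos) (auto simp: cosh_real_nonneg_le_iff)

text \<open>The derivative of \<open>(up - down) * weight = 2 (tanh (\<beta> m) / m - 1)\<close>, which decreases on all
  of \<open>(0, \<infinity>)\<close> although the drift itself does not.\<close>

lemma weighted_drift_deriv_neg:
  assumes "0 < m"
  shows "(up' m * weight m + up m * weight' m) - (down' m * weight m + down m * weight' m) < 0"
proof -
  let ?c = "cosh (\<beta> * m)" and ?s = "sinh (\<beta> * m)"
  have "(up' m * weight m + up m * weight' m) - (down' m * weight m + down m * weight' m)
      = (up' m - down' m) * weight m + (up m - down m) * weight' m"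
    by (simp add: algebra_simps)
  also have "\<dots> = (2 * (\<beta> - 1) * ?c - 2 * \<beta> * m * ?s) * weight m + 2 * (?s - m * ?c) * weight' m"
    unfolding drift_deriv_hyperbolic drift_hyperbolic by (simp add: tanh_def algebra_simps)
  also have "\<dots> = 2 * (m * \<beta> * (?c\<^sup>2 - ?s\<^sup>2) - ?s * ?c) / (m * ?c)\<^sup>2"
    using assms by (simp add: weight_def weight'_def field_simps power2_eq_square)
  also have "\<dots> = 2 * (\<beta> * m - ?s * ?c) / (m * ?c)\<^sup>2"
    by (simp add: hyperbolic_pythagoras mult.commute)
  also have "\<dots> < 0"
    using less_sinh_cosh[of "\<beta> * m"] assms \<beta> by (intro divide_neg_pos) auto
  finally show ?thesis .
qed

text \<open>The mean value theorem, applied separately to the up and the down part, gives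
  intermediate points \<open>x\<close> and \<open>y\<close>, with the second weight taken at
  \<open>y - h\<close>. Hence \<Psi> has three arguments; on the diagonal it is the derivative of
  the weighted drift, negative by compactness, and uniform continuity extends this to nearby
  triples.\<close>

lemma discrete_drift:
  assumes \<epsilon>: "0 < \<epsilon>" "\<epsilon> < 1"
  shows "\<exists>\<kappa>>0. \<exists>h0>0. \<forall>h m. 0 < h \<longrightarrow> h \<le> h0 \<longrightarrow> \<epsilon> \<le> m \<longrightarrow> m + h \<le> 1 \<longrightarrow>
     up (m + h) * weight (m + h) - up m * weight m - down (m + h) * weight m + down m * weight (m - h)
       \<le> - (2 * \<kappa> * h * weight m)"
proof -
  define \<Psi> where "\<Psi> = (\<lambda>(x, y, z). up' x * weight x + up x * weight' x - (down' y * weight z + down y * weight' z))"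
  \<comment> \<open>The left end \<open>\<epsilon> / 2\<close> leaves room for the shifted argument
    \<open>y - h\<close>.\<close>
  let ?I = "{\<epsilon> / 2..1}"
  have "continuous_on (?I \<times> ?I \<times> ?I) \<Psi>"
    unfolding \<Psi>_def up_def up'_def down_def down'_def weight_def weight'_def case_prod_unfold
    using \<epsilon> by (intro continuous_intros) auto
  moreover have "compact (?I \<times> ?I \<times> ?I)" by (intro compact_Times compact_Icc)
  ultimately have unif: "uniformly_continuous_on (?I \<times> ?I \<times> ?I) \<Psi>"
    and cont: "continuous_on (?I \<times> ?I \<times> ?I) \<Psi>"
    by (auto intro: compact_uniformly_continuous)
  have "continuous_on {\<epsilon>..1} (\<lambda>m. \<Psi> (m, m, m))"
    by (rule continuous_on_compose2[OF cont]) (use \<epsilon> in \<open>auto intro!: continuous_intros\<close>)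
  then obtain m0 where m0: "m0 \<in> {\<epsilon>..1}" "\<And>m. m \<in> {\<epsilon>..1} \<Longrightarrow> \<Psi> (m, m, m) \<le> \<Psi> (m0, m0, m0)"
    using continuous_attains_sup[of "{\<epsilon>..1}" "\<lambda>m. \<Psi> (m, m, m)"] \<epsilon> by auto
  define c where "c = - \<Psi> (m0, m0, m0)"
  have c: "0 < c"
    using weighted_drift_deriv_neg[of m0] m0(1) \<epsilon> by (simp add: c_def \<Psi>_def)
  obtain d where d: "d > 0" "\<And>v v'. v \<in> ?I \<times> ?I \<times> ?I \<Longrightarrow> v' \<in> ?I \<times> ?I \<times> ?I \<Longrightarrow> dist v' v < d \<Longrightarrow>
      dist (\<Psi> v') (\<Psi> v) < c / 2"
    using unif c unfolding uniformly_continuous_on_def by (metis half_gt_zero)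
  \<comment> \<open>Each of the three coordinates is within \<open>h\<close> of \<open>m\<close>, so
    \<open>3 * h < d\<close> is needed.\<close>
  define h0 where "h0 = min (\<epsilon> / 2) (d / 4)"
  \<comment> \<open>Makes \<open>2 * \<kappa> * weight m\<close> at most \<open>c / 2\<close>, the
    margin left after uniform continuity has used the other half.\<close>
  define \<kappa> where "\<kappa> = c / (4 * weight \<epsilon>)"
  have \<kappa>: "0 < \<kappa>" using c weight_pos[OF \<epsilon>(1)] by (simp add: \<kappa>_def)
  have "up (m + h) * weight (m + h) - up m * weight m - down (m + h) * weight m + down m * weight (m - h)
       \<le> - (2 * \<kappa> * h * weight m)"
    if h: "0 < h" "h \<le> h0" and m: "\<epsilon> \<le> m" "m + h \<le> 1" for h m
  proof -
    have h': "h \<le> \<epsilon> / 2" "3 * h < d" using h by (auto simp: h0_def min_def split: if_splits)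
    have lt: "m < m + h" using h by simp
    have "\<exists>x>m. x < m + h \<and> up (m + h) * weight (m + h) - up m * weight m
        = (m + h - m) * (up' x * weight x + up x * weight' x)"
    proof (rule MVT2[OF lt])
      fix x assume x: "m \<le> x"
      show "((\<lambda>x. up x * weight x) has_real_derivative up' x * weight x + up x * weight' x) (at x)"
        using DERIV_mult[OF up_deriv weight_deriv[of x]] x m \<epsilon> by (simp add: add.commute mult.commute)
    qed
    then obtain x where x: "m < x" "x < m + h" "up (m + h) * weight (m + h) - up m * weight m
        = h * (up' x * weight x + up x * weight' x)" by auto
    have "\<exists>y>m. y < m + h \<and> down (m + h) * weight (m + h - h) - down m * weight (m - h)
        = (m + h - m) * (down' y * weight (y - h) + down y * weight' (y - h))"
    proof (rule MVT2[OF lt])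
      fix y assume y: "m \<le> y"
      have pos: "0 < y - h" using y m \<epsilon> h' by linarith
      have "((\<lambda>y. weight (y - h)) has_real_derivative weight' (y - h) * 1) (at y)"
        by (rule DERIV_chain2[where f = weight and g = "\<lambda>y. y - h", OF weight_deriv[OF pos]]) (auto intro!: derivative_eq_intros)
      from DERIV_mult[OF down_deriv this]
      show "((\<lambda>y. down y * weight (y - h)) has_real_derivative down' y * weight (y - h) + down y * weight' (y - h)) (at y)"
        by (simp add: add.commute mult.commute)
    qed
    then obtain y where y: "m < y" "y < m + h" "down (m + h) * weight m - down m * weight (m - h)
        = h * (down' y * weight (y - h) + down y * weight' (y - h))" by auto
    have eq: "up (m + h) * weight (m + h) - up m * weight m - down (m + h) * weight m + down m * weight (m - h)
       = h * \<Psi> (x, y, y - h)"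
      using x(3) y(3) by (simp add: \<Psi>_def right_diff_distrib)
    have "dist (x, y, y - h) (m, m, m) \<le> \<bar>x - m\<bar> + (\<bar>y - m\<bar> + \<bar>y - h - m\<bar>)"
      unfolding dist_norm diff_Pair real_norm_def[symmetric]
      by (rule order_trans[OF norm_Pair_le]) (intro add_left_mono norm_Pair_le)
    also have "\<dots> \<le> 3 * h" using x y by linarith
    finally have "dist (x, y, y - h) (m, m, m) < d" using h' by linarith
    then have "dist (\<Psi> (x, y, y - h)) (\<Psi> (m, m, m)) < c / 2"
      using x y h' m \<epsilon> h by (intro d(2)) auto
    then have "\<Psi> (x, y, y - h) \<le> \<Psi> (m, m, m) + c / 2" unfolding dist_real_def by linarith
    moreover have "\<Psi> (m, m, m) \<le> - c" using m0(2)[of m] m h by (simp add: c_def)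
    ultimately have "\<Psi> (x, y, y - h) \<le> - (c / 2)" by linarith
    also have "\<dots> \<le> - (2 * \<kappa> * weight m)"
    proof -
      have "2 * \<kappa> * weight m \<le> 2 * \<kappa> * weight \<epsilon>"
        using weight_antimono[OF \<epsilon>(1) m(1)] \<kappa> by (intro mult_left_mono) auto
      also have "\<dots> = c / 2" using weight_pos[OF \<epsilon>(1)] by (simp add: \<kappa>_def)
      finally show ?thesis by simp
    qed
    finally have "h * \<Psi> (x, y, y - h) \<le> h * (- (2 * \<kappa> * weight m))" using h by (intro mult_left_mono) auto
    then show ?thesis unfolding eq by (simp add: mult_ac)
  qed
  moreover have "0 < h0" using \<epsilon> d by (simp add: h0_def)
  ultimately show ?thesis using \<kappa> by blast
qed

end

section \<open>Contraction uniformly in the number of spins\<close>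

lemma (in killed_birth_death) osc_decay_mono:
  assumes "osc_decay c C" "c' \<le> c" "C \<le> C'" "0 \<le> C'"
  shows "osc_decay c' C'"
proof -
  have le: "C * exp (- c * (real k * \<delta>)) \<le> C' * exp (- c' * (real k * \<delta>))" if "0 < \<delta>" for k \<delta>
    using assms(2-4) that mult_right_mono[OF assms(2), of "real k * \<delta>"] by (intro mult_mono) auto
  obtain \<delta>0 where \<delta>0: "\<delta>0 > 0" and dec: "\<And>\<delta> k g. 0 < \<delta> \<Longrightarrow> \<delta> \<le> \<delta>0 \<Longrightarrow> g 0 = 0 \<Longrightarrow> \<forall>i\<le>N. \<bar>g i\<bar> \<le> 1 \<Longrightarrow>
     \<exists>lo hi. hi - lo \<le> C * exp (- c * (real k * \<delta>)) \<and>
        (\<forall>i\<le>N. lo * (step \<delta> ^^ k) alive i \<le> (step \<delta> ^^ k) g i \<and>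
               (step \<delta> ^^ k) g i \<le> hi * (step \<delta> ^^ k) alive i)"
    using assms(1) unfolding osc_decay_def by blast
  show ?thesis
    unfolding osc_decay_def
  proof (rule exI[of _ \<delta>0], intro conjI allI impI \<delta>0)
    fix \<delta> :: real and k :: nat and g :: "nat \<Rightarrow> real"
    assume d: "0 < \<delta>" "\<delta> \<le> \<delta>0" "g 0 = 0" "\<forall>i\<le>N. \<bar>g i\<bar> \<le> 1"
    obtain lo hi where lh: "hi - lo \<le> C * exp (- c * (real k * \<delta>))"
      "\<forall>i\<le>N. lo * (step \<delta> ^^ k) alive i \<le> (step \<delta> ^^ k) g i \<and>
               (step \<delta> ^^ k) g i \<le> hi * (step \<delta> ^^ k) alive i"
      using dec[OF d, of k] by blast
    from lh(1) have "hi - lo \<le> C' * exp (- c' * (real k * \<delta>))" using le[OF d(1)] by (rule order_trans)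
    with lh(2) show "\<exists>lo hi. hi - lo \<le> C' * exp (- c' * (real k * \<delta>)) \<and>
        (\<forall>i\<le>N. lo * (step \<delta> ^^ k) alive i \<le> (step \<delta> ^^ k) g i \<and>
               (step \<delta> ^^ k) g i \<le> hi * (step \<delta> ^^ k) alive i)"
      by blast
  qed
qed

text \<open>For positive \<epsilon> and \<open>n\<close>, the largest \<open>i\<close> with
  \<open>-1 + 2 * i / n \<le> \<epsilon>\<close>. Site 0 is thus the last state not above \<epsilon>
  and plays the cemetery; for \<epsilon> below 1, the site numbered \<open>levels\<close> is the
  state 1.\<close>

definition base_index :: "real \<Rightarrow> nat \<Rightarrow> nat" where
  "base_index \<epsilon> n = nat \<lfloor>(1 + \<epsilon>) * real n / 2\<rfloor>"

definition site :: "real \<Rightarrow> nat \<Rightarrow> nat \<Rightarrow> real" where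
  "site \<epsilon> n i = -1 + 2 * real (base_index \<epsilon> n + i) / real n"

definition levels :: "real \<Rightarrow> nat \<Rightarrow> nat" where
  "levels \<epsilon> n = n - base_index \<epsilon> n"

lemma site_Suc: "site \<epsilon> n (Suc i) = site \<epsilon> n i + 2 / real n"
  by (simp add: site_def add_divide_distrib)

lemma site_eq: "site \<epsilon> n i = site \<epsilon> n 0 + real i * (2 / real n)"
  by (simp add: site_def add_divide_distrib)

lemma site_mono: "i \<le> j \<Longrightarrow> site \<epsilon> n i \<le> site \<epsilon> n j"
  by (simp add: site_def divide_right_mono)

context
  fixes \<epsilon> :: real and n :: nat
  assumes \<epsilon>: "0 < \<epsilon>" "\<epsilon> < 1" and n: "1 \<le> n"
begin

lemma base_index: "real (base_index \<epsilon> n) \<le> (1 + \<epsilon>) * real n / 2"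
  "(1 + \<epsilon>) * real n / 2 < real (base_index \<epsilon> n) + 1" "base_index \<epsilon> n < n"
proof -
  have "0 \<le> (1 + \<epsilon>) * real n / 2" using \<epsilon> by simp
  then have "real (base_index \<epsilon> n) = of_int \<lfloor>(1 + \<epsilon>) * real n / 2\<rfloor>" by (simp add: base_index_def)
  then show 1: "real (base_index \<epsilon> n) \<le> (1 + \<epsilon>) * real n / 2"
    "(1 + \<epsilon>) * real n / 2 < real (base_index \<epsilon> n) + 1" by linarith+
  have "\<epsilon> * real n < 1 * real n" using \<epsilon> n by (intro mult_strict_right_mono) auto
  then have "(1 + \<epsilon>) * real n / 2 < real n" by (simp add: algebra_simps)
  then show "base_index \<epsilon> n < n" using 1 by linarith
qed

lemma levels: "1 \<le> levels \<epsilon> n" "levels \<epsilon> n \<le> n" "base_index \<epsilon> n + levels \<epsilon> n = n"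
  using base_index(3) by (auto simp: levels_def)

lemma site_0_le: "site \<epsilon> n 0 \<le> \<epsilon>"
  using base_index(1) n by (simp add: site_def field_simps)

lemma site_1_gt: "\<epsilon> < site \<epsilon> n 1"
  using base_index(2) n by (simp add: site_def field_simps)

lemma site_top: "site \<epsilon> n (levels \<epsilon> n) = 1"
  using levels(3) n by (simp add: site_def del: of_nat_add)

lemma site_bounds: "1 \<le> i \<Longrightarrow> i \<le> levels \<epsilon> n \<Longrightarrow> \<epsilon> < site \<epsilon> n i \<and> site \<epsilon> n i \<le> 1"
  using site_mono[of 1 i \<epsilon> n] site_mono[of i "levels \<epsilon> n" \<epsilon> n] site_1_gt site_top by linarith

lemma site_less_1: "i < levels \<epsilon> n \<Longrightarrow> site \<epsilon> n i < 1"
  using site_mono[of "Suc i" "levels \<epsilon> n" \<epsilon> n] site_top n site_Suc[of \<epsilon> n i]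
  by (smt (verit) Suc_leI divide_pos_pos of_nat_0_less_iff less_le_trans zero_less_one)

lemma site_inj: "site \<epsilon> n i = site \<epsilon> n j \<longleftrightarrow> i = j"
  using n by (simp add: site_def)

end

context curie_weiss begin

definition birth :: "real \<Rightarrow> nat \<Rightarrow> nat \<Rightarrow> real" where
  "birth \<epsilon> n i = rate_up \<beta> n (site \<epsilon> n i)"

definition death :: "real \<Rightarrow> nat \<Rightarrow> nat \<Rightarrow> real" where
  "death \<epsilon> n i = rate_down \<beta> n (site \<epsilon> n i)"

lemma birth_eq: "birth \<epsilon> n i = real n / 2 * up (site \<epsilon> n i)"
  by (simp add: birth_def rate_up_def up_def)

lemma death_eq: "death \<epsilon> n i = real n / 2 * down (site \<epsilon> n i)"
  by (simp add: death_def rate_down_def down_def)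

lemma birth_pos:
  assumes "0 < \<epsilon>" "\<epsilon> < 1" "1 \<le> n" "i < levels \<epsilon> n"
  shows "0 < birth \<epsilon> n i"
  using site_less_1[OF assms] assms(3) by (simp add: birth_eq up_def)

lemma death_pos:
  assumes "0 < \<epsilon>" "\<epsilon> < 1" "1 \<le> n" "1 \<le> i" "i \<le> levels \<epsilon> n"
  shows "0 < death \<epsilon> n i"
  using site_bounds[OF assms] assms(1,3) by (simp add: death_eq down_def)

abbreviation "rate_bound n \<equiv> real n * (exp \<beta> + 1)"

text \<open>On the living sites \<open>up \<le> exp \<beta>\<close> and \<open>down \<le> 2\<close>,
  which gives \<open>rate_bound\<close> after multiplication by \<open>n / 2\<close>.\<close>

lemma birth_death:
  assumes "0 < \<epsilon>" "\<epsilon> < 1" "1 \<le> n"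
  shows "killed_birth_death (levels \<epsilon> n) (birth \<epsilon> n) (death \<epsilon> n) (rate_bound n)"
proof
  show "1 \<le> levels \<epsilon> n" using levels[OF assms] by simp
  show "0 < rate_bound n" using assms by (simp add: add_pos_pos)
  show top: "birth \<epsilon> n (levels \<epsilon> n) = 0" using site_top[OF assms] by (simp add: birth_eq up_def)
  show b: "0 \<le> birth \<epsilon> n i" if "1 \<le> i" "i \<le> levels \<epsilon> n" for i
    using birth_pos[OF assms, of i] top that by (cases "i = levels \<epsilon> n") auto
  show "0 \<le> death \<epsilon> n i" if "1 \<le> i" "i \<le> levels \<epsilon> n" for i
    using death_pos[OF assms that] by simp
  fix i j assume ij: "1 \<le> i" "i \<le> levels \<epsilon> n" "1 \<le> j" "j \<le> levels \<epsilon> n"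
  let ?x = "site \<epsilon> n i" and ?y = "site \<epsilon> n j"
  note x = site_bounds[OF assms ij(1,2)] and y = site_bounds[OF assms ij(3,4)]
  have "up ?x \<le> 1 * exp (\<beta> * 1)"
    unfolding up_def using x assms \<beta> by (intro mult_mono iffD2[OF exp_le_cancel_iff] mult_left_mono) auto
  moreover have "0 \<le> \<beta> * ?y" using y \<beta> assms by (intro mult_nonneg_nonneg) auto
  then have "down ?y \<le> 2 * 1"
    unfolding down_def using y assms \<beta> by (intro mult_mono) auto
  ultimately have "up ?x \<le> exp \<beta>" "down ?y \<le> 2" by simp_all
  then have "up ?x + down ?y \<le> 2 * (exp \<beta> + 1)" using exp_gt_zero[of \<beta>] by argo
  then have "real n / 2 * (up ?x + down ?y) \<le> real n / 2 * (2 * (exp \<beta> + 1))"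
    by (intro mult_left_mono) auto
  then show "birth \<epsilon> n i + death \<epsilon> n j \<le> rate_bound n"
    by (simp add: birth_eq death_eq algebra_simps)
qed

text \<open>\<open>K\<close> is of order \<open>n\<close>, so the perturbation
  \<open>2 * R * \<theta> ^ (K - 1)\<close> is exponentially small and beats the factor
  \<open>n\<close> in \<open>R\<close>. Large \<open>n\<close> also makes the mesh
  \<open>2 / n\<close> admissible in \<open>discrete_drift\<close>.\<close>

lemma contraction_large:
  assumes \<epsilon>: "0 < \<epsilon>" "\<epsilon> < m_plus \<beta>"
  shows "\<exists>c>0. \<exists>C>0. \<exists>n0. \<forall>n\<ge>n0. 1 \<le> n \<longrightarrow>
     killed_birth_death.osc_decay (levels \<epsilon> n) (birth \<epsilon> n) (death \<epsilon> n) c (C * real n)"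
proof -
  have \<epsilon>1: "\<epsilon> < 1" using \<epsilon> ex1_m_plus(3)[OF \<beta>] by simp
  obtain ms where ms: "\<epsilon> < ms" "0 < ms" "ms < m_plus \<beta>"
    "\<And>x y. ms \<le> x \<Longrightarrow> x \<le> y \<Longrightarrow> up y - down y \<le> up x - down x"
    using drift_antimono_near_m_plus[OF \<epsilon>(2)] by blast
  have ms1: "ms < 1" using ms ex1_m_plus(3)[OF \<beta>] by simp
  obtain \<theta> where \<theta>: "0 < \<theta>" "\<theta> < 1" "\<And>m. \<epsilon> \<le> m \<Longrightarrow> m \<le> ms \<Longrightarrow> down m \<le> \<theta> * up m"
    using rate_ratio[OF \<epsilon>(1) less_imp_le[OF ms(1)] ms(3)] by blast
  obtain \<kappa> h0 where \<kappa>: "0 < \<kappa>" "0 < h0" "\<And>h m. 0 < h \<Longrightarrow> h \<le> h0 \<Longrightarrow> \<epsilon> \<le> m \<Longrightarrow> m + h \<le> 1 \<Longrightarrow>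
     up (m + h) * weight (m + h) - up m * weight m - down (m + h) * weight m + down m * weight (m - h)
       \<le> - (2 * \<kappa> * h * weight m)"
    using discrete_drift[OF \<epsilon>(1) \<epsilon>1] by blast
  define L where "L = - ln \<theta>"
  \<comment> \<open>About \<open>d * n / 2\<close> sites lie between \<epsilon> and
    \<open>ms\<close>; this is the exponent that \<theta> collects.\<close>
  define d where "d = ms - \<epsilon>"
  have Ld: "0 < L" "0 < d" using \<theta> ms by (auto simp: L_def d_def)
  have "\<forall>\<^sub>F n in sequentially. 2 / real n < min (min h0 (\<epsilon> / 2)) d"
    using \<kappa>(2) \<epsilon>(1) Ld by (intro order_tendstoD(2)[of _ 0]) (real_asymp, simp)
  moreover have "(\<lambda>n. 2 * (real n * (exp \<beta> + 1)) * exp (- L * (d * real n / 2 - 1))) \<longlonglongrightarrow> 0"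
    using Ld by real_asymp
  then have "\<forall>\<^sub>F n in sequentially. 2 * (real n * (exp \<beta> + 1)) * exp (- L * (d * real n / 2 - 1)) < \<kappa>"
    using \<kappa>(1) by (rule order_tendstoD)
  ultimately have "\<forall>\<^sub>F n in sequentially. 2 / real n < min (min h0 (\<epsilon> / 2)) d \<and>
      2 * rate_bound n * exp (- L * (d * real n / 2 - 1)) < \<kappa>"
    by (rule eventually_conj)
  then obtain n0 where n0: "\<And>n. n0 \<le> n \<Longrightarrow> 2 / real n < min (min h0 (\<epsilon> / 2)) d"
    "\<And>n. n0 \<le> n \<Longrightarrow> 2 * rate_bound n * exp (- L * (d * real n / 2 - 1)) < \<kappa>"
    unfolding eventually_sequentially by blast
  \<comment> \<open>The sites 0 to \<open>N\<close> lie in \<open>[\<epsilon> / 2, 1]\<close>, where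
    the weight is extreme at the two ends; the 4 comes from
    \<open>osc_decay_contraction\<close>.\<close>
  define C where "C = 4 * (weight (\<epsilon> / 2) / weight 1)"
  have C: "0 < C" using weight_pos \<epsilon> by (simp add: C_def)
  have "killed_birth_death.osc_decay (levels \<epsilon> n) (birth \<epsilon> n) (death \<epsilon> n) (\<kappa> / 2) (C * real n)"
    if n: "n0 \<le> n" "1 \<le> n" for n
  proof -
    define N where "N = levels \<epsilon> n"
    define h where "h = 2 / real n"
    have h: "0 < h" "h \<le> h0" "h \<le> \<epsilon> / 2" "h \<le> d" using n0(1)[OF n(1)] n by (auto simp: h_def)
    let ?e = "site \<epsilon> n"
    \<comment> \<open>The first index whose site exceeds \<open>ms\<close>.\<close>
    define K where "K = nat \<lfloor>(ms - ?e 0) / h\<rfloor> + 1"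
    note site = site_0_le[OF \<epsilon>(1) \<epsilon>1 n(2)] site_1_gt[OF \<epsilon>(1) \<epsilon>1 n(2)]
    have e_eq: "?e i = ?e 0 + real i * h" for i unfolding h_def by (rule site_eq)
    have "1 \<le> (ms - ?e 0) / h" using h site(1) d_def by (simp add: field_simps)
    then have floor: "real (K - 1) \<le> (ms - ?e 0) / h" "(ms - ?e 0) / h < real K" "2 \<le> K"
      unfolding K_def by (auto simp: of_nat_nat le_nat_iff) linarith+
    have lessK: "?e i \<le> ms" if "i < K" for i
    proof -
      have "real i \<le> real (K - 1)" using that by simp
      then have "real i \<le> (ms - ?e 0) / h" using floor(1) by linarith
      then show ?thesis using h(1) e_eq[of i] by (simp add: field_simps)
    qed
    have geK: "ms < ?e i" if "K \<le> i" for i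
    proof -
      have "(ms - ?e 0) / h < real i" using that floor(2) by linarith
      then show ?thesis using h(1) e_eq[of i] by (simp add: field_simps)
    qed
    have K_exp: "\<theta> ^ (K - 1) \<le> exp (- L * (d * real n / 2 - 1))"
    proof -
      have "d * real n / 2 \<le> (ms - ?e 0) / h" using site(1) n by (simp add: d_def h_def field_simps)
      then have "d * real n / 2 - 1 \<le> real (K - 1)" using floor by linarith
      then have "L * (d * real n / 2 - 1) \<le> L * real (K - 1)" using Ld by (intro mult_left_mono) auto
      moreover have "\<theta> ^ (K - 1) = exp (- L * real (K - 1))"
        using \<theta> by (simp add: L_def exp_of_nat_mult[symmetric] mult.commute exp_of_nat2_mult)
      ultimately show ?thesis by simp
    qed
    interpret killed_birth_death N "birth \<epsilon> n" "death \<epsilon> n" "rate_bound n"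
      unfolding N_def by (rule birth_death[OF \<epsilon>(1) \<epsilon>1 n(2)])
    \<comment> \<open>The weight is also evaluated at site 0, which lies at most
      \<open>h \<le> \<epsilon> / 2\<close> below \<epsilon>.\<close>
    have site0: "\<epsilon> / 2 \<le> ?e 0" using site(2) h e_eq[of 1] by simp
    have site_lower: "\<epsilon> / 2 \<le> ?e i" for i using site0 site_mono[of 0 i \<epsilon> n] by linarith
    have site_upper: "?e i \<le> 1" if "i \<le> N" for i
      using site_mono[OF that, of \<epsilon> n] site_top[OF \<epsilon>(1) \<epsilon>1 n(2)] by (simp add: N_def)
    have site_\<epsilon>: "\<epsilon> \<le> ?e i" if "1 \<le> i" for i using site(2) site_mono[OF that, of \<epsilon> n] by linarith
    interpret contracting_birth_death N "birth \<epsilon> n" "death \<epsilon> n" "rate_bound n"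
      "\<lambda>i. weight (?e i)" \<theta> "\<theta> ^ (K - 1)" \<kappa> "weight 1" "weight (\<epsilon> / 2)" K
    proof
      show "2 \<le> K" by (rule floor)
      have "?e (K - 1) < ?e N" using lessK[of "K - 1"] ms1 site_top[OF \<epsilon>(1) \<epsilon>1 n(2)] floor(3) by (simp add: N_def)
      then have "real (K - 1) * h < real N * h" using e_eq[of "K - 1"] e_eq[of N] by linarith
      then show "K \<le> N" using h(1) by simp
      show "death \<epsilon> n (Suc i) \<le> death \<epsilon> n i" if "1 \<le> i" "i < N" for i
        unfolding death_eq using site_lower[of i] site_mono[of i "Suc i" \<epsilon> n] \<epsilon>
        by (intro mult_left_mono down_antimono) auto
      show "0 \<le> \<theta>" "\<theta> \<le> 1" using \<theta> by auto
      show "death \<epsilon> n i \<le> \<theta> * birth \<epsilon> n i" if "1 \<le> i" "i < K" for i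
        using mult_left_mono[OF \<theta>(3)[OF site_\<epsilon>[OF that(1)] lessK[OF that(2)]], of "real n / 2"]
        by (simp add: birth_eq death_eq mult_ac)
      show "0 < birth \<epsilon> n i" if "1 \<le> i" "i < K" for i
        using lessK[OF that(2)] ms1 n by (simp add: birth_eq up_def)
      show "death \<epsilon> n i - death \<epsilon> n (Suc i) \<le> birth \<epsilon> n i - birth \<epsilon> n (Suc i)"
        if "K \<le> i" "i < N" for i
      proof -
        have "up (?e (Suc i)) - down (?e (Suc i)) \<le> up (?e i) - down (?e i)"
          using geK[OF that(1)] site_mono[of i "Suc i" \<epsilon> n] by (intro ms(4)) auto
        then have "real n / 2 * (up (?e (Suc i)) - down (?e (Suc i))) \<le> real n / 2 * (up (?e i) - down (?e i))"
          by (intro mult_left_mono) auto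
        then show ?thesis by (simp add: birth_eq death_eq algebra_simps)
      qed
      show "\<theta> ^ (K - 1) \<le> \<theta> ^ (K - 1)" by simp
      show "\<theta> ^ (K - 1) \<le> 1" using \<theta> by (intro power_le_one) auto
      show "0 < \<kappa>" by (rule \<kappa>)
      have "2 * rate_bound n * \<theta> ^ (K - 1) \<le> 2 * rate_bound n * exp (- L * (d * real n / 2 - 1))"
        using K_exp R_pos by (intro mult_left_mono) auto
      then show "2 * rate_bound n * \<theta> ^ (K - 1) \<le> \<kappa>" using n0(2)[OF n(1)] by linarith
      show "0 < weight 1" by (simp add: weight_pos)
      have pos: "0 < ?e i" for i using site_lower[of i] \<epsilon> by linarith
      show "weight 1 \<le> weight (?e i)" if "i \<le> N" for i
        by (rule weight_antimono[OF pos site_upper[OF that]])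
      show "weight (?e i) \<le> weight (\<epsilon> / 2)" if "i \<le> N" for i
        using weight_antimono[OF _ site_lower] \<epsilon> by simp
      show "weight (?e (Suc i)) \<le> weight (?e i)" if "i < N" for i
        using weight_antimono[OF pos site_mono] by simp
      show "birth \<epsilon> n (Suc i) * weight (?e (Suc i)) - birth \<epsilon> n i * weight (?e i)
          - death \<epsilon> n (Suc i) * weight (?e i) + death \<epsilon> n i * weight (?e (i - 1))
          \<le> - (2 * \<kappa> * weight (?e i))" if i: "1 \<le> i" "i < N" for i
      proof -
        have s: "?e (Suc i) = ?e i + h" "?e (i - 1) = ?e i - h"
          using site_Suc[of \<epsilon> n i] site_Suc[of \<epsilon> n "i - 1"] i by (simp_all add: h_def)
        let ?T = "up (?e i + h) * weight (?e i + h) - up (?e i) * weight (?e i)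
            - down (?e i + h) * weight (?e i) + down (?e i) * weight (?e i - h)"
        have "?e i + h \<le> 1" using site_upper[of "Suc i"] s i by simp
        then have "?T \<le> - (2 * \<kappa> * h * weight (?e i))"
          using \<kappa>(3)[OF h(1,2) site_\<epsilon>[OF i(1)]] by simp
        then have "real n / 2 * ?T \<le> real n / 2 * (- (2 * \<kappa> * h * weight (?e i)))"
          by (intro mult_left_mono) auto
        \<comment> \<open>\<open>real n / 2 * h = 1\<close>: the speed of the chain cancels the
          mesh, so \<kappa> does not depend on \<open>n\<close>.\<close>
        also have "\<dots> = - (2 * \<kappa> * weight (?e i))" using n by (simp add: h_def)
        finally show ?thesis unfolding birth_eq death_eq s by (simp add: algebra_simps)
      qed
    qed
    have "osc_decay (\<kappa> / 2) (4 * (weight (\<epsilon> / 2) / weight 1) * N)" by (rule osc_decay_contraction)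
    moreover have "4 * (weight (\<epsilon> / 2) / weight 1) * N \<le> C * real n"
      unfolding C_def[symmetric] using levels(2)[OF \<epsilon>(1) \<epsilon>1 n(2)] C
      by (intro mult_left_mono) (auto simp: N_def)
    ultimately show ?thesis
      using osc_decay_mono[of "\<kappa> / 2" _ "\<kappa> / 2" "C * real n"] C unfolding N_def by simp
  qed
  moreover have "0 < \<kappa> / 2" using \<kappa>(1) by simp
  ultimately show ?thesis using C by blast
qed

lemma contraction_each:
  assumes \<epsilon>: "0 < \<epsilon>" "\<epsilon> < 1" and n: "1 \<le> n"
  shows "\<exists>c>0. \<exists>C>0. killed_birth_death.osc_decay (levels \<epsilon> n) (birth \<epsilon> n) (death \<epsilon> n) c C"
proof -
  define N where "N = levels \<epsilon> n"
  interpret killed_birth_death N "birth \<epsilon> n" "death \<epsilon> n" "rate_bound n"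
    unfolding N_def by (rule birth_death[OF assms])
  \<comment> \<open>\<open>birth\<close> at \<open>N\<close> is 0 and is left out; including
    \<open>rate_bound n\<close> makes the minimum at most \<open>R\<close>, as
    \<open>osc_decay_doeblin\<close> requires.\<close>
  define rates where "rates = insert (rate_bound n) (birth \<epsilon> n ` {1..<N} \<union> death \<epsilon> n ` {1..N})"
  have fin: "finite rates" "rates \<noteq> {}" by (auto simp: rates_def)
  have "\<forall>r\<in>rates. 0 < r"
    using R_pos birth_pos[OF assms] death_pos[OF assms] by (auto simp: rates_def N_def)
  then have "0 < Min rates" using fin by simp
  moreover have le: "Min rates \<le> r" if "r \<in> rates" for r using fin that by simp
  have "rate_bound n \<in> rates" unfolding rates_def by (rule insertI1)
  moreover have "birth \<epsilon> n i \<in> rates" if "1 \<le> i" "i < N" for i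
    unfolding rates_def by (intro insertI2 UnI1 imageI) (use that in simp)
  moreover have "death \<epsilon> n i \<in> rates" if "1 < i" "i \<le> N" for i
    unfolding rates_def by (intro insertI2 UnI2 imageI) (use that in simp)
  ultimately show ?thesis
    unfolding N_def[symmetric] using le by (intro osc_decay_doeblin[of "Min rates"]) blast+
qed

text \<open>Only finitely many \<open>n\<close> lie below the threshold, and
  \<open>osc_decay\<close> is monotone in its constants, so the smallest rate and the largest
  constant serve all of them.\<close>

lemma contraction_uniform:
  assumes \<epsilon>: "0 < \<epsilon>" "\<epsilon> < m_plus \<beta>"
  shows "\<exists>c>0. \<exists>C>0. \<forall>n\<ge>1.
     killed_birth_death.osc_decay (levels \<epsilon> n) (birth \<epsilon> n) (death \<epsilon> n) c (C * real n)"
proof -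
  have \<epsilon>1: "\<epsilon> < 1" using \<epsilon> ex1_m_plus(3)[OF \<beta>] by simp
  let ?D = "\<lambda>n c C. killed_birth_death.osc_decay (levels \<epsilon> n) (birth \<epsilon> n) (death \<epsilon> n) c (C * real n)"
  have mono: "?D n c' C'" if "?D n c C" "c' \<le> c" "C \<le> C'" "0 < C'" "1 \<le> n" for n c C c' C'
  proof -
    interpret killed_birth_death "levels \<epsilon> n" "birth \<epsilon> n" "death \<epsilon> n" "rate_bound n"
      by (rule birth_death[OF \<epsilon>(1) \<epsilon>1 that(5)])
    show ?thesis using that by (intro osc_decay_mono[OF that(1,2)] mult_right_mono) auto
  qed
  obtain c C n0 where large: "0 < c" "0 < C" "\<And>n. n0 \<le> n \<Longrightarrow> 1 \<le> n \<Longrightarrow> ?D n c C"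
    using contraction_large[OF \<epsilon>] by blast
  have "\<exists>c>0. \<exists>C>0. \<forall>n. 1 \<le> n \<and> n < k \<longrightarrow> ?D n c C" for k
  proof (induction k)
    case 0
    show ?case using zero_less_one by blast
  next
    case (Suc k)
    then obtain c1 C1 where 1: "0 < c1" "0 < C1" "\<And>n. 1 \<le> n \<Longrightarrow> n < k \<Longrightarrow> ?D n c1 C1" by blast
    show ?case
    proof (cases "k = 0")
      case True
      have "\<not> (1 \<le> n \<and> n < Suc k)" for n using True by auto
      then show ?thesis using zero_less_one by blast
    next
      case False
      then obtain c2 C2 where 2: "0 < c2" "0 < C2"
        "killed_birth_death.osc_decay (levels \<epsilon> k) (birth \<epsilon> k) (death \<epsilon> k) c2 C2"
        using contraction_each[OF \<epsilon>(1) \<epsilon>1, of k] by auto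
      \<comment> \<open>The uniform statement carries a factor \<open>n\<close>, hence the division
        by \<open>k\<close>.\<close>
      have k: "?D k c2 (C2 / real k)" using 2 False by simp
      have "?D n (min c1 c2) (max C1 (C2 / real k))" if "1 \<le> n" "n < Suc k" for n
        using mono[OF 1(3)[of n], of "min c1 c2" "max C1 (C2 / real k)"]
          mono[OF k, of "min c1 c2" "max C1 (C2 / real k)"] that 1(1,2) 2(1,2) False
        by (cases "n = k") (auto simp: less_max_iff_disj)
      moreover have "0 < min c1 c2" "0 < max C1 (C2 / real k)" using 1 2 by (auto simp: less_max_iff_disj)
      ultimately show ?thesis by blast
    qed
  qed
  then obtain c1 C1 where small: "0 < c1" "0 < C1" "\<And>n. 1 \<le> n \<Longrightarrow> n < n0 \<Longrightarrow> ?D n c1 C1" by blast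
  have "?D n (min c c1) (max C C1)" if "1 \<le> n" for n
    using mono[OF large(3)[of n], of "min c c1" "max C C1"]
      mono[OF small(3)[of n], of "min c c1" "max C C1"] that large(1,2) small(1,2)
    by (cases "n < n0") (auto simp: less_max_iff_disj)
  moreover have "0 < min c c1" "0 < max C C1" using large small by (auto simp: less_max_iff_disj)
  ultimately show ?thesis by blast
qed

end

section \<open>Quasi-stationary distributions\<close>

context killed_birth_death begin

lemma step_cong:
  assumes "\<And>j. j \<le> N \<Longrightarrow> u j = v j" "i \<le> N"
  shows "step \<delta> u i = step \<delta> v i"
proof (cases "i = N")
  case True
  then show ?thesis using assms a_top by (simp add: step_def gen_def)
next
  case False
  then have "u (Suc i) = v (Suc i)" "u (i - 1) = v (i - 1)" "u i = v i" using assms by auto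
  then show ?thesis by (simp add: step_def gen_def)
qed

lemma dyadic_floor:
  fixes t :: real
  assumes "0 \<le> t"
  shows "(\<lambda>l. real (nat \<lfloor>t * 2 ^ l\<rfloor>) * (1/2) ^ l) \<longlonglongrightarrow> t"
    and "real (nat \<lfloor>t * 2 ^ l\<rfloor>) * (1/2) ^ l \<le> t"
proof -
  have fl: "real (nat \<lfloor>t * 2 ^ l\<rfloor>) \<le> t * 2 ^ l" "t * 2 ^ l - 1 \<le> real (nat \<lfloor>t * 2 ^ l\<rfloor>)" for l
  proof -
    have "real (nat \<lfloor>t * 2 ^ l\<rfloor>) = of_int \<lfloor>t * 2 ^ l\<rfloor>" using assms by simp
    then show "real (nat \<lfloor>t * 2 ^ l\<rfloor>) \<le> t * 2 ^ l" "t * 2 ^ l - 1 \<le> real (nat \<lfloor>t * 2 ^ l\<rfloor>)" by linarith+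
  qed
  show upper: "real (nat \<lfloor>t * 2 ^ l\<rfloor>) * (1/2) ^ l \<le> t" for l
    using fl(1)[of l] by (simp add: field_simps)
  have lower: "t - (1/2) ^ l \<le> real (nat \<lfloor>t * 2 ^ l\<rfloor>) * (1/2) ^ l" for l
    using mult_right_mono[OF fl(2)[of l], of "(1/2) ^ l"] by (simp add: diff_divide_distrib power_divide)
  have "(\<lambda>l. t - (1/2 :: real) ^ l) \<longlonglongrightarrow> t - 0"
    by (intro tendsto_diff tendsto_const LIMSEQ_power_zero) simp
  then have "(\<lambda>l. t - (1/2 :: real) ^ l) \<longlonglongrightarrow> t" by simp
  from tendsto_sandwich[OF always_eventually always_eventually this tendsto_const, OF allI allI, OF lower upper]
  show "(\<lambda>l. real (nat \<lfloor>t * 2 ^ l\<rfloor>) * (1/2) ^ l) \<longlonglongrightarrow> t" .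
qed

lemma eventually_small_mesh:
  assumes "0 < \<delta>0"
  shows "\<forall>\<^sub>F l in sequentially. (1/2 :: real) ^ l \<le> \<delta>0 \<and> (1/2) ^ l * R \<le> 1 / 2"
proof -
  have "(\<lambda>l. (1/2 :: real) ^ l) \<longlonglongrightarrow> 0" by (rule LIMSEQ_power_zero) simp
  then have "\<forall>\<^sub>F l in sequentially. (1/2 :: real) ^ l < min \<delta>0 (1 / (2 * R))"
    using assms R_pos by (intro order_tendstoD(2)) auto
  then show ?thesis
    by eventually_elim (use R_pos in \<open>auto simp: field_simps\<close>)
qed

text \<open>For \<open>0 \<le> x \<le> 1 / 2\<close> one has
  \<open>exp (- (2 * x)) \<le> 1 - x\<close>, which turns the holding bound into
  \<open>exp (- (2 * R * t))\<close>, independent of the mesh.\<close>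

lemma survival_limit_pos:
  fixes t :: real
  assumes t: "0 \<le> t" and i: "1 \<le> i" "i \<le> N"
    and lim: "(\<lambda>l. (step ((1/2) ^ l) ^^ nat \<lfloor>t * 2 ^ l\<rfloor>) alive i) \<longlonglongrightarrow> V"
  shows "0 < V"
proof -
  have "exp (- (2 * R * t)) \<le> V"
  proof (rule tendsto_lowerbound[OF lim _ trivial_limit_sequentially])
    show "\<forall>\<^sub>F l in sequentially. exp (- (2 * R * t)) \<le> (step ((1/2) ^ l) ^^ nat \<lfloor>t * 2 ^ l\<rfloor>) alive i"
      using eventually_small_mesh[OF zero_less_one]
    proof eventually_elim
      case (elim l)
      define x where "x = (1/2) ^ l * R"
      define k where "k = nat \<lfloor>t * 2 ^ l\<rfloor>"
      have x: "0 \<le> x" "x \<le> 1 / 2" using elim R_pos by (auto simp: x_def)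
      have "1 \<le> (1 + 2 * x) * (1 - x)" using x mult_left_mono[of x "1/2" x] by (simp add: algebra_simps)
      also have "\<dots> \<le> exp (2 * x) * (1 - x)"
        using x exp_ge_add_one_self[of "2 * x"] by (intro mult_right_mono) auto
      finally have "exp (- (2 * x)) \<le> 1 - x" by (simp add: exp_minus field_simps)
      then have "exp (- (2 * x)) ^ k \<le> (1 - x) ^ k" by (intro power_mono) auto
      moreover have "exp (- (2 * R * t)) \<le> exp (- (2 * x)) ^ k"
      proof -
        have "R * (real k * (1/2) ^ l) \<le> R * t"
          unfolding k_def using dyadic_floor(2)[OF t] R_pos by (intro mult_left_mono) auto
        then have "- (2 * R * t) \<le> real k * (- (2 * x))" by (simp add: x_def mult_ac)
        then show ?thesis by (simp add: exp_of_nat_mult[symmetric])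
      qed
      moreover have "(1 - x) ^ k \<le> (step ((1/2) ^ l) ^^ k) alive i"
        unfolding x_def using x i by (intro iter_alive_lower) (auto simp: x_def)
      ultimately show ?case unfolding k_def by linarith
    qed
  qed
  then show ?thesis by (meson exp_gt_zero less_le_trans)
qed

text \<open>The bracket obtained at time \<open>t\<close> contains the ratios at every site and
  every later time. Allowing two sites and two times at once yields the Cauchy property,
  independence of the starting point and the rate from a single estimate.\<close>

lemma ratio_limit_contraction:
  fixes t t' :: real
  assumes osc: "osc_decay c C" and t: "0 \<le> t" "t \<le> t'"
    and g: "g 0 = 0" "\<And>i. i \<le> N \<Longrightarrow> \<bar>g i\<bar> \<le> 1" and ij: "1 \<le> i" "i \<le> N" "1 \<le> j" "j \<le> N"
    and lim: "(\<lambda>l. (step ((1/2) ^ l) ^^ nat \<lfloor>t * 2 ^ l\<rfloor>) g i) \<longlonglongrightarrow> U"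
      "(\<lambda>l. (step ((1/2) ^ l) ^^ nat \<lfloor>t * 2 ^ l\<rfloor>) alive i) \<longlonglongrightarrow> V"
      "(\<lambda>l. (step ((1/2) ^ l) ^^ nat \<lfloor>t' * 2 ^ l\<rfloor>) g j) \<longlonglongrightarrow> U'"
      "(\<lambda>l. (step ((1/2) ^ l) ^^ nat \<lfloor>t' * 2 ^ l\<rfloor>) alive j) \<longlonglongrightarrow> V'"
  shows "\<bar>U' / V' - U / V\<bar> \<le> C * exp (- c * t)"
proof -
  have t': "0 \<le> t'" using t by simp
  have V: "V \<noteq> 0" "V' \<noteq> 0"
    using survival_limit_pos[OF t(1) ij(1,2) lim(2)] survival_limit_pos[OF t' ij(3,4) lim(4)] by auto
  let ?k = "\<lambda>l. nat \<lfloor>t * 2 ^ l\<rfloor>" and ?k' = "\<lambda>l. nat \<lfloor>t' * 2 ^ l\<rfloor>" and ?\<delta> = "\<lambda>l. (1/2 :: real) ^ l"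
  let ?G = "\<lambda>l. (step (?\<delta> l) ^^ ?k l) g i / (step (?\<delta> l) ^^ ?k l) alive i"
  let ?G' = "\<lambda>l. (step (?\<delta> l) ^^ ?k' l) g j / (step (?\<delta> l) ^^ ?k' l) alive j"
  have lim1: "(\<lambda>l. \<bar>?G' l - ?G l\<bar>) \<longlonglongrightarrow> \<bar>U' / V' - U / V\<bar>"
    by (rule tendsto_rabs[OF tendsto_diff[OF tendsto_divide[OF lim(3,4) V(2)] tendsto_divide[OF lim(1,2) V(1)]]])
  have lim2: "(\<lambda>l. C * exp (- c * (real (?k l) * ?\<delta> l))) \<longlonglongrightarrow> C * exp (- c * t)"
    by (rule tendsto_mult[OF tendsto_const tendsto_exp[OF tendsto_mult[OF tendsto_const dyadic_floor(1)[OF t(1)]]]])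
  obtain \<delta>0 where \<delta>0: "\<delta>0 > 0" "\<And>\<delta> k g. 0 < \<delta> \<Longrightarrow> \<delta> \<le> \<delta>0 \<Longrightarrow> g 0 = 0 \<Longrightarrow> \<forall>i\<le>N. \<bar>g i\<bar> \<le> 1 \<Longrightarrow>
     (\<exists>lo hi. hi - lo \<le> C * exp (- c * (real k * \<delta>)) \<and>
        (\<forall>i\<le>N. lo * (step \<delta> ^^ k) alive i \<le> (step \<delta> ^^ k) g i \<and>
               (step \<delta> ^^ k) g i \<le> hi * (step \<delta> ^^ k) alive i))"
    using osc unfolding osc_decay_def by blast
  have "\<forall>\<^sub>F l in sequentially. \<bar>?G' l - ?G l\<bar> \<le> C * exp (- c * (real (?k l) * ?\<delta> l))"
    using eventually_small_mesh[OF \<delta>0(1)]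
  proof eventually_elim
    case (elim l)
    have d: "0 < ?\<delta> l" by simp
    obtain lo hi where lh: "hi - lo \<le> C * exp (- c * (real (?k l) * ?\<delta> l))"
      "\<And>i. i \<le> N \<Longrightarrow> lo * (step (?\<delta> l) ^^ ?k l) alive i \<le> (step (?\<delta> l) ^^ ?k l) g i \<and>
               (step (?\<delta> l) ^^ ?k l) g i \<le> hi * (step (?\<delta> l) ^^ ?k l) alive i"
      using \<delta>0(2)[of "?\<delta> l" g "?k l"] d elim g by blast
    have "t * 2 ^ l \<le> t' * 2 ^ l" using t by (intro mult_right_mono) auto
    then have "?k l \<le> ?k' l" by (intro nat_mono floor_mono)
    then obtain m where m: "?k' l = m + ?k l" by (metis le_add_diff_inverse2)
    have sand: "lo * (step (?\<delta> l) ^^ ?k' l) alive j \<le> (step (?\<delta> l) ^^ ?k' l) g j \<and>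
               (step (?\<delta> l) ^^ ?k' l) g j \<le> hi * (step (?\<delta> l) ^^ ?k' l) alive j"
      unfolding m funpow_add comp_apply using elim d
      by (intro step_sandwich[OF _ _ lh(2) ij(4)]) auto
    have pos: "0 < (step (?\<delta> l) ^^ k) alive i" if "1 \<le> i" "i \<le> N" for k i
    proof -
      have "0 < (1 - ?\<delta> l * R) ^ k" using elim by (intro zero_less_power) auto
      also have "\<dots> \<le> (step (?\<delta> l) ^^ k) alive i" using elim that by (intro iter_alive_lower) auto
      finally show ?thesis .
    qed
    have "lo \<le> ?G l" "?G l \<le> hi"
      using lh(2)[OF ij(2)] pos[OF ij(1,2)] by (auto simp: pos_le_divide_eq pos_divide_le_eq)
    moreover have "lo \<le> ?G' l" "?G' l \<le> hi"
      using sand pos[OF ij(3,4)] by (auto simp: pos_le_divide_eq pos_divide_le_eq)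
    ultimately show ?case using lh(1) by linarith
  qed
  then show ?thesis by (rule tendsto_le[OF trivial_limit_sequentially lim2 lim1])
qed

end

text \<open>All states are rational, so \<epsilon> is not among them; were it a state, it would be
  site 0 and belong to \<open>E_eps\<close>.\<close>

lemma E_eps_eq_sites:
  assumes "0 < \<epsilon>" "\<epsilon> < 1" "1 \<le> n" and irr: "\<epsilon> \<notin> \<rat>"
  shows "E_eps \<epsilon> n = site \<epsilon> n ` {1..levels \<epsilon> n}"
proof (intro equalityI subsetI)
  fix x assume "x \<in> E_eps \<epsilon> n"
  then obtain j where j: "j \<le> n" "x = -1 + 2 * real j / real n" "\<epsilon> \<le> x"
    by (auto simp: E_eps_def E_def)
  have "x \<in> \<rat>" unfolding j(2) by (intro Rats_add Rats_divide Rats_mult) auto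
  then have "\<epsilon> < x" using j(3) irr by (cases "\<epsilon> = x") auto
  then have "(1 + \<epsilon>) * real n / 2 < real j" using j(2) assms(3) by (simp add: field_simps)
  then have "base_index \<epsilon> n < j" using base_index(1)[OF assms(1-3)] by linarith
  then have "x = site \<epsilon> n (j - base_index \<epsilon> n)" "j - base_index \<epsilon> n \<in> {1..levels \<epsilon> n}"
    using j by (auto simp: site_def levels_def)
  then show "x \<in> site \<epsilon> n ` {1..levels \<epsilon> n}" by blast
next
  fix x assume "x \<in> site \<epsilon> n ` {1..levels \<epsilon> n}"
  then obtain i where i: "1 \<le> i" "i \<le> levels \<epsilon> n" "x = site \<epsilon> n i" by auto
  have "base_index \<epsilon> n + i \<in> {0..n}" using i levels(3)[OF assms(1-3)] by simp
  then have "x \<in> E n" unfolding i(3) site_def E_def by blast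
  then show "x \<in> E_eps \<epsilon> n"
    using site_bounds[OF assms(1-3) i(1,2)] i(3) by (simp add: E_eps_def)
qed

lemma site_in_E:
  assumes "0 < \<epsilon>" "\<epsilon> < 1" "1 \<le> n" "i \<le> levels \<epsilon> n"
  shows "site \<epsilon> n i \<in> E n"
proof -
  have "base_index \<epsilon> n + i \<in> {0..n}" using assms levels(3)[OF assms(1-3)] by simp
  then show ?thesis unfolding site_def E_def by blast
qed

lemma E_bounds: "1 \<le> n \<Longrightarrow> x \<in> E n \<Longrightarrow> -1 \<le> x \<and> x \<le> 1"
proof -
  assume "1 \<le> n" "x \<in> E n"
  then obtain i where "i \<le> n" "x = -1 + 2 * real i / real n" by (auto simp: E_def)
  moreover have "2 * real i / real n \<le> 2" using calculation(1) \<open>1 \<le> n\<close> by (simp add: pos_divide_le_eq)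
  ultimately show ?thesis by simp
qed

text \<open>Right-continuity gives the strict inequality: a path above \<epsilon> up to and
  including \<open>t\<close> stays there for a further interval, so the infimum exceeds
  \<open>t\<close>.\<close>

lemma less_hitting_time_iff:
  fixes X :: "real \<Rightarrow> 'a \<Rightarrow> real"
  assumes "0 \<le> t" and right: "\<forall>\<^sub>F s in at_right t. X s \<omega> = X t \<omega>"
  shows "ereal t < hitting_time X \<epsilon> \<omega> \<longleftrightarrow> (\<forall>s. 0 \<le> s \<and> s \<le> t \<longrightarrow> \<epsilon> < X s \<omega>)"
proof
  assume less: "ereal t < hitting_time X \<epsilon> \<omega>"
  have "\<epsilon> < X s \<omega>" if "0 \<le> s" "s \<le> t" for s
  proof (rule ccontr)
    assume "\<not> \<epsilon> < X s \<omega>"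
    then have "hitting_time X \<epsilon> \<omega> \<le> ereal s" unfolding hitting_time_def using that by (intro INF_lower) auto
    also have "\<dots> \<le> ereal t" using that by simp
    finally show False using less by simp
  qed
  then show "\<forall>s. 0 \<le> s \<and> s \<le> t \<longrightarrow> \<epsilon> < X s \<omega>" by blast
next
  assume above: "\<forall>s. 0 \<le> s \<and> s \<le> t \<longrightarrow> \<epsilon> < X s \<omega>"
  obtain b where b: "b > t" "\<And>s. t < s \<Longrightarrow> s < b \<Longrightarrow> X s \<omega> = X t \<omega>"
    using right unfolding eventually_at_right_field by blast
  have "ereal b \<le> hitting_time X \<epsilon> \<omega>" unfolding hitting_time_def
  proof (rule INF_greatest)
    fix s assume s: "s \<in> {s. 0 \<le> s \<and> X s \<omega> \<le> \<epsilon>}"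
    show "ereal b \<le> ereal s"
    proof (rule ccontr)
      assume "\<not> ereal b \<le> ereal s"
      then have "s < b" by simp
      then have "\<epsilon> < X s \<omega>" using above b(2)[of s] s assms(1) by (cases "s \<le> t") auto
      then show False using s by simp
    qed
  qed
  moreover have "ereal t < ereal b" using b by simp
  ultimately show "ereal t < hitting_time X \<epsilon> \<omega>" by (rule less_le_trans[rotated])
qed

text \<open>\<open>M\<close> and \<open>X\<close> are families indexed by the starting state; the
  chains are compared only through their laws.\<close>

locale curie_weiss_chains = curie_weiss +
  fixes \<epsilon> :: real and n :: nat and M :: "real \<Rightarrow> 'a measure" and X :: "real \<Rightarrow> real \<Rightarrow> 'a \<Rightarrow> real"
    and c C :: real
  assumes \<epsilon>: "0 < \<epsilon>" "\<epsilon> < 1" "\<epsilon> \<notin> \<rat>" and n: "1 \<le> n"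
    and chains: "\<And>m. m \<in> E_eps \<epsilon> n \<Longrightarrow> markov_chain (M m) (X m) (E n) (jump_rate \<beta> n) m"
    and osc: "killed_birth_death.osc_decay (levels \<epsilon> n) (birth \<epsilon> n) (death \<epsilon> n) c C"
    and c: "0 < c"
begin

abbreviation "N \<equiv> levels \<epsilon> n"
abbreviation "A \<equiv> E_eps \<epsilon> n"
abbreviation "e \<equiv> site \<epsilon> n"

sublocale killed_birth_death N "birth \<epsilon> n" "death \<epsilon> n" "rate_bound n"
  by (rule birth_death[OF \<epsilon>(1,2) n])

lemma A_eq: "A = e ` {1..N}"
  by (rule E_eps_eq_sites[OF \<epsilon>(1,2) n \<epsilon>(3)])

lemma e_in_A: "e i \<in> A \<longleftrightarrow> 1 \<le> i \<and> i \<le> N"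
  unfolding A_eq using site_inj[OF \<epsilon>(1,2) n] by auto

lemma e_in_E: "i \<le> N \<Longrightarrow> e i \<in> E n"
  by (rule site_in_E[OF \<epsilon>(1,2) n])

lemma A_iff:
  assumes "x \<in> E n"
  shows "x \<in> A \<longleftrightarrow> \<epsilon> < x"
proof
  assume "x \<in> A"
  then show "\<epsilon> < x" unfolding A_eq using site_bounds[OF \<epsilon>(1,2) n] by auto
next
  assume "\<epsilon> < x"
  with assms show "x \<in> A" using E_bounds[OF n, of x] by (simp add: E_eps_def)
qed

lemma finite_E: "finite (E n)"
  by (simp add: E_def)

lemma A_sub: "A \<subseteq> E n"
  by (simp add: E_eps_def)

lemma sum_jump_rate:
  assumes "1 \<le> i" and T: "finite T"
  shows "(\<Sum>y\<in>T. jump_rate \<beta> n (e i) y * g y) =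
     (if e (Suc i) \<in> T then birth \<epsilon> n i * g (e (Suc i)) else 0) +
     (if e (i - 1) \<in> T then death \<epsilon> n i * g (e (i - 1)) else 0)"
proof -
  have s: "e i + 2 / real n = e (Suc i)" "e i - 2 / real n = e (i - 1)"
    using site_Suc[of \<epsilon> n i] site_Suc[of \<epsilon> n "i - 1"] assms(1) by simp_all
  have "e (Suc i) \<noteq> e (i - 1)" using site_inj[OF \<epsilon>(1,2) n] by simp
  then have "jump_rate \<beta> n (e i) y * g y = (if y = e (Suc i) then birth \<epsilon> n i * g y else 0) +
      (if y = e (i - 1) then death \<epsilon> n i * g y else 0)" for y
    by (simp add: jump_rate_def s birth_def death_def)
  then show ?thesis using T by (simp add: sum.distrib)
qed

lemma total_jump_rate:
  assumes i: "1 \<le> i" "i \<le> N"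
  shows "(\<Sum>y\<in>E n - {e i}. jump_rate \<beta> n (e i) y) = birth \<epsilon> n i + death \<epsilon> n i"
proof -
  have "e (i - 1) \<in> E n - {e i}" using i e_in_E[of "i - 1"] site_inj[OF \<epsilon>(1,2) n] by simp
  \<comment> \<open>Site \<open>Suc N\<close> lies outside \<open>E n\<close>, but the rate towards
    it is 0.\<close>
  moreover have "e (Suc i) \<in> E n - {e i} \<or> birth \<epsilon> n i = 0"
    using i e_in_E[of "Suc i"] site_inj[OF \<epsilon>(1,2) n] a_top by (cases "i = N") auto
  ultimately show ?thesis
    using sum_jump_rate[OF i(1), of "E n - {e i}" "\<lambda>_. 1"] finite_E by auto
qed

lemma killed_chain:
  assumes "m \<in> A"
  obtains P where "killed_chain (M m) (X m) (E n) A (jump_rate \<beta> n) m P (rate_bound n)"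
proof -
  note ch = chains[OF assms, unfolded markov_chain_def]
  then obtain P where P: "transition_semigroup (E n) P" "has_jump_rates (E n) P (jump_rate \<beta> n)"
    "markov_property (M m) (X m) (E n) P" by blast
  have "killed_chain (M m) (X m) (E n) A (jump_rate \<beta> n) m P (rate_bound n)"
  proof (intro killed_chain.intro killed_chain_axioms.intro)
    show "0 \<le> jump_rate \<beta> n x y" if "x \<in> E n" for x y
      using E_bounds[OF n that] by (auto simp: jump_rate_def rate_up_def rate_down_def)
    show "(\<Sum>y\<in>E n - {x}. jump_rate \<beta> n x y) \<le> rate_bound n" if "x \<in> A" for x
    proof -
      obtain i where i: "1 \<le> i" "i \<le> N" "x = e i" using \<open>x \<in> A\<close> A_eq by auto
      show ?thesis unfolding i(3) total_jump_rate[OF i(1,2)] by (rule rate_le[OF i(1,2) i(1,2)])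
    qed
  qed (use ch P assms A_sub R_pos finite_E in auto)
  then show thesis by (rule that)
qed

definition lift :: "(real \<Rightarrow> real) \<Rightarrow> nat \<Rightarrow> real" where
  "lift g j = (if j = 0 then 0 else g (e j))"

lemma lift_simps [simp]: "lift g 0 = 0" "0 < j \<Longrightarrow> lift g j = g (e j)"
  by (simp_all add: lift_def)

definition surv :: "real \<Rightarrow> real \<Rightarrow> 'a set" where
  "surv m t = {\<omega> \<in> space (M m). ereal t < hitting_time (X m) \<epsilon> \<omega>}"

context
  fixes m P
  assumes m: "m \<in> A" and kc: "killed_chain (M m) (X m) (E n) A (jump_rate \<beta> n) m P (rate_bound n)"
begin

interpretation kc: killed_chain "M m" "X m" "E n" A "jump_rate \<beta> n" m P "rate_bound n"
  by (rule kc)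

lemma X_in_E: "\<omega> \<in> space (M m) \<Longrightarrow> 0 \<le> t \<Longrightarrow> X m t \<omega> \<in> E n"
  using kc.X_meas[of t] by (auto simp: measurable_def)

lemma surv_eq:
  assumes t: "0 \<le> t"
  shows "surv m t = kc.survive t"
proof -
  have "ereal t < hitting_time (X m) \<epsilon> \<omega> \<longleftrightarrow> (\<forall>s. 0 \<le> s \<and> s \<le> t \<longrightarrow> X m s \<omega> \<in> A)"
    if \<omega>: "\<omega> \<in> space (M m)" for \<omega>
    unfolding less_hitting_time_iff[where X = "X m" and t = t, OF t kc.X_right[OF \<omega> t]]
    using A_iff[OF X_in_E[OF \<omega>]] by blast
  then show ?thesis unfolding surv_def kc.survive_def by blast
qed

text \<open>Identifies the two Euler steps. The jump from site 1 to site 0 leaves \<open>A\<close>,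
  in accordance with \<open>lift g 0 = 0\<close>, and the jump up from \<open>N\<close> has rate
  0.\<close>

lemma kstep_site:
  assumes i: "1 \<le> i" "i \<le> N"
  shows "kc.kstep \<delta> g (e i) = step \<delta> (lift g) i"
proof -
  have fin: "finite (A - {e i})" using kc.finite_A by simp
  have "e (Suc i) \<in> A - {e i} \<longleftrightarrow> i < N" "e (i - 1) \<in> A - {e i} \<longleftrightarrow> 2 \<le> i"
    using i e_in_A[of "Suc i"] e_in_A[of "i - 1"] site_inj[OF \<epsilon>(1,2) n] by auto
  moreover have "birth \<epsilon> n i = 0" if "\<not> i < N" using that i a_top by simp
  ultimately have "(\<Sum>y\<in>A - {e i}. jump_rate \<beta> n (e i) y * g y) =
      birth \<epsilon> n i * lift g (Suc i) + death \<epsilon> n i * lift g (i - 1)"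
    unfolding sum_jump_rate[OF i(1) fin] using i by (auto simp: lift_def)
  then show ?thesis
    unfolding kc.kstep_def total_jump_rate[OF i] using i
    by (simp add: step_def gen_def lift_def algebra_simps)
qed

lemma iter_kstep_site:
  assumes i: "1 \<le> i" "i \<le> N"
  shows "(kc.kstep \<delta> ^^ k) g (e i) = (step \<delta> ^^ k) (lift g) i"
  using i
proof (induction k arbitrary: i)
  case (Suc k)
  have "lift ((kc.kstep \<delta> ^^ k) g) j = (step \<delta> ^^ k) (lift g) j" if "j \<le> N" for j
    using Suc.IH[of j] that iter_step_0[of "lift g"] by (cases "j = 0") auto
  from step_cong[OF this Suc.prems(2)] show ?case
    using kstep_site[OF Suc.prems] by simp
qed simp

lemma killed_law:
  assumes "0 \<le> t" "\<And>y. y \<in> A \<Longrightarrow> \<bar>g y\<bar> \<le> 1" and i: "1 \<le> i" "i \<le> N" "m = e i"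
  shows "(\<lambda>l. (step ((1/2) ^ l) ^^ nat \<lfloor>t * 2 ^ l\<rfloor>) (lift g) i) \<longlonglongrightarrow>
     (\<Sum>y\<in>A. measure (M m) {\<omega> \<in> surv m t. X m t \<omega> = y} * g y)"
proof -
  have "(\<lambda>l. (kc.kstep ((1/2) ^ l) ^^ nat \<lfloor>t * 2 ^ l\<rfloor>) g m) \<longlonglongrightarrow>
     (\<Sum>y\<in>A. measure (M m) {\<omega> \<in> kc.survive t. X m t \<omega> = y} * g y)"
    by (rule kc.killed_law_limit[OF assms(1,2)])
  then show ?thesis
    unfolding surv_eq[OF assms(1)] iter_kstep_site[OF i(1,2), symmetric] i(3)[symmetric] .
qed

lemma surv_sets: "0 \<le> t \<Longrightarrow> surv m t \<in> sets (M m)"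
  using kc.survive_sets surv_eq by simp

lemma surv_alive: "0 \<le> t \<Longrightarrow> \<omega> \<in> surv m t \<Longrightarrow> X m t \<omega> \<in> A"
  by (simp add: surv_eq kc.survive_def)

lemma surv_decompose:
  assumes t: "0 \<le> t"
  shows "measure (M m) (surv m t) = (\<Sum>y\<in>A. measure (M m) {\<omega> \<in> surv m t. X m t \<omega> = y})"
proof -
  have union: "surv m t = (\<Union>y\<in>A. {\<omega> \<in> surv m t. X m t \<omega> = y})"
    using surv_alive[OF t] by blast
  have "{\<omega> \<in> surv m t. X m t \<omega> = y} \<in> sets (M m)" for y
  proof -
    have "{\<omega> \<in> surv m t. X m t \<omega> = y} = surv m t \<inter> {\<omega> \<in> space (M m). X m t \<omega> = y}"
      by (auto simp: surv_def)
    then show ?thesis using surv_sets[OF t] kc.X_eq_pred[OF t, of y] by (auto simp: pred_def)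
  qed
  then have "measure (M m) (\<Union>y\<in>A. {\<omega> \<in> surv m t. X m t \<omega> = y}) =
      (\<Sum>y\<in>A. measure (M m) {\<omega> \<in> surv m t. X m t \<omega> = y})"
    by (intro kc.finite_measure_finite_Union kc.finite_A) (auto simp: disjoint_family_on_def)
  then show ?thesis unfolding union[symmetric] .
qed

lemma conditional_law_integral:
  fixes f :: "real \<Rightarrow> real"
  assumes t: "0 \<le> t" and pos: "0 < measure (M m) (surv m t)"
  shows "prob_space (conditional_law (M m) (X m) \<epsilon> t)"
    and "(\<integral>x. f x \<partial>conditional_law (M m) (X m) \<epsilon> t) =
      (\<Sum>y\<in>A. measure (M m) {\<omega> \<in> surv m t. X m t \<omega> = y} * f y) / measure (M m) (surv m t)"
proof -
  let ?B = "surv m t"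
  define U where "U = uniform_measure (M m) ?B"
  have law: "conditional_law (M m) (X m) \<epsilon> t = distr U (count_space UNIV) (X m t)"
    by (simp add: conditional_law_def U_def surv_def)
  have B: "?B \<in> sets (M m)" by (rule surv_sets[OF t])
  have em: "emeasure (M m) ?B \<noteq> 0" "emeasure (M m) ?B \<noteq> \<infinity>"
    using pos by (auto simp: kc.emeasure_eq_measure)
  interpret U: prob_space U unfolding U_def by (rule prob_space_uniform_measure[OF em])
  have sets_U: "sets U = sets (M m)" by (simp add: U_def)
  have "X m t \<in> measurable (M m) (count_space UNIV)"
    using measurable_compose[OF kc.X_meas[OF t], of "\<lambda>x. x" "count_space UNIV"] by simp
  then have XU [measurable]: "X m t \<in> measurable U (count_space UNIV)"
    using sets_U by (simp cong: measurable_cong_sets)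
  show "prob_space (conditional_law (M m) (X m) \<epsilon> t)"
    unfolding law by (rule U.prob_space_distr[OF XU])
  let ?D = "\<lambda>y. {\<omega> \<in> space (M m). X m t \<omega> = y}"
  have D: "?D y \<in> sets (M m)" for y using kc.X_eq_pred[OF t, of y] by (simp add: pred_def)
  have DU [measurable]: "?D y \<in> sets U" for y using D sets_U by simp
  \<comment> \<open>Given survival, \<open>X m t\<close> lies in the finite set \<open>A\<close>, so
    \<open>f\<close> may be replaced by a finite combination of indicators.\<close>
  have AE: "AE \<omega> in U. f (X m t \<omega>) = (\<Sum>y\<in>A. f y * indicator (?D y) \<omega>)"
    unfolding U_def
  proof (rule AE_uniform_measureI[OF B], rule AE_I2, rule impI)
    fix \<omega> assume \<omega>: "\<omega> \<in> space (M m)" "\<omega> \<in> ?B"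
    then have XA: "X m t \<omega> \<in> A" using surv_alive[OF t] by simp
    have "(\<Sum>y\<in>A. f y * indicator (?D y) \<omega>) = (\<Sum>y\<in>A. if y = X m t \<omega> then f y else 0)"
      using \<omega> by (intro sum.cong) (auto simp: indicator_def)
    then show "f (X m t \<omega>) = (\<Sum>y\<in>A. f y * indicator (?D y) \<omega>)" using XA kc.finite_A by simp
  qed
  have "(\<integral>x. f x \<partial>conditional_law (M m) (X m) \<epsilon> t) = (\<integral>\<omega>. f (X m t \<omega>) \<partial>U)"
    unfolding law by (rule integral_distr[OF XU]) simp
  also have "\<dots> = (\<integral>\<omega>. (\<Sum>y\<in>A. f y * indicator (?D y) \<omega>) \<partial>U)"
  proof (rule integral_cong_AE[OF _ _ AE])
    show "(\<lambda>\<omega>. f (X m t \<omega>)) \<in> borel_measurable U" by (rule measurable_compose[OF XU]) simp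
    show "(\<lambda>\<omega>. \<Sum>y\<in>A. f y * indicator (?D y) \<omega>) \<in> borel_measurable U"
      by (intro borel_measurable_sum borel_measurable_times borel_measurable_const borel_measurable_indicator DU)
  qed
  also have "\<dots> = (\<Sum>y\<in>A. f y * measure U (?D y))"
    using DU by (subst Bochner_Integration.integral_sum) (auto simp: U.emeasure_eq_measure)
  also have "\<dots> = (\<Sum>y\<in>A. measure (M m) {\<omega> \<in> ?B. X m t \<omega> = y} * f y / measure (M m) ?B)"
  proof (intro sum.cong refl)
    fix y
    have "?B \<inter> ?D y = {\<omega> \<in> ?B. X m t \<omega> = y}" by (auto simp: surv_def)
    then have "measure U (?D y) = measure (M m) {\<omega> \<in> ?B. X m t \<omega> = y} / measure (M m) ?B"
      unfolding U_def using measure_uniform_measure[OF em D] by simp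
    then show "f y * measure U (?D y) = measure (M m) {\<omega> \<in> ?B. X m t \<omega> = y} * f y / measure (M m) ?B"
      by simp
  qed
  finally show "(\<integral>x. f x \<partial>conditional_law (M m) (X m) \<epsilon> t) =
      (\<Sum>y\<in>A. measure (M m) {\<omega> \<in> surv m t. X m t \<omega> = y} * f y) / measure (M m) (surv m t)"
    by (simp add: sum_divide_distrib)
qed

end

abbreviation "law i t \<equiv> conditional_law (M (e i)) (X (e i)) \<epsilon> t"

definition mass :: "nat \<Rightarrow> real \<Rightarrow> real" where
  "mass i t = measure (M (e i)) (surv (e i) t)"

lemma law_properties:
  fixes f :: "real \<Rightarrow> real"
  assumes i: "1 \<le> i" "i \<le> N" and t: "0 \<le> t"
  shows alive_limit: "(\<lambda>l. (step ((1/2) ^ l) ^^ nat \<lfloor>t * 2 ^ l\<rfloor>) alive i) \<longlonglongrightarrow> mass i t"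
    and mass_pos: "0 < mass i t"
    and law_prob_space: "prob_space (law i t)"
    and law_limit: "(\<And>y. y \<in> A \<Longrightarrow> \<bar>f y\<bar> \<le> 1) \<Longrightarrow>
      (\<lambda>l. (step ((1/2) ^ l) ^^ nat \<lfloor>t * 2 ^ l\<rfloor>) (lift f) i) \<longlonglongrightarrow> mass i t * (\<integral>x. f x \<partial>law i t)"
    and law_integral: "(\<integral>x. f x \<partial>law i t) = (\<Sum>y\<in>A. (\<integral>x. indicator {y} x \<partial>law i t) * f y)"
proof -
  have m: "e i \<in> A" using i e_in_A by simp
  obtain P where P: "killed_chain (M (e i)) (X (e i)) (E n) A (jump_rate \<beta> n) (e i) P (rate_bound n)"
    using killed_chain[OF m] by blast
  let ?p = "\<lambda>y. measure (M (e i)) {\<omega> \<in> surv (e i) t. X (e i) t \<omega> = y}"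
  \<comment> \<open>For the constant 1 the limit of the killed laws is the survival
    probability.\<close>
  have "lift (\<lambda>_. 1) = alive" by (auto simp: lift_def alive_def)
  then show V: "(\<lambda>l. (step ((1/2) ^ l) ^^ nat \<lfloor>t * 2 ^ l\<rfloor>) alive i) \<longlonglongrightarrow> mass i t"
    using killed_law[OF m P t, of "\<lambda>_. 1" i] i surv_decompose[OF m P t] by (simp add: mass_def)
  show pos: "0 < mass i t" by (rule survival_limit_pos[OF t i V])
  note law = conditional_law_integral[OF m P t pos[unfolded mass_def], folded mass_def]
  show "prob_space (law i t)" by (rule law(1))
  have finA: "finite A" using finite_subset[OF A_sub finite_E] .
  have ind: "(\<integral>x. indicator {y} x \<partial>law i t) = ?p y / mass i t" if "y \<in> A" for y
  proof -
    have "(\<Sum>z\<in>A. ?p z * indicator {y} z) = (\<Sum>z\<in>A. if z = y then ?p z else 0)"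
      by (intro sum.cong) auto
    then show ?thesis unfolding law(2) using that finA by simp
  qed
  show "(\<lambda>l. (step ((1/2) ^ l) ^^ nat \<lfloor>t * 2 ^ l\<rfloor>) (lift f) i) \<longlonglongrightarrow> mass i t * (\<integral>x. f x \<partial>law i t)"
    if f: "\<And>y. y \<in> A \<Longrightarrow> \<bar>f y\<bar> \<le> 1"
    using killed_law[where g = f, OF m P t f i refl] pos unfolding law(2) by simp
  have "(\<integral>x. f x \<partial>law i t) = (\<Sum>y\<in>A. ?p y / mass i t * f y)"
    unfolding law(2) sum_divide_distrib by simp
  also have "\<dots> = (\<Sum>y\<in>A. (\<integral>x. indicator {y} x \<partial>law i t) * f y)"
    using ind by (intro sum.cong refl) (simp only:)
  finally show "(\<integral>x. f x \<partial>law i t) = (\<Sum>y\<in>A. (\<integral>x. indicator {y} x \<partial>law i t) * f y)" .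
qed

lemma law_contraction:
  fixes f :: "real \<Rightarrow> real"
  assumes ij: "1 \<le> i" "i \<le> N" "1 \<le> j" "j \<le> N" and t: "0 \<le> t" "t \<le> t'"
    and f: "\<And>y. \<bar>f y\<bar> \<le> 1"
  shows "\<bar>(\<integral>x. f x \<partial>law j t') - (\<integral>x. f x \<partial>law i t)\<bar> \<le> C * exp (- c * t)"
proof -
  have t': "0 \<le> t'" using t by simp
  have lf: "lift f 0 = 0" "\<bar>lift f k\<bar> \<le> 1" for k using f by (auto simp: lift_def)
  have "\<bar>mass j t' * (\<integral>x. f x \<partial>law j t') / mass j t' - mass i t * (\<integral>x. f x \<partial>law i t) / mass i t\<bar>
      \<le> C * exp (- c * t)"
    by (rule ratio_limit_contraction[OF osc t lf ij law_limit[OF ij(1,2) t(1) f] alive_limit[OF ij(1,2) t(1)]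
          law_limit[OF ij(3,4) t' f] alive_limit[OF ij(3,4) t']])
  then show ?thesis using mass_pos[OF ij(1,2) t(1)] mass_pos[OF ij(3,4) t'] by simp
qed

text \<open>\<nu> is the limit along integer times of the laws started at the top site, which are
  Cauchy by \<open>law_contraction\<close>. Letting the later time tend to infinity in the same
  estimate gives the rate for every starting site.\<close>

lemma quasi_stationary:
  obtains \<nu> :: "real pmf" where "set_pmf \<nu> \<subseteq> A"
    "\<And>i t. 1 \<le> i \<Longrightarrow> i \<le> N \<Longrightarrow> 0 \<le> t \<Longrightarrow> d_TV (law i t) (measure_pmf \<nu>) \<le> C * exp (- c * t)"
proof -
  have NN: "1 \<le> N" "N \<le> N" using N_pos by auto
  have finA: "finite A" using finite_subset[OF A_sub finite_E] .
  define q where "q y k = (\<integral>x. indicat_real {y} x \<partial>law N (real k))" for y :: real and k :: nat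
  have rate0: "(\<lambda>k. C * exp (- c * real k)) \<longlonglongrightarrow> 0" using c by real_asymp
  have "Cauchy (q y)" for y
  proof (rule metric_CauchyI)
    fix r :: real assume "0 < r"
    then have "\<forall>\<^sub>F k in sequentially. C * exp (- c * real k) < r / 2"
      using rate0 by (intro order_tendstoD(2)) auto
    then obtain k0 where k0: "C * exp (- c * real k0) < r / 2" unfolding eventually_sequentially by blast
    have "\<bar>q y k - q y k0\<bar> < r / 2" if "k0 \<le> k" for k
    proof -
      have "\<bar>q y k - q y k0\<bar> \<le> C * exp (- c * real k0)"
        unfolding q_def using that by (intro law_contraction[OF NN NN]) (auto simp: indicator_def)
      then show ?thesis using k0 by linarith
    qed
    then have "dist (q y k) (q y k') < r" if "k0 \<le> k" "k0 \<le> k'" for k k'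
      using that unfolding dist_real_def by (smt (verit) field_sum_of_halves)
    then show "\<exists>M. \<forall>m\<ge>M. \<forall>n\<ge>M. dist (q y m) (q y n) < r" by blast
  qed
  then have lim_q: "q y \<longlonglongrightarrow> lim (q y)" for y
    by (simp add: Cauchy_convergent_iff convergent_LIMSEQ_iff)
  define p where "p y = (if y \<in> A then lim (q y) else 0)" for y
  have lim_law: "(\<lambda>k. (\<integral>x. f x \<partial>law N (real k))) \<longlonglongrightarrow> (\<Sum>y\<in>A. p y * f y)" for f :: "real \<Rightarrow> real"
  proof -
    have "(\<integral>x. f x \<partial>law N (real k)) = (\<Sum>y\<in>A. q y k * f y)" for k
      unfolding q_def by (rule law_integral[OF NN]) simp
    moreover have "(\<lambda>k. \<Sum>y\<in>A. q y k * f y) \<longlonglongrightarrow> (\<Sum>y\<in>A. lim (q y) * f y)"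
      by (intro tendsto_intros lim_q)
    ultimately show ?thesis by (simp add: p_def)
  qed
  have q_nonneg: "0 \<le> q y k" for y k unfolding q_def by (rule integral_nonneg_AE) simp
  have p_nonneg: "0 \<le> p y" for y
    using LIMSEQ_le_const[OF lim_q, of 0 y] q_nonneg by (auto simp: p_def)
  have "(\<integral>x. (1 :: real) \<partial>law N (real k)) = 1" for k
  proof -
    interpret prob_space "law N (real k)" by (rule law_prob_space[OF NN]) simp
    show ?thesis using prob_space by simp
  qed
  then have p_sum: "(\<Sum>y\<in>A. p y) = 1"
    using lim_law[of "\<lambda>_. 1"] by (simp add: LIMSEQ_const_iff)
  have nn: "(\<integral>\<^sup>+x. ennreal (p x) \<partial>count_space UNIV) = 1"
  proof -
    have "(\<integral>\<^sup>+x. ennreal (p x) \<partial>count_space UNIV) = (\<Sum>x\<in>A. ennreal (p x))"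
      by (rule nn_integral_count_space'[OF finA]) (auto simp: p_def)
    also have "\<dots> = ennreal (\<Sum>x\<in>A. p x)" using p_nonneg by (simp add: sum_ennreal)
    finally show ?thesis by (simp add: p_sum)
  qed
  define \<nu> where "\<nu> = embed_pmf p"
  have pmf: "pmf \<nu> y = p y" for y unfolding \<nu>_def by (rule pmf_embed_pmf[OF p_nonneg nn])
  have set: "set_pmf \<nu> \<subseteq> A" using pmf by (auto simp: set_pmf_eq p_def)
  have integral: "(\<integral>x. f x \<partial>measure_pmf \<nu>) = (\<Sum>y\<in>A. p y * f y)" for f :: "real \<Rightarrow> real"
    using set finA by (subst integral_measure_pmf_real[of A]) (auto simp: pmf mult.commute)
  show thesis
  proof (rule that[OF set])
    fix i t assume i: "1 \<le> i" "i \<le> N" and t: "0 \<le> (t :: real)"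
    show "d_TV (law i t) (measure_pmf \<nu>) \<le> C * exp (- c * t)"
      unfolding d_TV_def
    proof (rule cSUP_least)
      show "{f :: real \<Rightarrow> real. f \<in> borel_measurable (law i t) \<and> f \<in> borel_measurable (measure_pmf \<nu>) \<and> (\<forall>x. \<bar>f x\<bar> \<le> 1)} \<noteq> {}"
        by (auto intro!: exI[of _ "\<lambda>_. 0"])
      fix f :: "real \<Rightarrow> real"
      assume "f \<in> {f :: real \<Rightarrow> real. f \<in> borel_measurable (law i t) \<and> f \<in> borel_measurable (measure_pmf \<nu>) \<and> (\<forall>x. \<bar>f x\<bar> \<le> 1)}"
      then have f: "\<bar>f x\<bar> \<le> 1" for x by blast
      have "(\<lambda>k. \<bar>(\<integral>x. f x \<partial>law N (real k)) - (\<integral>x. f x \<partial>law i t)\<bar>)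
          \<longlonglongrightarrow> \<bar>(\<integral>x. f x \<partial>measure_pmf \<nu>) - (\<integral>x. f x \<partial>law i t)\<bar>"
        unfolding integral by (intro tendsto_intros lim_law)
      moreover have "\<forall>\<^sub>F k in sequentially. \<bar>(\<integral>x. f x \<partial>law N (real k)) - (\<integral>x. f x \<partial>law i t)\<bar> \<le> C * exp (- c * t)"
        using eventually_ge_at_top[of "nat \<lceil>t\<rceil>"]
      proof eventually_elim
        case (elim k)
        then have "t \<le> real k" by linarith
        then show ?case by (rule law_contraction[OF i NN t _ f])
      qed
      ultimately have "\<bar>(\<integral>x. f x \<partial>measure_pmf \<nu>) - (\<integral>x. f x \<partial>law i t)\<bar> \<le> C * exp (- c * t)"
        by (rule tendsto_upperbound) simp
      then show "(\<integral>x. f x \<partial>law i t) - (\<integral>x. f x \<partial>measure_pmf \<nu>) \<le> C * exp (- c * t)" by linarith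
    qed
  qed
qed

end

section \<open>Uniqueness of the limit law\<close>

text \<open>A real supremum dominates its members only over a bounded set; each integral is at most
  1 in absolute value, hence the bound 2.\<close>

lemma d_TV_ge:
  fixes \<mu> \<nu> :: "'b measure" and f :: "'b \<Rightarrow> real"
  assumes "prob_space \<mu>" "prob_space \<nu>"
    and f: "f \<in> borel_measurable \<mu>" "f \<in> borel_measurable \<nu>" "\<And>x. \<bar>f x\<bar> \<le> 1"
  shows "(\<integral>x. f x \<partial>\<mu>) - (\<integral>x. f x \<partial>\<nu>) \<le> d_TV \<mu> \<nu>"
  unfolding d_TV_def
proof (rule cSUP_upper)
  interpret \<mu>: prob_space \<mu> by fact
  interpret \<nu>: prob_space \<nu> by fact
  have bound: "\<bar>\<integral>x. g x \<partial>L\<bar> \<le> 1" if "prob_space L" "g \<in> borel_measurable L" "\<forall>x. \<bar>g x\<bar> \<le> 1"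
    for g :: "'b \<Rightarrow> real" and L :: "'b measure"
  proof -
    interpret L: prob_space L by fact
    have "integrable L g" using that by (intro L.integrable_const_bound[where B = 1]) auto
    then have "\<bar>\<integral>x. g x \<partial>L\<bar> \<le> (\<integral>x. 1 \<partial>L)"
      using that by (intro order_trans[OF integral_abs_bound integral_mono]) auto
    then show ?thesis by (simp add: L.prob_space)
  qed
  show "bdd_above ((\<lambda>f :: 'b \<Rightarrow> real. (\<integral>x. f x \<partial>\<mu>) - (\<integral>x. f x \<partial>\<nu>)) `
      {f. f \<in> borel_measurable \<mu> \<and> f \<in> borel_measurable \<nu> \<and> (\<forall>x. \<bar>f x\<bar> \<le> 1)})"
  proof (rule bdd_aboveI[where M = 2])
    fix r assume "r \<in> (\<lambda>f :: 'b \<Rightarrow> real. (\<integral>x. f x \<partial>\<mu>) - (\<integral>x. f x \<partial>\<nu>)) `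
      {f. f \<in> borel_measurable \<mu> \<and> f \<in> borel_measurable \<nu> \<and> (\<forall>x. \<bar>f x\<bar> \<le> 1)}"
    then obtain g :: "'b \<Rightarrow> real" where "r = (\<integral>x. g x \<partial>\<mu>) - (\<integral>x. g x \<partial>\<nu>)" "g \<in> {f. f \<in> borel_measurable \<mu> \<and> f \<in> borel_measurable \<nu> \<and> (\<forall>x. \<bar>f x\<bar> \<le> 1)}"
      by blast
    then show "r \<le> 2"
      using bound[OF assms(1), of g] bound[OF assms(2), of g] by auto
  qed
qed (use f in auto)

text \<open>Testing with plus and minus the indicator of \<open>{y}\<close> shows that the masses at
  \<open>y\<close> converge to those of both limits; \<open>sets (L k) = UNIV\<close> makes every
  test function measurable.\<close>

lemma pmf_eq_if_d_TV_tendsto_0: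
  fixes \<mu> \<nu> :: "'b pmf" and L :: "nat \<Rightarrow> 'b measure"
  assumes L: "\<And>k. prob_space (L k)" "\<And>k. sets (L k) = UNIV"
    and \<mu>: "\<And>k. d_TV (L k) (measure_pmf \<mu>) \<le> r k" "r \<longlonglongrightarrow> 0"
    and \<nu>: "\<And>k. d_TV (L k) (measure_pmf \<nu>) \<le> s k" "s \<longlonglongrightarrow> 0"
  shows "\<mu> = \<nu>"
proof (rule pmf_eqI)
  fix y
  have conv: "(\<lambda>k. measure (L k) {y}) \<longlonglongrightarrow> pmf \<rho> y"
    if \<rho>: "\<And>k. d_TV (L k) (measure_pmf \<rho>) \<le> r k" "r \<longlonglongrightarrow> 0" for \<rho> :: "'b pmf" and r
  proof -
    have bound: "\<bar>measure (L k) {y} - pmf \<rho> y\<bar> \<le> r k" for k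
    proof -
      interpret prob_space "L k" by (rule L)
      have space: "space (L k) = UNIV" using L(2)[of k] sets.top sets.space_closed[of "L k"] by blast
      have meas: "g \<in> borel_measurable (L k)" for g :: "'b \<Rightarrow> real"
        by (rule measurableI) (auto simp: L space)
      have int: "(\<integral>x. s * indicator {y} x \<partial>L k) = s * measure (L k) {y}"
        "(\<integral>x. s * indicator {y} x \<partial>measure_pmf \<rho>) = s * pmf \<rho> y" for s :: real
        by (simp_all add: L space measure_pmf_single)
      have "(\<integral>x. s * indicator {y} x \<partial>L k) - (\<integral>x. s * indicator {y} x \<partial>measure_pmf \<rho>)
          \<le> d_TV (L k) (measure_pmf \<rho>)" if "\<bar>s\<bar> = 1" for s :: real
        using that by (intro d_TV_ge L measure_pmf.prob_space_axioms meas) (auto simp: indicator_def)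
      from this[of 1] this[of "-1"] show ?thesis unfolding int using \<rho>(1)[of k] by simp
    qed
    have "(\<lambda>k. measure (L k) {y} - pmf \<rho> y) \<longlonglongrightarrow> 0"
      by (rule Lim_null_comparison[OF _ \<rho>(2)]) (use bound in simp)
    then show ?thesis by (rule LIM_zero_cancel)
  qed
  show "pmf \<mu> y = pmf \<nu> y"
    using conv[OF \<mu>] conv[OF \<nu>] by (rule LIMSEQ_unique)
qed

theorem theorem1:
  fixes \<beta> \<epsilon> :: real
    and M :: "nat \<Rightarrow> real \<Rightarrow> 'a measure"
    and X :: "nat \<Rightarrow> real \<Rightarrow> real \<Rightarrow> 'a \<Rightarrow> real"
  assumes "\<beta> > 1"
    and "0 < \<epsilon>" "\<epsilon> < m_plus \<beta>" "\<epsilon> \<notin> \<rat>"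
    and "\<And>n m0. n \<ge> 1 \<Longrightarrow> m0 \<in> E_eps \<epsilon> n \<Longrightarrow>
           markov_chain (M n m0) (X n m0) (E n) (jump_rate \<beta> n) m0"
  shows "\<exists>\<nu> :: nat \<Rightarrow> real pmf.
           (\<forall>n\<ge>1. set_pmf (\<nu> n) \<subseteq> E_eps \<epsilon> n) \<and>
           (\<forall>\<eta>\<in>{\<epsilon><..<m_plus \<beta>}. \<exists>c>0. \<exists>C>0. \<forall>n\<ge>1. \<forall>m0\<in>{\<eta>..1} \<inter> E_eps \<epsilon> n. \<forall>t\<ge>0.
              d_TV (conditional_law (M n m0) (X n m0) \<epsilon> t) (measure_pmf (\<nu> n))
                \<le> C * real n * exp (- c * t)) \<and>
           (\<forall>n\<ge>1. \<forall>\<mu> :: real pmf.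
              set_pmf \<mu> \<subseteq> E_eps \<epsilon> n \<and>
              (\<forall>\<eta>\<in>{\<epsilon><..<m_plus \<beta>}. \<exists>c>0. \<exists>C>0. \<forall>m0\<in>{\<eta>..1} \<inter> E_eps \<epsilon> n. \<forall>t\<ge>0.
                 d_TV (conditional_law (M n m0) (X n m0) \<epsilon> t) (measure_pmf \<mu>)
                   \<le> C * real n * exp (- c * t))
              \<longrightarrow> \<mu> = \<nu> n)"
proof -
  interpret curie_weiss \<beta> by (rule curie_weiss.intro) (rule assms(1))
  have \<epsilon>1: "\<epsilon> < 1" using assms(3) ex1_m_plus(3)[OF assms(1)] by linarith
  obtain c C where cC: "0 < c" "0 < C" and osc: "\<And>n. 1 \<le> n \<Longrightarrow>
     killed_birth_death.osc_decay (levels \<epsilon> n) (birth \<epsilon> n) (death \<epsilon> n) c (C * real n)"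
    using contraction_uniform[OF assms(2,3)] by blast
  have chains: "curie_weiss_chains \<beta> \<epsilon> n (M n) (X n) c (C * real n)" if "1 \<le> n" for n
    using assms(2,4) \<epsilon>1 that assms(5)[OF that] osc[OF that] cC(1)
    by (intro curie_weiss_chains.intro curie_weiss_axioms curie_weiss_chains_axioms.intro)
  define law where "law n m t = conditional_law (M n m) (X n m) \<epsilon> t" for n m t
  have "\<exists>\<nu> :: real pmf. 1 \<le> n \<longrightarrow> set_pmf \<nu> \<subseteq> E_eps \<epsilon> n \<and>
     (\<forall>m\<in>E_eps \<epsilon> n. \<forall>t\<ge>0. d_TV (law n m t) (measure_pmf \<nu>) \<le> C * real n * exp (- c * t))" for n
  proof (cases "1 \<le> n")
    case True
    interpret curie_weiss_chains \<beta> \<epsilon> n "M n" "X n" c "C * real n" by (rule chains[OF True])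
    obtain \<nu> :: "real pmf" where "set_pmf \<nu> \<subseteq> E_eps \<epsilon> n"
      "\<And>i t. 1 \<le> i \<Longrightarrow> i \<le> levels \<epsilon> n \<Longrightarrow> 0 \<le> t \<Longrightarrow>
         d_TV (law n (site \<epsilon> n i) t) (measure_pmf \<nu>) \<le> C * real n * exp (- c * t)"
      unfolding law_def using quasi_stationary by blast
    then show ?thesis using A_eq by (intro exI[of _ \<nu>]) auto
  qed simp
  then obtain \<nu> :: "nat \<Rightarrow> real pmf" where \<nu>: "\<And>n. 1 \<le> n \<Longrightarrow> set_pmf (\<nu> n) \<subseteq> E_eps \<epsilon> n"
    "\<And>n m t. 1 \<le> n \<Longrightarrow> m \<in> E_eps \<epsilon> n \<Longrightarrow> 0 \<le> t \<Longrightarrow>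
       d_TV (law n m t) (measure_pmf (\<nu> n)) \<le> C * real n * exp (- c * t)"
    by metis
  have unique: "\<mu> = \<nu> n"
    if n: "1 \<le> n" and \<mu>: "\<forall>\<eta>\<in>{\<epsilon><..<m_plus \<beta>}. \<exists>c>0. \<exists>C>0. \<forall>m0\<in>{\<eta>..1} \<inter> E_eps \<epsilon> n. \<forall>t\<ge>0.
      d_TV (law n m0 t) (measure_pmf \<mu>) \<le> C * real n * exp (- c * t)" for n \<mu>
  proof -
    interpret curie_weiss_chains \<beta> \<epsilon> n "M n" "X n" c "C * real n" by (rule chains[OF n])
    have top: "site \<epsilon> n (levels \<epsilon> n) = 1" by (rule site_top[OF assms(2) \<epsilon>1 n])
    have one: "1 \<in> E_eps \<epsilon> n" using e_in_A[of "levels \<epsilon> n"] N_pos top by simp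
    \<comment> \<open>A single \<eta> is enough to identify the limit; the starting state 1 is the
      top site and lies in \<open>{\<eta>..1}\<close>. With \<open>n\<close> fixed, the constants of
      \<mu> may depend on \<open>n\<close>.\<close>
    define \<eta> where "\<eta> = (\<epsilon> + m_plus \<beta>) / 2"
    have \<eta>: "\<eta> \<in> {\<epsilon><..<m_plus \<beta>}" "\<eta> \<le> 1"
      using assms(3) ex1_m_plus(3)[OF assms(1)] by (auto simp: \<eta>_def)
    obtain c' C' where c': "0 < c'" and bound: "\<And>t. 0 \<le> t \<Longrightarrow>
        d_TV (law n 1 t) (measure_pmf \<mu>) \<le> C' * real n * exp (- c' * t)"
      using bspec[OF \<mu> \<eta>(1)] one \<eta>(2) by (metis IntI atLeastAtMost_iff order_refl)
    show ?thesis
    proof (rule pmf_eq_if_d_TV_tendsto_0)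
      show "prob_space (law n 1 (real k))" for k
        using law_prob_space[of "levels \<epsilon> n" "real k"] N_pos unfolding law_def top by simp
      show "sets (law n 1 (real k)) = UNIV" for k
        by (simp add: law_def conditional_law_def)
      show "d_TV (law n 1 (real k)) (measure_pmf \<mu>) \<le> C' * real n * exp (- c' * real k)" for k
        by (rule bound) simp
      show "(\<lambda>k. C' * real n * exp (- c' * real k)) \<longlonglongrightarrow> 0" using c' by real_asymp
      show "d_TV (law n 1 (real k)) (measure_pmf (\<nu> n)) \<le> C * real n * exp (- c * real k)" for k
        by (rule \<nu>(2)[OF n one]) simp
      show "(\<lambda>k. C * real n * exp (- c * real k)) \<longlonglongrightarrow> 0" using cC(1) by real_asymp
    qed
  qed
  show ?thesis
    unfolding law_def[symmetric]
  proof (intro exI[of _ \<nu>] conjI ballI allI impI)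
    show "set_pmf (\<nu> n) \<subseteq> E_eps \<epsilon> n" if "1 \<le> n" for n by (rule \<nu>(1)[OF that])
    show "\<exists>c>0. \<exists>C>0. \<forall>n\<ge>1. \<forall>m0\<in>{\<eta>..1} \<inter> E_eps \<epsilon> n. \<forall>t\<ge>0.
        d_TV (law n m0 t) (measure_pmf (\<nu> n)) \<le> C * real n * exp (- c * t)" for \<eta>
      using \<nu>(2) cC by blast
    show "\<mu> = \<nu> n" if "1 \<le> n" "set_pmf \<mu> \<subseteq> E_eps \<epsilon> n \<and>
        (\<forall>\<eta>\<in>{\<epsilon><..<m_plus \<beta>}. \<exists>c>0. \<exists>C>0. \<forall>m0\<in>{\<eta>..1} \<inter> E_eps \<epsilon> n. \<forall>t\<ge>0.
           d_TV (law n m0 t) (measure_pmf \<mu>) \<le> C * real n * exp (- c * t))" for n \<mu>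
      using unique[OF that(1)] that(2) by blast
  qed
qed

end
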